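(* Let $p=(1+\varepsilon)/n$ where $\varepsilon=\varepsilon(n)$ satisfies $\varepsilon\to 0$ and $\varepsilon^3 n\to\infty$ as $n\to\infty$. Then there is a constant $\gamma>0$ such that with high probability $\mathrm{spr}(H_{n,p})\ge \gamma/\varepsilon^2$, i.e. $\mathrm{spr}(H_{n,p})=\Omega(1/\varepsilon^2)$.
   Context: $G_{n,p}$ is the Erdős–Rényi random graph on $n$ vertices with edge probability $p$; $H_{n,p}$ denotes its largest component. "With high probability" means with probability $1-o(1)$ as $n\to\infty$. A Lipschitz function on a graph is a real function on its vertices with $|f(v)-f(w)|\le1$ for adjacent $v,w$; $\mathrm{Var}(f)$ is the variance of $f(X)$ for $X$ uniform on the vertex set; for a connected graph $G$ the spread $\mathrm{spr}(G)$ is the supremum of $\mathrm{Var}(f)$ over Lipschitz functions $f$ on $G$. *)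

theory Defs
  imports Complex_Main
begin

(* Vertex set of G_{n,p} is {..<n}; a graph is a set of edges, each edge a 2-element set. *)
definition all_edges :: "nat \<Rightarrow> nat set set" where
  "all_edges n = {e. \<exists>u v. u < n \<and> v < n \<and> u \<noteq> v \<and> e = {u, v}}"

definition gnp_prob :: "nat \<Rightarrow> real \<Rightarrow> (nat set set \<Rightarrow> bool) \<Rightarrow> real" where
  "gnp_prob n p P = (\<Sum>E\<in>Pow (all_edges n).
      if P E then p ^ card E * (1 - p) ^ (card (all_edges n) - card E) else 0)"

definition component :: "nat \<Rightarrow> nat set set \<Rightarrow> nat \<Rightarrow> nat set" where
  "component n E v = {w. w < n \<and> (v, w) \<in> {(a, b). {a, b} \<in> E}\<^sup>*}"

definition components :: "nat \<Rightarrow> nat set set \<Rightarrow> nat set set" where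
  "components n E = component n E ` {..<n}"

definition is_largest_component :: "nat \<Rightarrow> nat set set \<Rightarrow> nat set \<Rightarrow> bool" where
  "is_largest_component n E C \<longleftrightarrow>
     C \<in> components n E \<and> (\<forall>C' \<in> components n E. card C' \<le> card C)"

definition lipschitz_on_graph :: "'a set \<Rightarrow> 'a set set \<Rightarrow> ('a \<Rightarrow> real) \<Rightarrow> bool" where
  "lipschitz_on_graph V E f \<longleftrightarrow>
     (\<forall>u\<in>V. \<forall>v\<in>V. {u, v} \<in> E \<longrightarrow> \<bar>f u - f v\<bar> \<le> 1)"

definition unif_variance :: "'a set \<Rightarrow> ('a \<Rightarrow> real) \<Rightarrow> real" where
  "unif_variance V f =
     (let m = (\<Sum>v\<in>V. f v) / real (card V) in (\<Sum>v\<in>V. (f v - m)\<^sup>2) / real (card V))"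

definition spread :: "'a set \<Rightarrow> 'a set set \<Rightarrow> real" where
  "spread V E = (SUP f \<in> {f. lipschitz_on_graph V E f}. unif_variance V f)"

end

(*
  Write "arm of length k at v" for a trail of k distinct edges starting at v. By the van den
  Berg-Kesten and Harris inequalities its probability theta_k satisfies
  theta_(k+1) <= 1 - (1 - p theta_k)^n, hence theta_k = O(1/k) for k <= 1/eps. Let h be a small
  multiple of 1/eps. Expected ball sizes show that |B(v,4h)| > K h^2 has probability O(eps/K).
  If v has an arm of length 3h, then |B(v,2h)| < kappa h^2 forces a small sphere which some arm of
  length h must leave; by exposing the ball inside that sphere this has probability O(kappa eps).
  Counts of increasing local events concentrate, because disjoint occurrence costs at most the
  product and non-disjoint occurrence makes the two vertices close.

  The component of v is compared with that in a random induced subgraph on m = n - 1.5 eps n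
  vertices, which is subcritical: this gives P(|C(v)| > eps n / 8) >= eps and shows that few
  vertices with long arms lie in small components. So with high probability the largest
  component C has more than eps n / 8 vertices, and at least half of them satisfy
  |B(v,2h)| >= kappa h^2 and |B(v,4h)| <= K h^2. A greedily chosen 4h-separated set S of such
  vertices has |B(S,2h)| >= c |C| and |B(S,4h)| <= |C|/4, so the distance to S truncated at 4h has
  variance of order h^2.
*)
theory Submission
  imports Defs
begin

subsection \<open>Product measure on edge sets and correlation inequalities\<close>

text \<open>The event that some vertex lies at distance \<open>k\<close> from \<open>v\<close> is
  not increasing, since new edges shorten distances, so the correlation inequalities do not apply to
  it. A trail of \<open>k\<close> distinct edges is an increasing local event, and by disjoint
  occurrence each of its edges costs a factor \<open>p\<close>. The price is that a trail may close
  up on itself: a separate count shows that an arm without a vertex at distance \<open>k\<close> has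
  probability O(k^2 p), which for k = O(1/eps) is O(eps / (eps^3 n)), negligible against eps.
  Removing y n vertices leaves mean degree (1 - y)(1 + eps), below 1 once y > eps. Comparing
  component laws up to size k0 needs, to first order, y/2 + k0/n <= eps. The choice y = 1.5 eps and
  k0 = eps n / 8 satisfies both with room to spare. Only local counts are handled by a variance
  bound: the variance is O(n/eps) and the deviations are of order eps n, so each failure probability
  is O(1/(eps^3 n)). Lying in a small component is not local, and there a first moment suffices
  because the smaller graph is subcritical.\<close>

definition expec :: "real \<Rightarrow> 'e set \<Rightarrow> ('e set \<Rightarrow> real) \<Rightarrow> real" where
  "expec p F X = (\<Sum>E\<in>Pow F. p ^ card E * (1 - p) ^ (card F - card E) * X E)"

definition prob :: "real \<Rightarrow> 'e set \<Rightarrow> ('e set \<Rightarrow> bool) \<Rightarrow> real" where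
  "prob p F P = expec p F (\<lambda>E. of_bool (P E))"

lemma gnp_prob_eq: "gnp_prob n p P = prob p (all_edges n) P"
  unfolding gnp_prob_def prob_def expec_def by (intro sum.cong) auto

lemma expec_cong: "(\<And>E. E \<subseteq> F \<Longrightarrow> X E = Y E) \<Longrightarrow> expec p F X = expec p F Y"
  unfolding expec_def by (intro sum.cong) auto

lemma prob_cong: "(\<And>E. E \<subseteq> F \<Longrightarrow> P E = Q E) \<Longrightarrow> prob p F P = prob p F Q"
  unfolding prob_def by (intro expec_cong) auto

lemma expec_empty [simp]: "expec p {} X = X {}"
  by (simp add: expec_def)

text \<open>Conditioning on whether \<open>e\<close> is present. The ground set is an arbitrary
  finite set, not the edge set of a complete graph, so that the correlation inequalities can be
  proved by removing one element at a time.\<close>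

lemma expec_insert:
  assumes "finite F" "e \<notin> F"
  shows "expec p (insert e F) X = (1 - p) * expec p F X + p * expec p F (\<lambda>E. X (insert e E))"
proof -
  have inj: "inj_on (insert e) (Pow F)"
    using assms(2) by (auto simp: inj_on_def)
  have dis: "Pow F \<inter> insert e ` Pow F = {}" using assms(2) by auto
  have c: "card E \<le> card F" "finite E" "e \<notin> E" if "E \<subseteq> F" for E
    using that assms by (auto simp: card_mono finite_subset)
  have "expec p (insert e F) X =
      (\<Sum>E\<in>Pow F. p ^ card E * (1 - p) ^ (card (insert e F) - card E) * X E)
    + (\<Sum>E\<in>insert e ` Pow F. p ^ card E * (1 - p) ^ (card (insert e F) - card E) * X E)"
    unfolding expec_def Pow_insert using assms dis
    by (subst sum.union_disjoint) auto
  also have "(\<Sum>E\<in>Pow F. p ^ card E * (1 - p) ^ (card (insert e F) - card E) * X E)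
      = (1 - p) * expec p F X"
    unfolding expec_def sum_distrib_left using assms c
    by (intro sum.cong) (auto simp: Suc_diff_le)
  also have "(\<Sum>E\<in>insert e ` Pow F. p ^ card E * (1 - p) ^ (card (insert e F) - card E) * X E)
      = p * expec p F (\<lambda>E. X (insert e E))"
    unfolding expec_def sum_distrib_left using assms c
    by (subst sum.reindex[OF inj], intro sum.cong) auto
  finally show ?thesis .
qed

lemma expec_add: "expec p F (\<lambda>E. X E + Y E) = expec p F X + expec p F Y"
  by (simp add: expec_def sum.distrib algebra_simps)

lemma expec_diff: "expec p F (\<lambda>E. X E - Y E) = expec p F X - expec p F Y"
  by (simp add: expec_def sum_subtractf algebra_simps)

lemma expec_cmult: "expec p F (\<lambda>E. c * X E) = c * expec p F X"
  by (simp add: expec_def sum_distrib_left algebra_simps)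

lemma expec_sum: "expec p F (\<lambda>E. \<Sum>i\<in>I. X i E) = (\<Sum>i\<in>I. expec p F (X i))"
  unfolding expec_def by (subst sum.swap) (simp add: sum_distrib_left)

lemma expec_const: "finite F \<Longrightarrow> expec p F (\<lambda>_. c) = c"
  by (induction F rule: finite_induct) (auto simp: expec_insert algebra_simps)

lemma expec_mono:
  assumes "0 \<le> p" "p \<le> 1" "\<And>E. E \<subseteq> F \<Longrightarrow> X E \<le> Y E"
  shows "expec p F X \<le> expec p F Y"
  unfolding expec_def using assms by (intro sum_mono mult_left_mono) auto

lemma expec_nonneg:
  assumes "0 \<le> p" "p \<le> 1" "\<And>E. E \<subseteq> F \<Longrightarrow> 0 \<le> X E"
  shows "0 \<le> expec p F X"
  unfolding expec_def using assms by (intro sum_nonneg) auto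

lemma prob_nonneg: "0 \<le> p \<Longrightarrow> p \<le> 1 \<Longrightarrow> 0 \<le> prob p F P"
  unfolding prob_def by (intro expec_nonneg) auto

lemma prob_mono:
  assumes "0 \<le> p" "p \<le> 1" "\<And>E. E \<subseteq> F \<Longrightarrow> P E \<Longrightarrow> Q E"
  shows "prob p F P \<le> prob p F Q"
  unfolding prob_def using assms by (intro expec_mono) auto

lemma prob_True: "finite F \<Longrightarrow> prob p F (\<lambda>_. True) = 1"
  by (simp add: prob_def expec_const)

lemma prob_False: "finite F \<Longrightarrow> prob p F (\<lambda>_. False) = 0"
  by (simp add: prob_def expec_const)

lemma prob_le_1: "finite F \<Longrightarrow> 0 \<le> p \<Longrightarrow> p \<le> 1 \<Longrightarrow> prob p F P \<le> 1"
  using prob_mono[of p F P "\<lambda>_. True"] by (simp add: prob_True)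

lemma prob_Not: "finite F \<Longrightarrow> prob p F (\<lambda>E. \<not> P E) = 1 - prob p F P"
  using expec_diff[of p F "\<lambda>_. 1" "\<lambda>E. of_bool (P E)"]
  by (simp add: prob_def expec_const of_bool_not_iff)

lemma prob_insert:
  "finite F \<Longrightarrow> e \<notin> F \<Longrightarrow>
    prob p (insert e F) P = (1 - p) * prob p F P + p * prob p F (\<lambda>E. P (insert e E))"
  by (simp add: prob_def expec_insert)

lemma prob_disj:
  "prob p F (\<lambda>E. P E \<or> Q E) + prob p F (\<lambda>E. P E \<and> Q E) = prob p F P + prob p F Q"
  unfolding prob_def expec_add[symmetric] by (intro expec_cong) auto

lemma prob_disj_le:
  "0 \<le> p \<Longrightarrow> p \<le> 1 \<Longrightarrow> prob p F (\<lambda>E. P E \<or> Q E) \<le> prob p F P + prob p F Q"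
  using prob_disj[of p F P Q] prob_nonneg[of p F "\<lambda>E. P E \<and> Q E"] by simp

lemma prob_le_expec:
  assumes "0 \<le> p" "p \<le> 1" "\<And>E. E \<subseteq> F \<Longrightarrow> of_bool (P E) \<le> X E"
  shows "prob p F P \<le> expec p F X"
  unfolding prob_def using assms by (intro expec_mono) auto

lemma prob_Ex_le:
  assumes "0 \<le> p" "p \<le> 1" "finite U"
  shows "prob p F (\<lambda>E. \<exists>u\<in>U. P u E) \<le> (\<Sum>u\<in>U. prob p F (P u))"
proof -
  have "of_bool (\<exists>u\<in>U. P u E) \<le> (\<Sum>u\<in>U. of_bool (P u E) :: real)" for E
  proof (cases "\<exists>u\<in>U. P u E")
    case True
    then obtain u where "u \<in> U" "P u E" by auto
    then show ?thesis using member_le_sum[of u U "\<lambda>u. of_bool (P u E) :: real"] assms by auto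
  qed (auto intro: sum_nonneg)
  then show ?thesis
    unfolding prob_def expec_sum[symmetric] using assms by (intro expec_mono) auto
qed

lemma markov:
  assumes "0 \<le> p" "p \<le> 1" "a > 0" "\<And>E. E \<subseteq> F \<Longrightarrow> 0 \<le> X E"
  shows "prob p F (\<lambda>E. X E \<ge> a) \<le> expec p F X / a"
proof -
  have "prob p F (\<lambda>E. X E \<ge> a) \<le> expec p F (\<lambda>E. (1/a) * X E)"
    using assms by (intro prob_le_expec) (auto simp: field_simps)
  then show ?thesis by (simp only: expec_cmult) simp
qed

lemma chebyshev:
  assumes "finite F" "0 \<le> p" "p \<le> 1" "a > 0" "expec p F (\<lambda>E. (X E)\<^sup>2) \<le> (expec p F X)\<^sup>2 + V"
  shows "prob p F (\<lambda>E. \<bar>X E - expec p F X\<bar> \<ge> a) \<le> V / a\<^sup>2"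
proof -
  define m where "m = expec p F X"
  have "prob p F (\<lambda>E. \<bar>X E - m\<bar> \<ge> a) \<le> prob p F (\<lambda>E. (X E - m)\<^sup>2 \<ge> a\<^sup>2)"
    using assms by (intro prob_mono) (auto simp: abs_le_square_iff[symmetric])
  also have "\<dots> \<le> expec p F (\<lambda>E. (X E - m)\<^sup>2) / a\<^sup>2"
    using assms by (intro markov) auto
  also have "expec p F (\<lambda>E. (X E - m)\<^sup>2) = expec p F (\<lambda>E. ((X E)\<^sup>2 - 2 * m * X E) + m\<^sup>2)"
    by (intro expec_cong) (simp add: power2_eq_square algebra_simps)
  also have "\<dots> = expec p F (\<lambda>E. (X E)\<^sup>2) - 2 * m * m + m\<^sup>2"
    using assms(1) by (simp only: expec_add expec_diff expec_cmult expec_const m_def)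
  also have "\<dots> \<le> V" using assms(5) by (simp add: m_def power2_eq_square)
  finally show ?thesis using assms by (simp add: m_def divide_right_mono)
qed

lemma expec_indep:
  assumes "finite A" "finite B" "A \<inter> B = {}"
  shows "expec p (A \<union> B) (\<lambda>E. X (E \<inter> A) * Y (E \<inter> B)) = expec p A X * expec p B Y"
  using assms(2,3)
proof (induction B arbitrary: Y rule: finite_induct)
  case empty
  have "expec p A (\<lambda>E. X (E \<inter> A) * Y {}) = expec p A (\<lambda>E. Y {} * X E)"
    by (intro expec_cong) (auto simp: Int_absorb2)
  then show ?case by (simp add: expec_cmult)
next
  case (insert e B)
  have e: "e \<notin> A \<union> B" using insert by auto
  have "expec p (A \<union> insert e B) (\<lambda>E. X (E \<inter> A) * Y (E \<inter> insert e B)) =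
     (1 - p) * expec p (A \<union> B) (\<lambda>E. X (E \<inter> A) * Y (E \<inter> insert e B))
     + p * expec p (A \<union> B) (\<lambda>E. X (insert e E \<inter> A) * Y (insert e E \<inter> insert e B))"
    using expec_insert[OF _ e] assms(1) insert by simp
  also have "expec p (A \<union> B) (\<lambda>E. X (E \<inter> A) * Y (E \<inter> insert e B))
     = expec p (A \<union> B) (\<lambda>E. X (E \<inter> A) * Y (E \<inter> B))"
    using e by (intro expec_cong arg_cong2[where f="(*)"] arg_cong[where f=Y]) auto
  also have "expec p (A \<union> B) (\<lambda>E. X (insert e E \<inter> A) * Y (insert e E \<inter> insert e B))
     = expec p (A \<union> B) (\<lambda>E. X (E \<inter> A) * Y (insert e (E \<inter> B)))"
    using e by (intro expec_cong arg_cong2[where f="(*)"] arg_cong[where f=X] arg_cong[where f=Y]) auto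
  finally show ?case
    using insert.IH[of Y] insert.IH[of "\<lambda>E. Y (insert e E)"] insert.prems insert.hyps
    by (simp add: expec_insert algebra_simps)
qed

lemma prob_Int:
  assumes "finite F" "A \<subseteq> F"
  shows "prob p F (\<lambda>E. P (E \<inter> A)) = prob p A P"
proof -
  have "A \<union> (F - A) = F" "finite A" using assms by (auto intro: finite_subset)
  then show ?thesis
    using expec_indep[of A "F - A" p "\<lambda>E. of_bool (P E)" "\<lambda>_. 1"] assms
    by (simp add: prob_def expec_const Int_absorb1)
qed

lemma prob_indep:
  assumes "finite F" "A \<subseteq> F" "B \<subseteq> F" "A \<inter> B = {}"
  shows "prob p F (\<lambda>E. P (E \<inter> A) \<and> Q (E \<inter> B))
    = prob p F (\<lambda>E. P (E \<inter> A)) * prob p F (\<lambda>E. Q (E \<inter> B))"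
proof -
  have f: "finite A" "finite B" "A \<union> B \<subseteq> F" using assms finite_subset by auto
  have "prob p F (\<lambda>E. P (E \<inter> A) \<and> Q (E \<inter> B)) =
     prob p F (\<lambda>E. P (E \<inter> (A \<union> B) \<inter> A) \<and> Q (E \<inter> (A \<union> B) \<inter> B))"
    by (intro prob_cong) (simp add: Int_assoc Int_absorb1)
  also have "\<dots> = prob p (A \<union> B) (\<lambda>E. P (E \<inter> A) \<and> Q (E \<inter> B))"
    using prob_Int[OF assms(1) f(3), of p "\<lambda>E. P (E \<inter> A) \<and> Q (E \<inter> B)"] .
  also have "\<dots> = prob p A P * prob p B Q"
    using expec_indep[OF f(1,2) assms(4), of p "\<lambda>E. of_bool (P E)" "\<lambda>E. of_bool (Q E)"]
    by (simp add: prob_def of_bool_conj)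
  finally show ?thesis using assms by (simp add: prob_Int)
qed

lemma prob_edge_le:
  assumes "finite F" "0 \<le> p" "p \<le> 1"
  shows "prob p F (\<lambda>E. e \<in> E) \<le> p"
proof (cases "e \<in> F")
  case True
  then have "F = insert e (F - {e})" by auto
  then have "prob p F (\<lambda>E. e \<in> E) = prob p (insert e (F - {e})) (\<lambda>E. e \<in> E)" by simp
  also have "\<dots> = (1 - p) * prob p (F - {e}) (\<lambda>E. False) + p * prob p (F - {e}) (\<lambda>E. True)"
    using assms by (subst prob_insert, auto intro!: arg_cong2[where f="(+)"] arg_cong2[where f="(*)"] prob_cong)
  finally show ?thesis using assms by (simp add: prob_True prob_False)
next
  case False
  then have "prob p F (\<lambda>E. e \<in> E) = prob p F (\<lambda>E. False)" by (intro prob_cong) auto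
  then show ?thesis using assms by (simp add: prob_False)
qed

lemma prob_none:
  assumes "finite F" "B \<subseteq> F"
  shows "prob p F (\<lambda>E. E \<inter> B = {}) = (1 - p) ^ card B"
proof -
  have "prob p F (\<lambda>E. E \<inter> B = {}) = prob p B (\<lambda>E. E = {})"
    using prob_Int[OF assms, of p "\<lambda>E. E = {}"] .
  also have "\<dots> = (\<Sum>E\<in>Pow B. if E = {} then (1-p)^card B else 0)"
    unfolding prob_def expec_def by (intro sum.cong) auto
  also have "\<dots> = (1 - p) ^ card B"
    using assms finite_subset by (subst sum.delta) auto
  finally show ?thesis .
qed

section \<open>Monotone events and disjoint occurrence\<close>

definition increasing :: "('e set \<Rightarrow> bool) \<Rightarrow> bool" where
  "increasing P \<longleftrightarrow> (\<forall>X Y. X \<subseteq> Y \<longrightarrow> P X \<longrightarrow> P Y)"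

lemma increasingD: "increasing P \<Longrightarrow> P X \<Longrightarrow> X \<subseteq> Y \<Longrightarrow> P Y"
  by (auto simp: increasing_def)

lemma increasingI: "(\<And>X Y. X \<subseteq> Y \<Longrightarrow> P X \<Longrightarrow> P Y) \<Longrightarrow> increasing P"
  by (auto simp: increasing_def)

lemma increasing_insert: "increasing P \<Longrightarrow> increasing (\<lambda>E. P (insert e E))"
  by (rule increasingI) (meson increasingD insert_mono)

text \<open>Disjoint occurrence in the sense of van den Berg and Kesten. For increasing events,
  holding on a subset of \<open>E\<close> is the same as having a witness there, so two disjoint
  subsets replace the usual certificates.\<close>

definition box :: "('e set \<Rightarrow> bool) \<Rightarrow> ('e set \<Rightarrow> bool) \<Rightarrow> 'e set \<Rightarrow> bool" where
  "box A B E \<longleftrightarrow> (\<exists>I J. I \<inter> J = {} \<and> I \<subseteq> E \<and> J \<subseteq> E \<and> A I \<and> B J)"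

lemma boxI: "A I \<Longrightarrow> B J \<Longrightarrow> I \<inter> J = {} \<Longrightarrow> I \<subseteq> E \<Longrightarrow> J \<subseteq> E \<Longrightarrow> box A B E"
  by (auto simp: box_def)

lemma increasing_box: "increasing (box A B)"
  unfolding box_def by (rule increasingI) (meson subset_trans)

lemma box_mono:
  "box A B E \<Longrightarrow> (\<And>X. X \<subseteq> E \<Longrightarrow> A X \<Longrightarrow> A' X) \<Longrightarrow> (\<And>X. X \<subseteq> E \<Longrightarrow> B X \<Longrightarrow> B' X) \<Longrightarrow> box A' B' E"
  unfolding box_def by blast

text \<open>Induction on the ground set. When \<open>e\<close> is present at most one of the two
  witnesses uses it, so \<open>box A B\<close> at \<open>insert e E\<close> gives
  \<open>box A B1\<close> or \<open>box A1 B\<close> at \<open>E\<close>, and both of these follow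
  from \<open>box A B\<close> at \<open>E\<close>. Inclusion-exclusion then leaves
  \<open>box A B\<close> with coefficient 1 - 2p, which is nonnegative for p <= 1/2, so the
  induction hypothesis bounds all three terms. The remainder is p^2 times a product of two
  nonnegative increments.\<close>

theorem van_den_berg_kesten:
  assumes "finite F" "0 \<le> p" "p \<le> 1/2" "increasing A" "increasing B"
  shows "prob p F (box A B) \<le> prob p F A * prob p F B"
  using assms(1,4,5)
proof (induction F arbitrary: A B rule: finite_induct)
  case empty
  then show ?case by (auto simp: prob_def box_def)
next
  case (insert e F)
  define A1 where "A1 = (\<lambda>E. A (insert e E))"
  define B1 where "B1 = (\<lambda>E. B (insert e E))"
  have inc: "increasing A1" "increasing B1"
    using insert.prems by (auto simp: A1_def B1_def increasing_insert)
  have sub: "A1 E" if "A E" for E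
    using that insert.prems(1) unfolding A1_def by (auto elim: increasingD)
  have subB: "B1 E" if "B E" for E
    using that insert.prems(2) unfolding B1_def by (auto elim: increasingD)
  let ?P = "prob p F"
  have p1: "p \<le> 1" using assms by simp
  have ab: "?P A \<le> ?P A1" "?P B \<le> ?P B1"
    using assms p1 sub subB by (auto intro!: prob_mono)
  have step: "box A B1 E \<or> box A1 B E" if bx: "box A B (insert e E)" for E
  proof -
    obtain I J where *: "I \<inter> J = {}" "I \<subseteq> insert e E" "J \<subseteq> insert e E" "A I" "B J"
      using bx unfolding box_def by auto
    show ?thesis
    proof (cases "e \<in> J")
      case True
      then have "B1 (J - {e})" using * by (auto simp: B1_def insert_absorb)
      then have "box A B1 E" using * True by (intro boxI[of A I B1 "J - {e}"]) auto
      then show ?thesis ..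
    next
      case False
      have "A1 (I - {e})" using * insert.prems(1) by (auto simp: A1_def elim!: increasingD)
      then have "box A1 B E" using * False by (intro boxI[of A1 "I - {e}" B J]) auto
      then show ?thesis ..
    qed
  qed
  have "?P (\<lambda>E. box A B (insert e E)) \<le> ?P (\<lambda>E. box A B1 E \<or> box A1 B E)"
    using assms p1 step by (intro prob_mono) auto
  also have "\<dots> = ?P (box A B1) + ?P (box A1 B) - ?P (\<lambda>E. box A B1 E \<and> box A1 B E)"
    using prob_disj[of p F "box A B1" "box A1 B"] by simp
  also have "\<dots> \<le> ?P (box A B1) + ?P (box A1 B) - ?P (box A B)"
  proof -
    have "?P (box A B) \<le> ?P (\<lambda>E. box A B1 E \<and> box A1 B E)"
      using assms p1 sub subB by (intro prob_mono) (auto elim!: box_mono)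
    then show ?thesis by simp
  qed
  also have "\<dots> \<le> ?P A * ?P B1 + ?P A1 * ?P B - ?P (box A B)"
    using insert.IH insert.prems inc by (intro diff_right_mono add_mono) auto
  finally have le: "?P (\<lambda>E. box A B (insert e E)) \<le> ?P A * ?P B1 + ?P A1 * ?P B - ?P (box A B)" .
  have "prob p (insert e F) (box A B) =
      (1 - p) * ?P (box A B) + p * ?P (\<lambda>E. box A B (insert e E))"
    using insert by (simp add: prob_insert)
  also have "\<dots> \<le> (1 - p) * ?P (box A B) + p * (?P A * ?P B1 + ?P A1 * ?P B - ?P (box A B))"
    using le assms by (intro add_left_mono mult_left_mono) auto
  also have "\<dots> = (1 - 2 * p) * ?P (box A B) + p * (?P A * ?P B1 + ?P A1 * ?P B)"
    by (simp add: algebra_simps)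
  also have "\<dots> \<le> (1 - 2 * p) * (?P A * ?P B) + p * (?P A * ?P B1 + ?P A1 * ?P B)"
    using insert.IH[OF insert.prems] assms by (intro add_right_mono mult_left_mono) auto
  also have "\<dots> = ((1 - p) * ?P A + p * ?P A1) * ((1 - p) * ?P B + p * ?P B1)
      - p\<^sup>2 * ((?P A1 - ?P A) * (?P B1 - ?P B))"
    by (simp add: power2_eq_square algebra_simps)
  also have "\<dots> \<le> ((1 - p) * ?P A + p * ?P A1) * ((1 - p) * ?P B + p * ?P B1)"
    using ab by (simp add: mult_nonneg_nonneg)
  also have "\<dots> = prob p (insert e F) A * prob p (insert e F) B"
    using insert by (simp add: prob_insert A1_def B1_def)
  finally show ?case .
qed

text \<open>Positive correlation in the form for complements, which is how it is iterated to bound a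
  union from above. In the induction step the defect is p (1 - p) times the product of two
  increments of the same sign.\<close>

lemma harris:
  assumes "finite F" "0 \<le> p" "p \<le> 1" "increasing A" "increasing B"
  shows "prob p F (\<lambda>E. \<not> A E) * prob p F (\<lambda>E. \<not> B E) \<le> prob p F (\<lambda>E. \<not> A E \<and> \<not> B E)"
  using assms(1,4,5)
proof (induction F arbitrary: A B rule: finite_induct)
  case empty
  then show ?case by (auto simp: prob_def)
next
  case (insert e F)
  let ?P = "prob p F" and ?n = "\<lambda>A E. \<not> A E" and ?A1 = "\<lambda>E. A (insert e E)" and ?B1 = "\<lambda>E. B (insert e E)"
  have inc: "increasing ?A1" "increasing ?B1" using insert.prems by (auto intro: increasing_insert)
  have subA: "?A1 E" if "A E" for E using increasingD[OF insert.prems(1) that] by auto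
  have subB: "?B1 E" if "B E" for E using increasingD[OF insert.prems(2) that] by auto
  have "?P (?n ?A1) \<le> ?P (?n A)"
    using assms subA by (intro prob_mono) auto
  moreover have "?P (?n ?B1) \<le> ?P (?n B)"
    using assms subB by (intro prob_mono) auto
  ultimately have pos: "0 \<le> p * (1 - p) * ((?P (?n A) - ?P (?n ?A1)) * (?P (?n B) - ?P (?n ?B1)))"
    using assms by simp
  have "((1 - p) * ?P (?n A) + p * ?P (?n ?A1)) * ((1 - p) * ?P (?n B) + p * ?P (?n ?B1))
     = (1 - p) * (?P (?n A) * ?P (?n B)) + p * (?P (?n ?A1) * ?P (?n ?B1))
       - p * (1 - p) * ((?P (?n A) - ?P (?n ?A1)) * (?P (?n B) - ?P (?n ?B1)))"
    by (simp add: algebra_simps)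
  also have "\<dots> \<le> (1 - p) * (?P (?n A) * ?P (?n B)) + p * (?P (?n ?A1) * ?P (?n ?B1))"
    using pos by linarith
  also have "\<dots> \<le> (1 - p) * ?P (\<lambda>E. \<not> A E \<and> \<not> B E) + p * ?P (\<lambda>E. \<not> ?A1 E \<and> \<not> ?B1 E)"
    using insert.IH[OF insert.prems] insert.IH[OF inc] assms
    by (intro add_mono mult_left_mono) auto
  finally show ?case using insert by (simp add: prob_insert)
qed

lemma increasing_Ex: "(\<And>u. u \<in> U \<Longrightarrow> increasing (A u)) \<Longrightarrow> increasing (\<lambda>E. \<exists>u\<in>U. A u E)"
  by (rule increasingI) (meson increasingD)

lemma increasing_conj: "increasing A \<Longrightarrow> increasing B \<Longrightarrow> increasing (\<lambda>E. A E \<and> B E)"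
  by (rule increasingI) (meson increasingD)

text \<open>Better than the union bound by a second-order term. That gain is what makes the one-arm
  probability decay at criticality, where the union bound would only give a constant.\<close>

lemma prob_Ex_increasing_le:
  assumes "finite F" "0 \<le> p" "p \<le> 1" "finite U" "\<And>u. u \<in> U \<Longrightarrow> increasing (A u)"
    "\<And>u. u \<in> U \<Longrightarrow> prob p F (A u) \<le> x" "x \<le> 1"
  shows "prob p F (\<lambda>E. \<exists>u\<in>U. A u E) \<le> 1 - (1 - x) ^ card U"
proof -
  have "(1 - x) ^ card U \<le> prob p F (\<lambda>E. \<not> (\<exists>u\<in>U. A u E))"
    using assms(4,5,6)
  proof (induction U rule: finite_induct)
    case empty
    then show ?case using assms by (simp add: prob_True)
  next
    case (insert u U)
    have "(1 - x) ^ card (insert u U) = (1 - x) * (1 - x) ^ card U" using insert by simp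
    also have "\<dots> \<le> prob p F (\<lambda>E. \<not> A u E) * prob p F (\<lambda>E. \<not> (\<exists>u\<in>U. A u E))"
      using insert assms by (intro mult_mono) (auto simp: prob_Not prob_nonneg prob_le_1)
    also have "\<dots> \<le> prob p F (\<lambda>E. \<not> A u E \<and> \<not> (\<exists>u\<in>U. A u E))"
      using assms insert by (intro harris increasing_Ex) auto
    also have "\<dots> = prob p F (\<lambda>E. \<not> (\<exists>u\<in>insert u U. A u E))"
      by (intro prob_cong) auto
    finally show ?case .
  qed
  then show ?thesis using prob_Not[OF assms(1), of p "\<lambda>E. \<exists>u\<in>U. A u E"] by linarith
qed

subsection \<open>Balls, disjoint chains and components\<close>

text \<open>Starting from a set instead of a vertex lets balls be composed by
  \<open>ball_ball\<close> and later serves as the neighbourhood of a whole set of centres.\<close>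

fun ball :: "'a set set \<Rightarrow> nat \<Rightarrow> 'a set \<Rightarrow> 'a set" where
  "ball E 0 S = S"
| "ball E (Suc k) S = ball E k S \<union> {w. \<exists>u\<in>ball E k S. {u, w} \<in> E}"

lemma ball_mono_radius: "k \<le> l \<Longrightarrow> ball E k S \<subseteq> ball E l S"
  by (rule lift_Suc_mono_le) auto

lemma ball_mono_edges: "E \<subseteq> E' \<Longrightarrow> ball E k S \<subseteq> ball E' k S"
  by (induction k) auto

lemma ball_mono_start: "S \<subseteq> S' \<Longrightarrow> ball E k S \<subseteq> ball E k S'"
  by (induction k) auto

lemma ball_ball: "ball E k (ball E l S) = ball E (l + k) S"
  by (induction k) auto

lemma ball_UN: "ball E k S = (\<Union>s\<in>S. ball E k {s})"
  by (induction k) auto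

lemma ball_step: "{v, u} \<in> E \<Longrightarrow> w \<in> ball E k {u} \<Longrightarrow> w \<in> ball E (Suc k) {v}"
proof -
  assume *: "{v, u} \<in> E" "w \<in> ball E k {u}"
  then have "ball E k {u} \<subseteq> ball E k (ball E 1 {v})" by (intro ball_mono_start) auto
  then have "w \<in> ball E k (ball E 1 {v})" using *(2) by blast
  then show ?thesis by (simp only: ball_ball) simp
qed

lemma ball_sym: "w \<in> ball E k {v} \<Longrightarrow> v \<in> ball E k {w}"
proof (induction k arbitrary: w)
  case (Suc k)
  then consider "w \<in> ball E k {v}" | u where "u \<in> ball E k {v}" "{w, u} \<in> E"
    by (auto simp: insert_commute)
  then show ?case
  proof cases
    case 1
    then show ?thesis using Suc.IH by auto
  next
    case 2
    from ball_step[OF 2(2) Suc.IH[OF 2(1)]] show ?thesis .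
  qed
qed auto

lemma ball_trans: "u \<in> ball E k {v} \<Longrightarrow> w \<in> ball E l {u} \<Longrightarrow> w \<in> ball E (k + l) {v}"
  using ball_mono_start[of "{u}" "ball E k {v}" E l] ball_ball[of E l k "{v}"] by auto

lemma ball_subset: "S \<subseteq> V \<Longrightarrow> E \<subseteq> Pow V \<Longrightarrow> ball E k S \<subseteq> V"
  by (induction k) auto

text \<open>A ball is determined by the edges that it spans. This makes a lower bound on the size of
  a ball a local event.\<close>

lemma ball_restrict:
  "j \<le> k \<Longrightarrow> ball {e\<in>E. e \<subseteq> ball E k S} j S = ball E j S"
proof (induction j)
  case (Suc j)
  have "w \<in> ball E k S" if "u \<in> ball E j S" "{u, w} \<in> E" for u w
    using that Suc.prems ball_mono_radius[of "Suc j" k E S] by auto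
  moreover have "u \<in> ball E k S" if "u \<in> ball E j S" for u
    using that Suc.prems ball_mono_radius[of j k E S] by auto
  ultimately show ?case using Suc by auto
qed auto

section \<open>Exact distances and geodesics\<close>

definition at_dist :: "'a set set \<Rightarrow> nat \<Rightarrow> 'a \<Rightarrow> 'a \<Rightarrow> bool" where
  "at_dist E k v w \<longleftrightarrow> w \<in> ball E k {v} \<and> (\<forall>j<k. w \<notin> ball E j {v})"

lemma at_dist_sym: "at_dist E k v w \<Longrightarrow> at_dist E k w v"
  unfolding at_dist_def using ball_sym by metis

lemma at_dist_exists: "w \<in> ball E k {v} \<Longrightarrow> \<exists>j\<le>k. at_dist E j v w"
proof -
  assume *: "w \<in> ball E k {v}"
  let ?j = "LEAST j. w \<in> ball E j {v}"
  have "w \<in> ball E ?j {v}" using * by (rule LeastI)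
  moreover have "?j \<le> k" using * by (rule Least_le)
  ultimately show ?thesis unfolding at_dist_def using not_less_Least by blast
qed

lemma at_dist_intermediate:
  "at_dist E k v w \<Longrightarrow> i \<le> k \<Longrightarrow> \<exists>u. at_dist E i v u \<and> at_dist E (k - i) u w"
proof (induction k arbitrary: w i)
  case (Suc k)
  show ?case
  proof (cases "i = Suc k")
    case True
    then show ?thesis using Suc.prems by (auto simp: at_dist_def)
  next
    case False
    obtain x where x: "x \<in> ball E k {v}" "{x, w} \<in> E"
      using Suc.prems(1) by (auto simp: at_dist_def)
    have "x \<notin> ball E j {v}" if "j < k" for j
    proof
      assume "x \<in> ball E j {v}"
      then have "w \<in> ball E (Suc j) {v}" using x by auto
      then show False using Suc.prems(1) that by (auto simp: at_dist_def simp del: ball.simps)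
    qed
    then have "at_dist E k v x" using x by (auto simp: at_dist_def)
    then obtain u where u: "at_dist E i v u" "at_dist E (k - i) u x"
      using Suc.IH[of x i] Suc.prems(2) False by auto
    have "w \<in> ball E (Suc k - i) {u}"
      using u(2) x(2) Suc.prems(2) False by (auto simp: at_dist_def Suc_diff_le)
    moreover have "w \<notin> ball E j {u}" if "j < Suc k - i" for j
    proof
      assume "w \<in> ball E j {u}"
      then have "w \<in> ball E (i + j) {v}" using u(1) ball_trans by (auto simp: at_dist_def)
      then show False using Suc.prems(1) that by (auto simp: at_dist_def simp del: ball.simps)
    qed
    ultimately show ?thesis using u(1) by (auto simp: at_dist_def simp del: ball.simps)
  qed
qed (auto simp: at_dist_def)

lemma at_dist_ball_Diff:
  "at_dist E (Suc k) v w \<longleftrightarrow> w \<in> ball E (Suc k) {v} - ball E k {v}"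
proof -
  have "w \<notin> ball E j {v}" if "w \<notin> ball E k {v}" "j < Suc k" for j
    using that ball_mono_radius[of j k E "{v}"] by auto
  then show ?thesis unfolding at_dist_def by blast
qed

section \<open>Edge-disjoint chains\<close>

fun chain :: "'a set \<Rightarrow> ('a \<Rightarrow> 'a set set \<Rightarrow> bool) \<Rightarrow> nat \<Rightarrow> 'a \<Rightarrow> 'a set set \<Rightarrow> bool" where
  "chain V Q 0 v = Q v"
| "chain V Q (Suc k) v = (\<lambda>E. \<exists>u\<in>V. box (\<lambda>I. {v, u} \<in> I) (chain V Q k u) E)"

abbreviation conn :: "'a set \<Rightarrow> nat \<Rightarrow> 'a \<Rightarrow> 'a \<Rightarrow> 'a set set \<Rightarrow> bool" where
  "conn V k w \<equiv> chain V (\<lambda>u _. u = w) k"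

text \<open>Both \<open>conn\<close> and \<open>arm\<close> describe trails: edges are distinct
  because each step occurs disjointly from the rest, but vertices may repeat. The general
  \<open>Q\<close> allows chains to be split by \<open>chain_chain\<close>, with different estimates
  for the two parts.\<close>

abbreviation arm :: "'a set \<Rightarrow> nat \<Rightarrow> 'a \<Rightarrow> 'a set set \<Rightarrow> bool" where
  "arm V k \<equiv> chain V (\<lambda>_ _. True) k"

lemma increasing_mem: "increasing (\<lambda>I. e \<in> I)"
  by (auto simp: increasing_def)

lemma increasing_triv: "increasing (\<lambda>_. c)"
  by (auto simp: increasing_def)

lemma increasing_chain: "(\<And>u. increasing (Q u)) \<Longrightarrow> increasing (chain V Q k v)"
proof (induction k arbitrary: v)
  case (Suc k)
  have "increasing (\<lambda>E. \<exists>u\<in>V. box (\<lambda>I. {v, u} \<in> I) (chain V Q k u) E)"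
    by (intro increasing_Ex increasing_box)
  then show ?case by simp
qed auto

lemmas increasing_arm = increasing_chain[of "\<lambda>_ _. True", OF increasing_triv]

lemma chain_mono:
  "chain V Q k v E \<Longrightarrow> (\<And>u X. X \<subseteq> E \<Longrightarrow> Q u X \<Longrightarrow> Q' u X) \<Longrightarrow> chain V Q' k v E"
proof (induction k arbitrary: v E)
  case (Suc k)
  then obtain u where u: "u \<in> V" "box (\<lambda>I. {v, u} \<in> I) (chain V Q k u) E" by auto
  from u(2) have "box (\<lambda>I. {v, u} \<in> I) (chain V Q' k u) E"
    by (rule box_mono) (use Suc in \<open>auto\<close>)
  then show ?case using u(1) by auto
qed auto

lemma chain_chain: "chain V (chain V Q k) j v = chain V Q (j + k) v"
  by (induction j arbitrary: v) auto

lemma conn_arm: "conn V k w v E \<Longrightarrow> arm V k v E"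
  by (rule chain_mono) auto

text \<open>Seen from \<open>w\<close>, the first edge of the geodesic contains \<open>v\<close>,
  which lies outside the ball spanned by the remaining edges. Hence that edge is new, and the
  induction can keep its witness inside the ball around \<open>w\<close>.\<close>

lemma conn_geodesic:
  assumes "E \<subseteq> Pow V" "at_dist E k v w" "w \<in> V"
  shows "conn V k w v {e\<in>E. e \<subseteq> ball E k {w}}"
  using at_dist_sym[OF assms(2)]
proof (induction k arbitrary: v)
  case 0
  then show ?case by (auto simp: at_dist_def)
next
  case (Suc k)
  then obtain u where u: "u \<in> ball E k {w}" "{v, u} \<in> E" and v: "v \<notin> ball E k {w}"
    by (auto simp: at_dist_ball_Diff insert_commute)
  have "u \<notin> ball E j {w}" if "j < k" for j
  proof
    assume "u \<in> ball E j {w}"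
    then have "v \<in> ball E (Suc j) {w}" using u by (auto simp: insert_commute)
    then show False using v that ball_mono_radius[of "Suc j" k E "{w}"] by auto
  qed
  then have "at_dist E k w u" using u by (auto simp: at_dist_def)
  note IH = Suc.IH[OF this]
  have uV: "u \<in> V" using u assms by auto
  have "box (\<lambda>I. {v, u} \<in> I) (conn V k w u) {e\<in>E. e \<subseteq> ball E (Suc k) {w}}"
    using IH v u by (intro boxI[of _ "{{v, u}}" _ "{e\<in>E. e \<subseteq> ball E k {w}}"]) (auto simp: insert_commute)
  then show ?case using uV by auto
qed

lemma arm_at_dist:
  assumes "E \<subseteq> Pow V" "at_dist E k v w" "w \<in> V"
  shows "arm V k v E"
proof -
  have "conn V k w v E"
    by (rule increasingD[OF increasing_chain[OF increasing_triv] conn_geodesic[OF assms]]) auto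
  then show ?thesis by (rule conn_arm)
qed

text \<open>One implication suffices as the definition: for increasing \<open>P\<close> the converse
  is automatic, because the restricted edge set is a subset of \<open>E\<close>.\<close>

definition local_at :: "nat \<Rightarrow> 'a \<Rightarrow> ('a set set \<Rightarrow> bool) \<Rightarrow> bool" where
  "local_at r v P \<longleftrightarrow> (\<forall>E. P E \<longrightarrow> P {e\<in>E. e \<subseteq> ball E r {v}})"

lemma local_atD: "local_at r v P \<Longrightarrow> P E \<Longrightarrow> P {e\<in>E. e \<subseteq> ball E r {v}}"
  by (auto simp: local_at_def)

lemma local_at_mono:
  assumes "local_at r v P" "increasing P" "r \<le> r'"
  shows "local_at r' v P"
  unfolding local_at_def
proof (intro allI impI)
  fix E assume "P E"
  then have "P {e\<in>E. e \<subseteq> ball E r {v}}" using assms(1) by (rule local_atD[rotated])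
  then show "P {e\<in>E. e \<subseteq> ball E r' {v}}"
    by (rule increasingD[OF assms(2)]) (use ball_mono_radius[OF assms(3), of E "{v}"] in auto)
qed

lemma local_at_conj: "local_at r v P \<Longrightarrow> local_at r v Q \<Longrightarrow> local_at r v (\<lambda>E. P E \<and> Q E)"
  by (simp add: local_at_def)

lemma local_at_arm: "local_at k v (arm V k v)"
  unfolding local_at_def
proof (induction k arbitrary: v)
  case (Suc k)
  show ?case
  proof (intro allI impI)
    fix E assume "arm V (Suc k) v E"
    then obtain u where u: "u \<in> V" and b: "box (\<lambda>I. {v, u} \<in> I) (arm V k u) E" by auto
    from b obtain I J where *: "I \<inter> J = {}" "I \<subseteq> E" "J \<subseteq> E" "{v, u} \<in> I" "arm V k u J"
      unfolding box_def by auto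
    let ?J = "{e\<in>J. e \<subseteq> ball J k {u}}"
    have J: "arm V k u ?J" using Suc *(5) by blast
    have vu: "{v, u} \<in> E" using * by auto
    have "ball J k {u} \<subseteq> ball E (Suc k) {v}"
    proof
      fix w assume "w \<in> ball J k {u}"
      then have "w \<in> ball E k {u}" using *(3) ball_mono_edges by blast
      then show "w \<in> ball E (Suc k) {v}" by (rule ball_step[OF vu])
    qed
    moreover have "{v, u} \<subseteq> ball E (Suc k) {v}"
      using vu ball_mono_radius[of 1 "Suc k" E "{v}"] by auto
    ultimately have "box (\<lambda>I. {v, u} \<in> I) (arm V k u) {e\<in>E. e \<subseteq> ball E (Suc k) {v}}"
      using * J vu by (intro boxI[of _ "{{v, u}}" _ ?J]) auto
    then show "arm V (Suc k) v {e\<in>E. e \<subseteq> ball E (Suc k) {v}}" using u by auto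
  qed
qed auto

lemma arm_subset:
  assumes "arm V k v E" "E \<subseteq> Pow V'"
  shows "arm V' k v E"
  using assms
proof (induction k arbitrary: v E)
  case (Suc k)
  then obtain u where u: "u \<in> V" and b: "box (\<lambda>I. {v, u} \<in> I) (arm V k u) E" by auto
  from b have "u \<in> V'" using Suc.prems(2) unfolding box_def by blast
  moreover from b have "box (\<lambda>I. {v, u} \<in> I) (arm V' k u) E"
    by (rule box_mono) (use Suc.IH Suc.prems(2) in auto)
  ultimately show ?case by auto
qed auto

section \<open>Connected components as unions of balls\<close>

definition cmp :: "'a set set \<Rightarrow> 'a \<Rightarrow> 'a set" where
  "cmp E v = (\<Union>k. ball E k {v})"

lemma cmp_eq_rtrancl: "cmp E v = {w. (v, w) \<in> {(a, b). {a, b} \<in> E}\<^sup>*}"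
proof (intro set_eqI iffI)
  fix w assume "w \<in> cmp E v"
  then obtain k where "w \<in> ball E k {v}" by (auto simp: cmp_def)
  then have "(v, w) \<in> {(a, b). {a, b} \<in> E}\<^sup>*"
  proof (induction k arbitrary: w)
    case (Suc k)
    then show ?case by (auto intro: rtrancl_into_rtrancl)
  qed auto
  then show "w \<in> {w. (v, w) \<in> {(a, b). {a, b} \<in> E}\<^sup>*}" by simp
next
  fix w assume "w \<in> {w. (v, w) \<in> {(a, b). {a, b} \<in> E}\<^sup>*}"
  then have "(v, w) \<in> {(a, b). {a, b} \<in> E}\<^sup>*" by simp
  then have "\<exists>k. w \<in> ball E k {v}"
  proof (induction rule: rtrancl_induct)
    case base
    have "v \<in> ball E 0 {v}" by simp
    then show ?case by blast
  next
    case (step y z)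
    then obtain k where "y \<in> ball E k {v}" by auto
    then have "z \<in> ball E (Suc k) {v}" using step by auto
    then show ?case by blast
  qed
  then show "w \<in> cmp E v" by (auto simp: cmp_def)
qed

lemma ball_subset_cmp: "ball E k {v} \<subseteq> cmp E v"
  by (auto simp: cmp_def)

lemma cmp_self: "v \<in> cmp E v"
  by (auto simp: cmp_eq_rtrancl)

lemma cmp_closed: "u \<in> cmp E v \<Longrightarrow> {u, w} \<in> E \<Longrightarrow> w \<in> cmp E v"
  by (auto simp: cmp_eq_rtrancl intro: rtrancl_into_rtrancl)

lemma cmp_least: "v \<in> W \<Longrightarrow> (\<And>u w. u \<in> W \<Longrightarrow> {u, w} \<in> E \<Longrightarrow> w \<in> W) \<Longrightarrow> cmp E v \<subseteq> W"
proof -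
  assume *: "v \<in> W" "\<And>u w. u \<in> W \<Longrightarrow> {u, w} \<in> E \<Longrightarrow> w \<in> W"
  have "ball E k {v} \<subseteq> W" for k by (induction k) (use * in auto)
  then show ?thesis by (auto simp: cmp_def)
qed

lemma cmp_mono: "E \<subseteq> E' \<Longrightarrow> cmp E v \<subseteq> cmp E' v"
  unfolding cmp_def by (intro UN_mono ball_mono_edges) auto

lemma cmp_eq: assumes "w \<in> cmp E v" shows "cmp E w = cmp E v"
proof
  show "cmp E w \<subseteq> cmp E v" using assms cmp_closed by (rule cmp_least)
  obtain k where "w \<in> ball E k {v}" using assms by (auto simp: cmp_def)
  then have "v \<in> ball E k {w}" by (rule ball_sym)
  then have "v \<in> cmp E w" by (auto simp: cmp_def)
  then show "cmp E v \<subseteq> cmp E w" using cmp_closed by (rule cmp_least)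
qed

text \<open>A vertex of the component outside the ball has a finite distance of at least
  \<open>k\<close>, and a geodesic to it passes through distance exactly \<open>k\<close>.\<close>

lemma far_if_not_covered:
  assumes "\<not> cmp E v \<subseteq> ball E k {v}"
  shows "\<exists>w. at_dist E k v w"
proof -
  obtain w l where w: "w \<in> ball E l {v}" "w \<notin> ball E k {v}" using assms by (auto simp: cmp_def)
  then obtain j where j: "at_dist E j v w" using at_dist_exists by metis
  have "\<not> j \<le> k"
    using j w(2) ball_mono_radius[of j k E "{v}"] by (auto simp: at_dist_def)
  then have "k \<le> j" by simp
  then show ?thesis using at_dist_intermediate[OF j] by blast
qed

subsection \<open>One-arm estimate and concentration of local counts\<close>

text \<open>The rational form is chosen for iteration: t -> t / (1 + c t) adds c to 1/t, so the
  reciprocals of the one-arm bounds will grow linearly.\<close>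

lemma one_minus_power_le:
  fixes x :: real
  assumes "0 \<le> x" "x \<le> 1"
  shows "1 - (1 - x) ^ Suc n \<le> real (Suc n) * x / (1 + real n * x / 2)"
proof (induction n)
  case (Suc n)
  define D where "D = 1 + real n * x / 2"
  have D: "D \<ge> 1" using assms by (simp add: D_def)
  have "1 - (1 - x) ^ Suc (Suc n) = x + (1 - x) * (1 - (1 - x) ^ Suc n)"
    by (simp add: algebra_simps)
  also have "\<dots> \<le> x + (1 - x) * (real (Suc n) * x / D)"
    using Suc assms by (intro add_left_mono mult_left_mono) (auto simp: D_def)
  also have "\<dots> = x * (real (Suc (Suc n)) * (1 - x / 2)) / D"
  proof -
    have "x * D + (1 - x) * (real (Suc n) * x) = x * (real (Suc (Suc n)) * (1 - x / 2))"
      by (simp add: D_def field_simps)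
    then show ?thesis using D by (simp add: add_divide_eq_iff)
  qed
  also have "\<dots> \<le> x * real (Suc (Suc n)) / (D + x / 2)"
  proof -
    have "(1 - x / 2) * (D + x / 2) = D - (x / 2) * (D - 1) - x\<^sup>2 / 4"
      by (simp add: power2_eq_square field_simps)
    also have "\<dots> \<le> D"
    proof -
      have "0 \<le> (x / 2) * (D - 1)" "0 \<le> x\<^sup>2 / 4" using D assms by auto
      then show ?thesis by linarith
    qed
    finally have "(1 - x / 2) / D \<le> 1 / (D + x / 2)"
      using D assms by (simp add: field_simps)
    then have "(x * real (Suc (Suc n))) * ((1 - x / 2) / D) \<le> (x * real (Suc (Suc n))) * (1 / (D + x / 2))"
      using assms by (intro mult_left_mono) auto
    then show ?thesis by (simp add: mult.assoc)
  qed
  also have "D + x / 2 = 1 + real (Suc n) * x / 2"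
    by (simp add: D_def algebra_simps add_divide_distrib)
  finally show ?case by (simp add: mult.commute)
qed auto

lemma finite_all_edges: "finite (all_edges n)"
  by (rule finite_subset[of _ "Pow {..<n}"]) (auto simp: all_edges_def)

lemma all_edges_Pow: "all_edges n \<subseteq> Pow {..<n}"
  by (auto simp: all_edges_def)

lemma all_edges_iff: "{u, v} \<in> all_edges n \<longleftrightarrow> u < n \<and> v < n \<and> u \<noteq> v"
  by (auto simp: all_edges_def doubleton_eq_iff)

text \<open>\<open>g\<close> bounds the mean degree from above and is at least 1, so its powers are
  monotone in the exponent; in the application g = 1 + eps and the powers up to 1/eps stay below 3.
  The bound on \<open>p\<close> is the one under which the disjoint-occurrence inequality was
  proved.\<close>

locale gnp =
  fixes n :: nat and p g :: real
  assumes n2: "2 \<le> n" and p0: "0 \<le> p" and p2: "p \<le> 1/2" and np: "real n * p \<le> g" and g1: "1 \<le> g"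
begin

abbreviation V where "V \<equiv> {..<n}"
abbreviation F where "F \<equiv> all_edges n"
abbreviation Pr where "Pr \<equiv> prob p F"
abbreviation Exv where "Exv \<equiv> expec p F"

lemma p1: "p \<le> 1" using p2 by simp

lemmas pr = finite_all_edges[of n] p0 p1

lemma Pr_nonneg: "0 \<le> Pr P" using pr by (simp add: prob_nonneg)

lemma Pr_mono: "(\<And>E. E \<subseteq> F \<Longrightarrow> P E \<Longrightarrow> Q E) \<Longrightarrow> Pr P \<le> Pr Q"
  using pr by (intro prob_mono) auto

lemma edges_sub: "E \<subseteq> F \<Longrightarrow> E \<subseteq> Pow V"
  using all_edges_Pow by blast

lemma Pr_box: "increasing A \<Longrightarrow> increasing B \<Longrightarrow> Pr (box A B) \<le> Pr A * Pr B"
  using van_den_berg_kesten[OF finite_all_edges p0 p2] by blast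

lemma Pr_edge_box:
  assumes "increasing B"
  shows "Pr (box (\<lambda>I. e \<in> I) B) \<le> p * Pr B"
proof -
  have "Pr (box (\<lambda>I. e \<in> I) B) \<le> Pr (\<lambda>I. e \<in> I) * Pr B"
    using assms by (intro Pr_box increasing_mem)
  also have "\<dots> \<le> p * Pr B"
    using pr by (intro mult_right_mono prob_edge_le Pr_nonneg) auto
  finally show ?thesis .
qed

lemma Pr_chain_Suc:
  assumes "finite W" "\<And>u. increasing (Q u)"
  shows "Pr (chain W Q (Suc k) v) \<le> (\<Sum>u\<in>W. p * Pr (chain W Q k u))"
proof -
  have "Pr (chain W Q (Suc k) v) \<le> (\<Sum>u\<in>W. Pr (box (\<lambda>I. {v, u} \<in> I) (chain W Q k u)))"
    using prob_Ex_le[OF p0 p1 assms(1)] by simp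
  also have "\<dots> \<le> (\<Sum>u\<in>W. p * Pr (chain W Q k u))"
    using assms by (intro sum_mono Pr_edge_box increasing_chain)
  finally show ?thesis .
qed

text \<open>Of use when \<open>W\<close> is so small that \<open>card W * p\<close> is below 1: the
  chain then decays exponentially in \<open>k\<close>.\<close>

lemma Pr_chain_le:
  assumes "finite W" "\<And>u. increasing (Q u)" "\<And>u. Pr (Q u) \<le> x"
  shows "Pr (chain W Q k v) \<le> (real (card W) * p) ^ k * x"
proof (induction k arbitrary: v)
  case (Suc k)
  have "Pr (chain W Q (Suc k) v) \<le> (\<Sum>u\<in>W. p * Pr (chain W Q k u))"
    using assms by (intro Pr_chain_Suc)
  also have "\<dots> \<le> (\<Sum>u\<in>W. p * ((real (card W) * p) ^ k * x))"
    using p0 Suc by (intro sum_mono mult_left_mono)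
  finally show ?case by (simp add: algebra_simps)
qed (use assms in auto)

lemma Pr_const: "Pr (\<lambda>_. c) = of_bool c"
  using pr by (cases c) (auto simp: prob_True prob_False)

lemma sum_Pr_conn: "(\<Sum>w\<in>V. Pr (conn V k w v)) \<le> g ^ k"
proof -
  have "(\<Sum>w\<in>V. Pr (conn V k w v)) \<le> (real n * p) ^ k"
  proof (induction k arbitrary: v)
    case 0
    have "(\<Sum>w\<in>V. Pr (conn V 0 w v)) = (\<Sum>w\<in>V. if v = w then 1 else 0)"
      by (intro sum.cong) (auto simp: Pr_const)
    then show ?case by simp
  next
    case (Suc k)
    have "(\<Sum>w\<in>V. Pr (conn V (Suc k) w v)) \<le> (\<Sum>w\<in>V. \<Sum>u\<in>V. p * Pr (conn V k w u))"
      by (intro sum_mono Pr_chain_Suc increasing_triv) auto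
    also have "\<dots> = (\<Sum>u\<in>V. p * (\<Sum>w\<in>V. Pr (conn V k w u)))"
      by (subst sum.swap) (simp add: sum_distrib_left)
    also have "\<dots> \<le> (\<Sum>u\<in>V. p * (real n * p) ^ k)"
      using p0 Suc by (intro sum_mono mult_left_mono)
    finally show ?case by simp
  qed
  also have "\<dots> \<le> g ^ k" using np p0 by (intro power_mono) auto
  finally show ?thesis .
qed

text \<open>All intermediate vertices are free and cost a factor \<open>n * p\<close> each, while
  the edge into the prescribed endpoint costs \<open>p\<close>.\<close>

lemma Pr_conn_le: "Pr (conn V (Suc k) w v) \<le> p * g ^ k"
proof (induction k arbitrary: v)
  case 0
  have "Pr (conn V (Suc 0) w v) \<le> (\<Sum>u\<in>V. p * Pr (conn V 0 w u))"
    by (intro Pr_chain_Suc increasing_triv) auto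
  also have "\<dots> = (\<Sum>u\<in>V. if u = w then p else 0)"
    by (intro sum.cong) (auto simp: Pr_const)
  also have "\<dots> \<le> p" using p0 by simp
  finally show ?case by simp
next
  case (Suc k)
  have "Pr (conn V (Suc (Suc k)) w v) \<le> (\<Sum>u\<in>V. p * Pr (conn V (Suc k) w u))"
    by (intro Pr_chain_Suc increasing_triv) auto
  also have "\<dots> \<le> (\<Sum>u\<in>V. p * (p * g ^ k))"
    using p0 Suc by (intro sum_mono mult_left_mono)
  also have "\<dots> = (real n * p) * (p * g ^ k)" by simp
  also have "\<dots> \<le> g * (p * g ^ k)"
    using np p0 g1 by (intro mult_right_mono) auto
  finally show ?case by (simp add: algebra_simps)
qed

text \<open>For g = 1 the recursion sends a bound y to y / (1 + y/4), so 1/y grows by 1/4 per step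
  from the value 1, giving 4 / (k + 4). A general \<open>g\<close> contributes one factor per step.
  The 1/4 comes from the 1/2 of \<open>one_minus_power_le\<close> and the crude n - 1 >=
  n/2.\<close>

lemma Pr_arm_le:
  assumes "W \<subseteq> V"
  shows "Pr (arm W k v) \<le> 4 * g ^ k / (real k + 4)"
proof (induction k arbitrary: v)
  case 0
  then show ?case by (simp add: Pr_const)
next
  case (Suc k)
  define y where "y = 4 * g ^ k / (real k + 4)"
  \<comment> \<open>The bound \<open>y\<close> may exceed 1 when \<open>g ^ k\<close> is large,
    whereas \<open>p * x\<close> has to be a probability for the power estimate.\<close>
  define x where "x = min 1 y"
  have fW: "finite W" "card W \<le> n" using assms finite_subset card_mono[of V W] by auto
  have y0: "0 \<le> y" using g1 by (simp add: y_def)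
  have x: "0 \<le> x" "x \<le> 1" "x \<le> y" using y0 by (auto simp: x_def)
  have px: "0 \<le> p * x" "p * x \<le> 1" "p * x \<le> p" using x p0 p1 mult_le_one by (auto simp: mult_left_le)
  have le: "Pr (box (\<lambda>I. {v, u} \<in> I) (arm W k u)) \<le> p * x" for u
  proof -
    have "Pr (box (\<lambda>I. {v, u} \<in> I) (arm W k u)) \<le> p * Pr (arm W k u)"
      by (intro Pr_edge_box increasing_arm)
    also have "\<dots> \<le> p * x"
      using Suc[of u] prob_le_1[OF pr] p0 by (intro mult_left_mono) (auto simp: x_def y_def)
    finally show ?thesis .
  qed
  have "Pr (arm W (Suc k) v) \<le> 1 - (1 - p * x) ^ card W"
    using prob_Ex_increasing_le[OF pr fW(1) increasing_box le px(2)] by simp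
  also have "\<dots> \<le> 1 - (1 - p * x) ^ n"
    using px fW by (simp add: power_decreasing)
  also have "\<dots> \<le> real n * (p * x) / (1 + real (n - 1) * (p * x) / 2)"
    using one_minus_power_le[of "p * x" "n - 1"] px n2 by simp
  also have "\<dots> \<le> real n * (p * x) / (1 + real n * (p * x) / 4)"
  proof -
    have "real n / 2 \<le> real (n - 1)" using n2 by simp
    then have "real n / 2 * (p * x) \<le> real (n - 1) * (p * x)" by (rule mult_right_mono) (use px in auto)
    then have "1 + real n * (p * x) / 4 \<le> 1 + real (n - 1) * (p * x) / 2" by linarith
    moreover have "0 \<le> real n * (p * x)" using px by simp
    ultimately show ?thesis by (intro divide_left_mono mult_pos_pos) linarith+
  qed
  also have "\<dots> \<le> (g * y) / (1 + (g * y) / 4)"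
  proof -
    have mono: "a / (1 + a / 4) \<le> b / (1 + b / 4)" if "0 \<le> a" "a \<le> b" for a b :: real
      using that by (simp add: field_simps)
    have "(real n * p) * x \<le> g * y" using np x p0 g1 by (intro mult_mono) auto
    then show ?thesis using mono[of "real n * (p * x)" "g * y"] px by (simp add: mult.assoc)
  qed
  also have "\<dots> \<le> 4 * g ^ Suc k / (real (Suc k) + 4)"
  proof -
    define G where "G = g ^ Suc k"
    have G: "G \<ge> 1" using g1 unfolding G_def by (rule one_le_power)
    have gy: "g * y = 4 * G / (real k + 4)" by (simp add: y_def G_def)
    have eq: "(4 * G / a) / (1 + (4 * G / a) / 4) = 4 * G / (a + G)" if "a > 0" for a
    proof -
      have "1 + (4 * G / a) / 4 = (a + G) / a" using that by (simp add: field_simps)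
      then show ?thesis using that by simp
    qed
    have "(g * y) / (1 + (g * y) / 4) = 4 * G / (real k + 4 + G)"
      unfolding gy by (rule eq) simp
    also have "\<dots> \<le> 4 * G / (real (Suc k) + 4)"
      using G by (intro divide_left_mono mult_pos_pos) auto
    finally show ?thesis by (simp add: G_def)
  qed
  finally show ?case .
qed

lemma Pr_ball_le:
  assumes "v \<in> V" "w \<in> V"
  shows "Pr (\<lambda>E. w \<in> ball E r {v}) \<le> (\<Sum>i\<le>r. Pr (conn V i w v))"
proof -
  have "Pr (\<lambda>E. w \<in> ball E r {v}) \<le> Pr (\<lambda>E. \<exists>i\<in>{..r}. conn V i w v E)"
  proof (rule Pr_mono)
    fix E assume E: "E \<subseteq> F" "w \<in> ball E r {v}"
    from at_dist_exists[OF E(2)] obtain i where i: "i \<le> r" "at_dist E i v w" by auto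
    have "conn V i w v E"
      by (rule increasingD[OF increasing_chain[OF increasing_triv]
            conn_geodesic[OF edges_sub[OF E(1)] i(2) assms(2)]]) auto
    then show "\<exists>i\<in>{..r}. conn V i w v E" using i by auto
  qed
  also have "\<dots> \<le> (\<Sum>i\<le>r. Pr (conn V i w v))"
    by (rule prob_Ex_le[OF p0 p1]) simp
  finally show ?thesis .
qed

lemma ball_sub_V: "E \<subseteq> F \<Longrightarrow> v \<in> V \<Longrightarrow> ball E r {v} \<subseteq> V"
  by (rule ball_subset) (auto dest: edges_sub)

lemma sum_Pr_ball_le:
  assumes "v \<in> V"
  shows "(\<Sum>w\<in>V. Pr (\<lambda>E. w \<in> ball E r {v})) \<le> real (r + 1) * g ^ r"
proof -
  have "(\<Sum>w\<in>V. Pr (\<lambda>E. w \<in> ball E r {v})) \<le> (\<Sum>w\<in>V. \<Sum>i\<le>r. Pr (conn V i w v))"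
    using assms by (intro sum_mono Pr_ball_le) auto
  also have "\<dots> = (\<Sum>i\<le>r. \<Sum>w\<in>V. Pr (conn V i w v))" by (rule sum.swap)
  also have "\<dots> \<le> (\<Sum>i\<le>r. g ^ r)"
    using g1 by (intro sum_mono order_trans[OF sum_Pr_conn] power_increasing) auto
  finally show ?thesis by (simp add: algebra_simps)
qed

lemma Exv_card_ball_le:
  assumes "v \<in> V"
  shows "Exv (\<lambda>E. real (card (ball E r {v}))) \<le> real (r + 1) * g ^ r"
proof -
  have "Exv (\<lambda>E. real (card (ball E r {v}))) = Exv (\<lambda>E. \<Sum>w\<in>V. of_bool (w \<in> ball E r {v}))"
  proof (rule expec_cong)
    fix E assume "E \<subseteq> F"
    then have "ball E r {v} = V \<inter> {w. w \<in> ball E r {v}}" using ball_sub_V assms by blast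
    then show "real (card (ball E r {v})) = (\<Sum>w\<in>V. of_bool (w \<in> ball E r {v}))"
      by (simp add: sum_of_bool_eq)
  qed
  also have "\<dots> = (\<Sum>w\<in>V. Pr (\<lambda>E. w \<in> ball E r {v}))"
    by (simp add: expec_sum prob_def del: sum_of_bool_eq)
  finally show ?thesis using sum_Pr_ball_le[OF assms] by simp
qed

lemma Pr_ball_large_le:
  assumes "v \<in> V" "0 < L"
  shows "Pr (\<lambda>E. L \<le> real (card (ball E r {v}))) \<le> real (r + 1) * g ^ r / L"
proof -
  have "Pr (\<lambda>E. L \<le> real (card (ball E r {v}))) \<le> Exv (\<lambda>E. real (card (ball E r {v}))) / L"
    using p0 p1 assms by (intro markov) auto
  also have "\<dots> \<le> real (r + 1) * g ^ r / L"
    using assms by (intro divide_right_mono Exv_card_ball_le) auto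
  finally show ?thesis .
qed

lemma Pr_conj_le:
  assumes "u \<in> V" "v \<in> V" "local_at r u A" "local_at r v B" "increasing A" "increasing B"
  shows "Pr (\<lambda>E. A E \<and> B E) \<le> Pr A * Pr B + Pr (\<lambda>E. v \<in> ball E (2 * r) {u})"
proof -
  have "Pr (\<lambda>E. A E \<and> B E) \<le> Pr (\<lambda>E. box A B E \<or> v \<in> ball E (2 * r) {u})"
  proof (rule Pr_mono)
    fix E assume E: "E \<subseteq> F" "A E \<and> B E"
    let ?I = "{e\<in>E. e \<subseteq> ball E r {u}}" and ?J = "{e\<in>E. e \<subseteq> ball E r {v}}"
    have AB: "A ?I" "B ?J" using local_atD[OF assms(3)] local_atD[OF assms(4)] E by auto
    show "box A B E \<or> v \<in> ball E (2 * r) {u}"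
    proof (cases "?I \<inter> ?J = {}")
      case True
      then have "box A B E" using AB by (intro boxI[of A ?I B ?J]) auto
      then show ?thesis ..
    next
      case False
      then obtain e where e: "e \<in> E" "e \<subseteq> ball E r {u}" "e \<subseteq> ball E r {v}" by auto
      have "e \<noteq> {}" using E(1) e(1) by (auto simp: all_edges_def)
      then obtain x where "x \<in> e" by auto
      then have "x \<in> ball E r {u}" "v \<in> ball E r {x}"
        using e ball_sym[of x E r v] by auto
      then have "v \<in> ball E (r + r) {u}" by (rule ball_trans)
      then show ?thesis by (simp add: mult_2)
    qed
  qed
  also have "\<dots> \<le> Pr (box A B) + Pr (\<lambda>E. v \<in> ball E (2 * r) {u})"
    using prob_disj_le[OF p0 p1] .
  also have "\<dots> \<le> Pr A * Pr B + Pr (\<lambda>E. v \<in> ball E (2 * r) {u})"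
    using assms by (intro add_right_mono Pr_box)
  finally show ?thesis .
qed

section \<open>Moment methods for counts of vertices\<close>

definition num :: "(nat \<Rightarrow> nat set set \<Rightarrow> bool) \<Rightarrow> nat set set \<Rightarrow> real" where
  "num H E = (\<Sum>v\<in>V. of_bool (H v E))"

lemma num_eq_card: "num H E = real (card {v\<in>V. H v E})"
  by (simp add: num_def sum_of_bool_eq Int_def)

lemma num_nonneg: "0 \<le> num H E"
  by (simp add: num_eq_card)

lemma Exv_num: "Exv (num H) = (\<Sum>v\<in>V. Pr (H v))"
  by (simp add: num_def[abs_def] expec_sum prob_def del: sum_of_bool_eq)

text \<open>The excess of the second moment over the square of the mean is at most the expected
  number of ordered pairs at distance at most 2r. With r of order 1/eps and \<open>a\<close> of
  order eps n the right-hand side is O(1/(eps^3 n)).\<close>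

lemma num_concentration:
  assumes "\<And>v. v \<in> V \<Longrightarrow> local_at r v (H v)" "\<And>v. v \<in> V \<Longrightarrow> increasing (H v)" "a > 0"
  shows "Pr (\<lambda>E. a \<le> \<bar>num H E - Exv (num H)\<bar>) \<le> real n * (real (2 * r + 1) * g ^ (2 * r)) / a\<^sup>2"
proof (rule chebyshev[OF pr assms(3)])
  have "Exv (\<lambda>E. (num H E)\<^sup>2) = Exv (\<lambda>E. \<Sum>u\<in>V. \<Sum>v\<in>V. of_bool (H u E \<and> H v E))"
    by (intro expec_cong) (simp add: num_def power2_eq_square sum_product of_bool_conj del: sum_of_bool_eq)
  also have "\<dots> = (\<Sum>u\<in>V. \<Sum>v\<in>V. Pr (\<lambda>E. H u E \<and> H v E))"
    by (simp add: expec_sum prob_def del: sum_of_bool_eq)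
  also have "\<dots> \<le> (\<Sum>u\<in>V. \<Sum>v\<in>V. Pr (H u) * Pr (H v) + Pr (\<lambda>E. v \<in> ball E (2 * r) {u}))"
    using assms by (intro sum_mono Pr_conj_le) auto
  also have "\<dots> = (Exv (num H))\<^sup>2 + (\<Sum>u\<in>V. \<Sum>v\<in>V. Pr (\<lambda>E. v \<in> ball E (2 * r) {u}))"
    by (simp add: sum.distrib Exv_num power2_eq_square sum_product)
  also have "\<dots> \<le> (Exv (num H))\<^sup>2 + (\<Sum>u\<in>V. real (2 * r + 1) * g ^ (2 * r))"
    by (intro add_left_mono sum_mono sum_Pr_ball_le) auto
  finally show "Exv (\<lambda>E. (num H E)\<^sup>2) \<le> (Exv (num H))\<^sup>2 + real n * (real (2 * r + 1) * g ^ (2 * r))"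
    by simp
qed

text \<open>A first-moment bound, for events such as lying in a small component that are neither
  local nor increasing.\<close>

lemma Pr_num_ge:
  assumes "a > 0" "\<And>v. v \<in> V \<Longrightarrow> Pr (H v) \<le> x"
  shows "Pr (\<lambda>E. a \<le> num H E) \<le> real n * x / a"
proof -
  have "Pr (\<lambda>E. a \<le> num H E) \<le> Exv (num H) / a"
    using p0 p1 assms num_nonneg by (intro markov) auto
  also have "\<dots> \<le> real n * x / a"
    unfolding Exv_num using assms sum_mono[of V "\<lambda>v. Pr (H v)" "\<lambda>_. x"] by (intro divide_right_mono) auto
  finally show ?thesis .
qed

end

subsection \<open>Lollipops\<close>

lemma at_dist_unique: "at_dist E i v w \<Longrightarrow> at_dist E j v w \<Longrightarrow> i = j"
  unfolding at_dist_def by (metis nat_neq_iff)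

lemma at_dist_ball: "at_dist E a v y \<Longrightarrow> w \<in> ball E m {y} \<Longrightarrow> w \<in> ball E (a + m) {v}"
  by (rule ball_trans[of y]) (auto simp: at_dist_def)

text \<open>Passing from radius j to j + 1 inspects only edges that meet the ball of radius j. Hence
  the balls up to radius i + 1 depend only on the edges touching the ball of radius i.\<close>

lemma ball_agree:
  assumes "ball E i {v} \<subseteq> X" "\<And>u w. u \<in> X \<Longrightarrow> {u, w} \<in> E \<longleftrightarrow> {u, w} \<in> E'"
  shows "j \<le> Suc i \<Longrightarrow> ball E' j {v} = ball E j {v}"
proof (induction j)
  case (Suc j)
  have "ball E j {v} \<subseteq> X" using assms(1) Suc.prems ball_mono_radius[of j i E "{v}"] by auto
  then have "{u, w} \<in> E \<longleftrightarrow> {u, w} \<in> E'" if "u \<in> ball E j {v}" for u w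
    using that assms(2) by blast
  then show ?case using Suc by auto
qed auto

text \<open>The part of a geodesic after level \<open>a\<close> runs through levels at least
  \<open>a\<close> and so never meets the ball of smaller radius \<open>i\<close>. It therefore
  survives when the edges touching that ball have been exposed.\<close>

lemma ball_avoid:
  assumes "at_dist E a v y" "at_dist E (a + m) v w" "w \<in> ball E m {y}" "i < a"
  shows "w \<in> ball {e\<in>E. e \<inter> ball E i {v} = {}} m {y}"
  using assms(2,3)
proof (induction m arbitrary: w)
  case (Suc m)
  have no: "u \<notin> ball E i {v}" if "at_dist E (a + l) v u" for u l
    using that assms(4) by (auto simp: at_dist_def)
  have "w \<notin> ball E m {y}"
  proof
    assume "w \<in> ball E m {y}"
    then have "w \<in> ball E (a + m) {v}" by (rule at_dist_ball[OF assms(1)])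
    then show False using Suc.prems(1) by (auto simp: at_dist_def)
  qed
  then obtain x where x: "x \<in> ball E m {y}" "{x, w} \<in> E" using Suc.prems(2) by auto
  have "x \<in> ball E (a + m) {v}" using x(1) by (rule at_dist_ball[OF assms(1)])
  moreover have "x \<notin> ball E l {v}" if "l < a + m" for l
  proof
    assume "x \<in> ball E l {v}"
    then have "w \<in> ball E (Suc l) {v}" using x by auto
    then show False using Suc.prems(1) that by (auto simp: at_dist_def simp del: ball.simps)
  qed
  ultimately have d: "at_dist E (a + m) v x" by (auto simp: at_dist_def)
  have "x \<in> ball {e\<in>E. e \<inter> ball E i {v} = {}} m {y}" using Suc.IH[OF d x(1)] .
  moreover have "{x, w} \<in> {e\<in>E. e \<inter> ball E i {v} = {}}"
    using x no[OF d] no[of "Suc m" w] Suc.prems(1) by auto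
  ultimately show ?case by auto
qed auto

lemma walk_ball:
  assumes "\<And>l. l < k \<Longrightarrow> {ys l, ys (Suc l)} \<in> E" "l \<le> m" "m \<le> k"
  shows "ys m \<in> ball E (m - l) {ys l}"
  using assms(2,3)
proof (induction m rule: dec_induct)
  case (step m)
  then have "ys m \<in> ball E (m - l) {ys l}" "{ys m, ys (Suc m)} \<in> E" using assms(1) by auto
  then show ?case using step by (auto simp: Suc_diff_le)
qed auto

lemma geodesic_walk:
  "at_dist E k v w \<Longrightarrow> \<exists>ys. ys 0 = v \<and> ys k = w \<and> (\<forall>l<k. {ys l, ys (Suc l)} \<in> E)"
proof (induction k arbitrary: w)
  case 0
  then show ?case by (intro exI[of _ "\<lambda>_. v"]) (auto simp: at_dist_def)
next
  case (Suc k)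
  obtain u where u: "at_dist E k v u" "at_dist E (Suc k - k) u w"
    using at_dist_intermediate[OF Suc.prems, of k] by auto
  then have uw: "{u, w} \<in> E" by (auto simp: at_dist_def)
  obtain ys where "ys 0 = v" "ys k = u" "\<forall>l<k. {ys l, ys (Suc l)} \<in> E" using Suc.IH[OF u(1)] by auto
  then show ?case using uw by (intro exI[of _ "ys(Suc k := w)"]) (auto simp: less_Suc_eq)
qed

lemma trail_of_arm:
  assumes "arm V k v E" "v \<in> V"
  shows "\<exists>xs. xs 0 = v \<and> (\<forall>l<k. {xs l, xs (Suc l)} \<in> E) \<and> (\<forall>l\<le>k. xs l \<in> V)
    \<and> inj_on (\<lambda>l. {xs l, xs (Suc l)}) {..<k}"
  using assms
proof (induction k arbitrary: v E)
  case 0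
  then show ?case by (intro exI[of _ "\<lambda>_. v"]) auto
next
  case (Suc k)
  then obtain u where u: "u \<in> V" and b: "box (\<lambda>I. {v, u} \<in> I) (arm V k u) E" by auto
  from b obtain I J where *: "I \<inter> J = {}" "I \<subseteq> E" "J \<subseteq> E" "{v, u} \<in> I" "arm V k u J"
    unfolding box_def by auto
  from Suc.IH[OF *(5) u] obtain xs where xs: "xs 0 = u" "\<forall>l<k. {xs l, xs (Suc l)} \<in> J"
    "\<forall>l\<le>k. xs l \<in> V" "inj_on (\<lambda>l. {xs l, xs (Suc l)}) {..<k}" by auto
  define ys where "ys l = (case l of 0 \<Rightarrow> v | Suc l \<Rightarrow> xs l)" for l
  have ys: "ys 0 = v" "\<And>l. ys (Suc l) = xs l" by (auto simp: ys_def)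
  have e: "{ys l, ys (Suc l)} \<in> E" if "l < Suc k" for l
    using that xs * ys by (cases l) auto
  have V: "ys l \<in> V" if "l \<le> Suc k" for l
    using that xs ys Suc.prems(2) by (cases l) auto
  have "inj_on (\<lambda>l. {ys l, ys (Suc l)}) {..<Suc k}"
  proof (rule inj_onI)
    fix l m assume lm: "l \<in> {..<Suc k}" "m \<in> {..<Suc k}" "{ys l, ys (Suc l)} = {ys m, ys (Suc m)}"
    have ne: "{ys 0, ys (Suc 0)} \<noteq> {ys (Suc a), ys (Suc (Suc a))}" if "a < k" for a
      unfolding ys using that xs(1,2) * by auto
    show "l = m"
    proof (cases l)
      case 0
      then show ?thesis using lm ne by (cases m) (auto simp del: doubleton_eq_iff)
    next
      case (Suc a)
      show ?thesis
      proof (cases m)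
        case 0
        then show ?thesis using lm Suc ne[of a] by (auto simp del: doubleton_eq_iff)
      next
        case (Suc b)
        have "{xs a, xs (Suc a)} = {xs b, xs (Suc b)}"
          using lm(3) \<open>l = Suc a\<close> Suc by (simp add: ys del: doubleton_eq_iff)
        then have "a = b"
          using xs(4) lm(1,2) \<open>l = Suc a\<close> Suc unfolding inj_on_def by auto
        then show ?thesis using \<open>l = Suc a\<close> Suc by simp
      qed
    qed
  qed
  then show ?case using ys e V by (intro exI[of _ ys]) blast
qed

text \<open>The witness is exactly the edge set of the segment, so that disjoint index ranges of one
  trail give disjoint witnesses.\<close>

lemma conn_of_trail:
  assumes "\<And>l. i \<le> l \<Longrightarrow> l \<le> j \<Longrightarrow> xs l \<in> V" "inj_on (\<lambda>l. {xs l, xs (Suc l)}) {i..<j}" "i \<le> j"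
  shows "conn V (j - i) (xs j) (xs i) ((\<lambda>l. {xs l, xs (Suc l)}) ` {i..<j})"
  using assms(3,1,2)
proof (induction i rule: inc_induct)
  case (step i)
  let ?e = "\<lambda>l. {xs l, xs (Suc l)}"
  have "conn V (j - Suc i) (xs j) (xs (Suc i)) (?e ` {Suc i..<j})"
    using step by (intro step.IH) (auto elim: inj_on_subset)
  moreover have "?e i \<notin> ?e ` {Suc i..<j}"
  proof
    assume "?e i \<in> ?e ` {Suc i..<j}"
    then obtain l where l: "?e i = ?e l" "l \<in> {Suc i..<j}" by (rule imageE)
    have "i = l" by (rule inj_onD[OF step.prems(2) l(1)]) (use l step.hyps in auto)
    then show False using l by simp
  qed
  ultimately have "box (\<lambda>I. ?e i \<in> I) (conn V (j - Suc i) (xs j) (xs (Suc i))) (?e ` {i..<j})"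
    using step.hyps by (intro boxI[of _ "{?e i}" _ "?e ` {Suc i..<j}"]) auto
  moreover have "xs (Suc i) \<in> V" using step.prems(1) step.hyps by auto
  ultimately show ?case using step.hyps by (auto simp: Suc_diff_Suc[symmetric])
qed auto

text \<open>At its first non-geodesic vertex \<open>z\<close> the trail closes a cycle with a geodesic branching off at \<open>x\<close>.
  That the two routes from \<open>x\<close> to \<open>z\<close> have almost equal lengths saves a factor \<open>k\<close> in the union
  bound below, without which it would fail near the critical window.\<close>

lemma arm_far_or_lollipop:
  assumes E: "E \<subseteq> Pow V" and v: "v \<in> V" and arm: "arm V k v E" and nf: "\<not> (\<exists>w. at_dist E k v w)"
  shows "\<exists>i\<le>k. \<exists>a\<in>{1..k}. \<exists>b. (b + 1 = a \<or> b + 2 = a) \<and> (\<exists>x\<in>V. \<exists>z\<in>V.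
     box (conn V i x v) (box (conn V a z x) (conn V b z x)) E)"
proof -
  obtain xs where xs: "xs 0 = v" "\<And>l. l < k \<Longrightarrow> {xs l, xs (Suc l)} \<in> E" "\<And>l. l \<le> k \<Longrightarrow> xs l \<in> V"
    "inj_on (\<lambda>l. {xs l, xs (Suc l)}) {..<k}"
    using trail_of_arm[OF arm v] by blast
  \<comment> \<open>Up to index \<open>j - 1\<close> the trail is a geodesic; \<open>xs j\<close> is
    the first vertex nearer to \<open>v\<close> than its index.\<close>
  define j where "j = (LEAST j. \<not> at_dist E j v (xs j))"
  have ex: "\<not> at_dist E k v (xs k)" using nf by blast
  have j: "\<not> at_dist E j v (xs j)" "j \<le> k" and lt: "\<And>l. l < j \<Longrightarrow> at_dist E l v (xs l)"
    unfolding j_def using ex by (rule LeastI, rule Least_le, use not_less_Least in blast)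
  have "at_dist E 0 v (xs 0)" using xs(1) by (auto simp: at_dist_def)
  then have j0: "0 < j" using j(1) by (cases j) auto
  have "xs j \<in> ball E (j - 0) {xs 0}" using xs(2) j(2) by (intro walk_ball[where k=k]) auto
  then obtain l0 where l0: "l0 \<le> j" "at_dist E l0 v (xs j)"
    using at_dist_exists[of "xs j" E j v] xs(1) by auto
  then have l0j: "l0 < j" using j(1) by (cases "l0 = j") auto
  have "xs (j - 1) \<in> ball E (Suc l0) {v}"
  proof -
    have "{xs j, xs (j - 1)} \<in> E" using xs(2)[of "j - 1"] j0 j(2) by (simp add: insert_commute)
    then show ?thesis using l0(2) by (auto simp: at_dist_def)
  qed
  \<comment> \<open>An edge changes the distance by at most 1, so the distance \<open>l0\<close> of
    \<open>xs j\<close> is j - 1 or j - 2. These are the two possible values of \<open>b\<close>,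
    for an odd or an even closed circuit.\<close>
  then have l0g: "j - 1 \<le> Suc l0"
    using lt[of "j - 1"] j0 by (auto simp: at_dist_def not_less[symmetric] simp del: ball.simps)
  \<comment> \<open>\<open>Q i\<close> says that some geodesic from \<open>v\<close> to
    \<open>xs j\<close> passes through \<open>xs i\<close>. The last such \<open>i\<close> is the
    branch point, and its maximality keeps the two routes from there to \<open>xs j\<close>
    edge-disjoint.\<close>
  define Q where "Q = (\<lambda>i. i \<le> l0 \<and> xs j \<in> ball E (l0 - i) {xs i})"
  have "Q 0" using l0(2) xs(1) by (auto simp: Q_def at_dist_def)
  then obtain i where i: "Q i" and imax: "\<And>m. Q m \<Longrightarrow> m \<le> i"
    using GreatestI_nat[of Q 0 l0] Greatest_le_nat[of Q _ l0] unfolding Q_def by blast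
  define b where "b = l0 - i"
  have il: "i \<le> l0" "l0 = i + b" "xs j \<in> ball E b {xs i}" using i by (auto simp: Q_def b_def)
  have lv: "at_dist E i v (xs i)" using lt il l0j by auto
  have "xs j \<notin> ball E m {xs i}" if "m < b" for m
  proof
    assume "xs j \<in> ball E m {xs i}"
    then have "xs j \<in> ball E (i + m) {v}" by (rule at_dist_ball[OF lv])
    then show False using l0(2) il that by (auto simp: at_dist_def)
  qed
  then have bd: "at_dist E b (xs i) (xs j)" using il by (auto simp: at_dist_def)
  obtain ys where ys: "ys 0 = xs i" "ys b = xs j" "\<And>l. l < b \<Longrightarrow> {ys l, ys (Suc l)} \<in> E"
    using geodesic_walk[OF bd] by metis
  have ylev: "at_dist E (i + l) v (ys l)" if "l \<le> b" for l
  proof -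
    have "ys l \<in> ball E (l - 0) {ys 0}" using that ys(3) by (intro walk_ball[where k=b]) auto
    then have 1: "ys l \<in> ball E (i + l) {v}" using at_dist_ball[OF lv] ys(1) by simp
    have 2: "ys b \<in> ball E (b - l) {ys l}" using that ys(3) by (intro walk_ball[where k=b]) auto
    have "ys l \<notin> ball E m {v}" if m: "m < i + l" for m
    proof
      assume "ys l \<in> ball E m {v}"
      then have "xs j \<in> ball E (m + (b - l)) {v}" using 2[unfolded ys(2)] by (rule ball_trans)
      then show False using l0(2) il m that \<open>l \<le> b\<close> by (auto simp: at_dist_def)
    qed
    then show ?thesis using 1 by (auto simp: at_dist_def)
  qed
  have yV: "ys l \<in> V" if "l \<le> b" for l
    using ylev[OF that] ball_subset[OF _ E, of "{v}"] v by (auto simp: at_dist_def)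
  let ?e = "\<lambda>l. {xs l, xs (Suc l)}" and ?f = "\<lambda>l. {ys l, ys (Suc l)}"
  have finj: "l = m" if "l < b" "m < b" "?f l = ?f m" for l m
  proof -
    have lev: "at_dist E (i + l) v (ys l)" "at_dist E (i + Suc l) v (ys (Suc l))"
      "at_dist E (i + m) v (ys m)" "at_dist E (i + Suc m) v (ys (Suc m))"
      using ylev that by (auto simp del: add_Suc_right)
    from that(3) consider "ys l = ys m" | "ys l = ys (Suc m)" "ys (Suc l) = ys m"
      by (auto simp: doubleton_eq_iff)
    then show ?thesis
    proof cases
      case 1
      then have "i + l = i + m" using lev(1,3) at_dist_unique by metis
      then show ?thesis by simp
    next
      case 2
      then have "i + l = i + Suc m" "i + Suc l = i + m"
        using lev by (metis at_dist_unique)+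
      then show ?thesis by simp
    qed
  qed
  let ?I1 = "?e ` {0..<i}" and ?I2 = "?e ` {i..<j}" and ?I3 = "?f ` {0..<b}"
  have c1: "conn V (i - 0) (xs i) (xs 0) ?I1"
    using xs j l0j il by (intro conn_of_trail) (auto elim: inj_on_subset)
  have c2: "conn V (j - i) (xs j) (xs i) ?I2"
    using xs j l0j il by (intro conn_of_trail) (auto elim: inj_on_subset)
  have c3: "conn V (b - 0) (ys b) (ys 0) ?I3"
    using yV finj by (intro conn_of_trail) (auto simp: inj_on_def simp del: doubleton_eq_iff)
  have d12: "?I1 \<inter> ?I2 = {}"
  proof -
    have "?e ` ({0..<i} \<inter> {i..<j}) = ?I1 \<inter> ?I2"
      using il l0j j by (intro inj_on_image_Int[OF xs(4)]) auto
    then show ?thesis by simp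
  qed
  have d13: "?e l \<noteq> ?f m" if "l < i" "m < b" for l m
  proof
    assume "?e l = ?f m"
    then have "xs l = ys m \<or> xs l = ys (Suc m)" by (auto simp: doubleton_eq_iff)
    moreover have x: "at_dist E l v (xs l)" using lt that il l0j by auto
    moreover have y: "at_dist E (i + m) v (ys m)" "at_dist E (i + Suc m) v (ys (Suc m))"
      using ylev[of m] ylev[of "Suc m"] that by auto
    ultimately have "l = i + m \<or> l = i + Suc m"
      by (elim disjE) (use at_dist_unique in metis)+
    then show False using that by simp
  qed
  \<comment> \<open>Levels decide every case. A common edge traversed upwards before the last trail
    step would move the branch point to \<open>Suc m\<close>; any other coincidence gives one vertex
    two different distances from \<open>v\<close>.\<close>
  have d23: "?e m \<noteq> ?f l" if m: "i \<le> m" "m < j" and l: "l < b" for m l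
  proof
    assume eq: "?e m = ?f l"
    have y1: "at_dist E (i + l) v (ys l)" and y2: "at_dist E (i + Suc l) v (ys (Suc l))"
      using ylev[of l] ylev[of "Suc l"] l by auto
    have x1: "at_dist E m v (xs m)" using lt m by auto
    show False
    proof (cases "Suc m < j")
      case True
      then have x2: "at_dist E (Suc m) v (xs (Suc m))" using lt by auto
      from eq consider "xs m = ys l" "xs (Suc m) = ys (Suc l)" | "xs m = ys (Suc l)" "xs (Suc m) = ys l"
        by (auto simp: doubleton_eq_iff)
      then show False
      proof cases
        case 1
        then have ml: "m = i + l" using x1 y1 at_dist_unique by metis
        have "ys b \<in> ball E (b - Suc l) {ys (Suc l)}" using l ys(3) by (intro walk_ball[where k=b]) auto
        then have "Q (Suc m)" using 1 ml il l ys(2) by (auto simp: Q_def)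
        then show False using imax[of "Suc m"] m by simp
      next
        case 2
        then have "m = i + Suc l" "Suc m = i + l" using x1 x2 y1 y2 at_dist_unique by metis+
        then show False by simp
      qed
    next
      case False
      then have mj: "Suc m = j" using m by simp
      from eq consider "xs m = ys l" "xs j = ys (Suc l)" | "xs m = ys (Suc l)" "xs j = ys l"
        unfolding mj by (auto simp: doubleton_eq_iff)
      then show False
      proof cases
        case 1
        then have "m = i + l" "l0 = i + Suc l" using x1 y1 y2 l0(2) at_dist_unique by metis+
        then show False using mj l0j by simp
      next
        case 2
        then have "l0 = i + l" using y1 l0(2) at_dist_unique by metis
        then show False using il l by simp
      qed
    qed
  qed
  have sub: "?I1 \<subseteq> E" "?I2 \<subseteq> E" "?I3 \<subseteq> E"
    using xs(2) ys(3) j il l0j by auto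
  have "?I2 \<inter> ?I3 = {}" using d23 by (auto simp del: doubleton_eq_iff)
  then have B1: "box (conn V (j - i) (xs j) (xs i)) (conn V b (xs j) (xs i)) (?I2 \<union> ?I3)"
    using c2 c3 ys by (intro boxI[of _ ?I2 _ ?I3]) auto
  have "?I1 \<inter> ?I3 = {}" using d13 by (auto simp del: doubleton_eq_iff)
  then have B2: "?I1 \<inter> (?I2 \<union> ?I3) = {}" using d12 by blast
  have B0: "conn V i (xs i) v ?I1" using c1 xs(1) by simp
  have "?I2 \<union> ?I3 \<subseteq> E" using sub(2,3) by (rule Un_least)
  with sub(1) have B: "box (conn V i (xs i) v) (box (conn V (j - i) (xs j) (xs i)) (conn V b (xs j) (xs i))) E"
    by (rule boxI[of "conn V i (xs i) v" ?I1 "box (conn V (j - i) (xs j) (xs i)) (conn V b (xs j) (xs i))"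
          "?I2 \<union> ?I3", OF B0 B1 B2])
  have "b + 1 = j - i \<or> b + 2 = j - i" "i \<le> k" "j - i \<in> {1..k}" "xs i \<in> V" "xs j \<in> V"
    using l0g l0j il j xs(3) by auto
  with B show ?thesis
    by (intro exI[of _ i] conjI bexI[of _ "j - i"] exI[of _ b] bexI[of _ "xs i"] bexI[of _ "xs j"])
qed

subsection \<open>Small balls around vertices with long arms\<close>

context gnp
begin

text \<open>Summing over x pays for the stick, and summing over z pays for the route of length b.
  The route of length a then joins two prescribed vertices, which costs the factor \<open>p\<close>
  uncompensated by any choice.\<close>

lemma Pr_lollipop_le:
  assumes "1 \<le> a"
  shows "Pr (\<lambda>E. \<exists>x\<in>V. \<exists>z\<in>V. box (conn V i x v) (box (conn V a z x) (conn V b z x)) E)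
    \<le> p * g ^ (i + a + b)"
proof -
  note inc = increasing_chain[OF increasing_triv]
  obtain a' where a: "a = Suc a'" using assms by (cases a) auto
  have "Pr (\<lambda>E. \<exists>x\<in>V. \<exists>z\<in>V. box (conn V i x v) (box (conn V a z x) (conn V b z x)) E)
    \<le> (\<Sum>x\<in>V. Pr (\<lambda>E. \<exists>z\<in>V. box (conn V i x v) (box (conn V a z x) (conn V b z x)) E))"
    by (rule prob_Ex_le[OF p0 p1]) simp
  also have "\<dots> \<le> (\<Sum>x\<in>V. \<Sum>z\<in>V. Pr (box (conn V i x v) (box (conn V a z x) (conn V b z x))))"
    by (intro sum_mono prob_Ex_le[OF p0 p1]) simp
  also have "\<dots> \<le> (\<Sum>x\<in>V. \<Sum>z\<in>V. Pr (conn V i x v) * ((p * g ^ a') * Pr (conn V b z x)))"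
  proof (intro sum_mono)
    fix x z
    have "Pr (box (conn V i x v) (box (conn V a z x) (conn V b z x)))
        \<le> Pr (conn V i x v) * Pr (box (conn V a z x) (conn V b z x))"
      by (intro Pr_box inc increasing_box)
    also have "\<dots> \<le> Pr (conn V i x v) * (Pr (conn V a z x) * Pr (conn V b z x))"
      by (intro mult_left_mono Pr_box inc Pr_nonneg)
    also have "\<dots> \<le> Pr (conn V i x v) * ((p * g ^ a') * Pr (conn V b z x))"
      unfolding a by (intro mult_left_mono mult_right_mono Pr_conn_le Pr_nonneg)
    finally show "Pr (box (conn V i x v) (box (conn V a z x) (conn V b z x)))
        \<le> Pr (conn V i x v) * ((p * g ^ a') * Pr (conn V b z x))" .
  qed
  also have "\<dots> = (\<Sum>x\<in>V. Pr (conn V i x v) * ((p * g ^ a') * (\<Sum>z\<in>V. Pr (conn V b z x))))"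
    by (simp add: sum_distrib_left)
  also have "\<dots> \<le> (\<Sum>x\<in>V. Pr (conn V i x v) * ((p * g ^ a') * g ^ b))"
    using p0 g1 by (intro sum_mono mult_left_mono sum_Pr_conn Pr_nonneg) auto
  also have "\<dots> = (\<Sum>x\<in>V. Pr (conn V i x v)) * ((p * g ^ a') * g ^ b)"
    by (simp add: sum_distrib_right)
  also have "\<dots> \<le> g ^ i * ((p * g ^ a') * g ^ b)"
    using p0 g1 by (intro mult_right_mono sum_Pr_conn) auto
  also have "\<dots> = p * g ^ (i + a' + b)" by (simp add: power_add)
  also have "\<dots> \<le> p * g ^ (i + a + b)"
    using p0 g1 a by (intro mult_left_mono power_increasing) auto
  finally show ?thesis .
qed

lemma Pr_arm_not_far_le:
  assumes "v \<in> V"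
  shows "Pr (\<lambda>E. arm V k v E \<and> \<not> (\<exists>w. at_dist E k v w)) \<le> real (2 * k * (k + 1)) * (p * g ^ (3 * k))"
proof -
  let ?L = "\<lambda>i a b E. \<exists>x\<in>V. \<exists>z\<in>V. box (conn V i x v) (box (conn V a z x) (conn V b z x)) E"
  have L: "Pr (?L i a b) \<le> p * g ^ (3 * k)" if "i \<le> k" "1 \<le> a" "a \<le> k" "b \<le> k" for i a b
  proof -
    have "Pr (?L i a b) \<le> p * g ^ (i + a + b)" using that by (intro Pr_lollipop_le)
    also have "\<dots> \<le> p * g ^ (3 * k)" using that p0 g1 by (intro mult_left_mono power_increasing) auto
    finally show ?thesis .
  qed
  \<comment> \<open>For a = 1 the truncated difference \<open>a - 2\<close> equals
    \<open>a - 1\<close>; this only repeats an event in the union bound.\<close>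
  have "Pr (\<lambda>E. arm V k v E \<and> \<not> (\<exists>w. at_dist E k v w))
      \<le> Pr (\<lambda>E. \<exists>i\<in>{..k}. \<exists>a\<in>{1..k}. ?L i a (a - 1) E \<or> ?L i a (a - 2) E)"
  proof (rule Pr_mono)
    fix E assume E: "E \<subseteq> F" "arm V k v E \<and> \<not> (\<exists>w. at_dist E k v w)"
    obtain i a b where "i \<le> k" "a \<in> {1..k}" and b: "b + 1 = a \<or> b + 2 = a" and L: "?L i a b E"
      using arm_far_or_lollipop[OF edges_sub[OF E(1)] assms] E(2) by metis
    moreover from b have "b = a - 1 \<or> b = a - 2" by auto
    then have "?L i a (a - 1) E \<or> ?L i a (a - 2) E" using L by (elim disjE) simp_all
    ultimately show "\<exists>i\<in>{..k}. \<exists>a\<in>{1..k}. ?L i a (a - 1) E \<or> ?L i a (a - 2) E"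
      by (intro bexI[of _ i] bexI[of _ a]) auto
  qed
  also have "\<dots> \<le> (\<Sum>i\<in>{..k}. Pr (\<lambda>E. \<exists>a\<in>{1..k}. ?L i a (a - 1) E \<or> ?L i a (a - 2) E))"
    by (rule prob_Ex_le[OF p0 p1]) simp
  also have "\<dots> \<le> (\<Sum>i\<in>{..k}. \<Sum>a\<in>{1..k}. Pr (\<lambda>E. ?L i a (a - 1) E \<or> ?L i a (a - 2) E))"
    by (intro sum_mono prob_Ex_le[OF p0 p1]) simp
  also have "\<dots> \<le> (\<Sum>i\<in>{..k}. \<Sum>a\<in>{1..k}. Pr (?L i a (a - 1)) + Pr (?L i a (a - 2)))"
    by (intro sum_mono prob_disj_le[OF p0 p1])
  also have "\<dots> \<le> (\<Sum>i\<in>{..k}. \<Sum>a\<in>{1..k}. p * g ^ (3 * k) + p * g ^ (3 * k))"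
    by (intro sum_mono add_mono L) auto
  also have "\<dots> = real (2 * k * (k + 1)) * (p * g ^ (3 * k))" by (simp add: algebra_simps)
  finally show ?thesis .
qed

text \<open>Exposing the ball of radius \<open>i\<close> leaves the edges disjoint from it untouched,
  so a small sphere of radius \<open>i + 1\<close> has few chances to continue.\<close>

lemma Pr_far_small_sphere_le:
  assumes v: "v \<in> V" and k: "Suc i \<le> k" and L: "0 \<le> L" and t: "\<And>y. Pr (arm V (k - Suc i) y) \<le> t"
  shows "Pr (\<lambda>E. (\<exists>w. at_dist E k v w) \<and> real (card (ball E (Suc i) {v} - ball E i {v})) \<le> L)
    \<le> Pr (arm V (Suc i) v) * (L * t)"
proof -
  \<comment> \<open>The edges touching X decide whether the ball of radius i is X and the next one
    is Y. The edges disjoint from X are independent of this event.\<close>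
  define tc where "tc X = {e\<in>F. e \<inter> X \<noteq> {}}" for X :: "nat set"
  define D where "D X Y E \<longleftrightarrow> ball E i {v} = X \<and> ball E (Suc i) {v} = Y" for X Y :: "nat set" and E
  \<comment> \<open>Requiring a nonempty sphere makes each of these mutually exclusive events imply
    an arm of length i + 1. Their total probability is therefore at most that of the arm, which
    yields the first factor.\<close>
  define S where "S = {(X, Y). X \<subseteq> V \<and> Y \<subseteq> V \<and> Y - X \<noteq> {} \<and> real (card (Y - X)) \<le> L}"
  have fS: "finite S" by (rule finite_subset[of _ "Pow V \<times> Pow V"]) (auto simp: S_def)
  have t0: "0 \<le> t" using t[of v] Pr_nonneg[of "arm V (k - Suc i) v"] by linarith
  have Dtc: "D X Y E \<longleftrightarrow> D X Y (E \<inter> tc X)" if "E \<subseteq> F" for X Y E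
  proof -
    have ag: "{u, w} \<in> E \<longleftrightarrow> {u, w} \<in> E \<inter> tc X" if "u \<in> X" for u w
      using that \<open>E \<subseteq> F\<close> by (auto simp: tc_def)
    have "D X Y (E \<inter> tc X)" if d: "D X Y E"
    proof -
      have "ball E i {v} \<subseteq> X" using d by (simp add: D_def)
      note * = ball_agree[OF this ag]
      show ?thesis using d *[of i] *[of "Suc i"] unfolding D_def by (simp del: ball.simps)
    qed
    moreover have "D X Y E" if d: "D X Y (E \<inter> tc X)"
    proof -
      have "ball (E \<inter> tc X) i {v} \<subseteq> X" using d by (simp add: D_def)
      note * = ball_agree[OF this ag[symmetric]]
      show ?thesis using d *[of i] *[of "Suc i"] unfolding D_def by (simp del: ball.simps)
    qed
    ultimately show ?thesis by blast
  qed
  have each: "Pr (\<lambda>E. D X Y E \<and> (\<exists>y\<in>Y - X. arm V (k - Suc i) y (E \<inter> (F - tc X))))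
      \<le> Pr (D X Y) * (L * t)" if XY: "(X, Y) \<in> S" for X Y
  proof -
    let ?R = "\<lambda>E. \<exists>y\<in>Y - X. arm V (k - Suc i) y E"
    have fin: "finite (Y - X)" using XY by (auto simp: S_def intro: finite_subset)
    have "Pr (\<lambda>E. D X Y E \<and> ?R (E \<inter> (F - tc X))) = Pr (\<lambda>E. D X Y (E \<inter> tc X) \<and> ?R (E \<inter> (F - tc X)))"
      by (rule prob_cong) (use Dtc in blast)
    also have "\<dots> = Pr (\<lambda>E. D X Y (E \<inter> tc X)) * Pr (\<lambda>E. ?R (E \<inter> (F - tc X)))"
      using prob_indep[OF finite_all_edges, of "tc X" n "F - tc X" p "D X Y" ?R] by (auto simp: tc_def)
    also have "Pr (\<lambda>E. D X Y (E \<inter> tc X)) = Pr (D X Y)"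
      by (rule prob_cong) (use Dtc in blast)
    also have "Pr (\<lambda>E. ?R (E \<inter> (F - tc X))) \<le> L * t"
    proof -
      have "Pr (\<lambda>E. ?R (E \<inter> (F - tc X))) \<le> Pr ?R"
        by (rule Pr_mono) (auto elim!: increasingD[OF increasing_arm])
      also have "\<dots> \<le> (\<Sum>y\<in>Y - X. Pr (arm V (k - Suc i) y))"
        by (rule prob_Ex_le[OF p0 p1 fin])
      also have "\<dots> \<le> (\<Sum>y\<in>Y - X. t)" by (intro sum_mono t)
      also have "\<dots> \<le> L * t" using XY t0 by (auto simp: S_def intro: mult_right_mono)
      finally show ?thesis .
    qed
    then have "Pr (D X Y) * Pr (\<lambda>E. ?R (E \<inter> (F - tc X))) \<le> Pr (D X Y) * (L * t)"
      by (intro mult_left_mono Pr_nonneg)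
    finally show ?thesis .
  qed
  have "Pr (\<lambda>E. (\<exists>w. at_dist E k v w) \<and> real (card (ball E (Suc i) {v} - ball E i {v})) \<le> L)
     \<le> Pr (\<lambda>E. \<exists>XY\<in>S. D (fst XY) (snd XY) E \<and>
          (\<exists>y\<in>snd XY - fst XY. arm V (k - Suc i) y (E \<inter> (F - tc (fst XY)))))"
  proof (rule Pr_mono)
    fix E assume E: "E \<subseteq> F" and
      "(\<exists>w. at_dist E k v w) \<and> real (card (ball E (Suc i) {v} - ball E i {v})) \<le> L"
    then obtain w where w: "at_dist E k v w" and c: "real (card (ball E (Suc i) {v} - ball E i {v})) \<le> L"
      by blast
    let ?X = "ball E i {v}" and ?Y = "ball E (Suc i) {v}"
    let ?E = "E \<inter> (F - tc ?X)"
    obtain y where y: "at_dist E (Suc i) v y" "at_dist E (k - Suc i) y w"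
      using at_dist_intermediate[OF w k] by blast
    have yXY: "y \<in> ?Y - ?X" using y(1) at_dist_ball_Diff by metis
    have sub: "?X \<subseteq> V" "?Y \<subseteq> V" using ball_sub_V[OF E v] by blast+
    have wV: "w \<in> V" using w ball_sub_V[OF E v] by (auto simp: at_dist_def)
    have "w \<in> ball {e\<in>E. e \<inter> ?X = {}} (k - Suc i) {y}"
      using ball_avoid[OF y(1), of "k - Suc i" w i] w y(2) k by (auto simp: at_dist_def)
    also have "{e\<in>E. e \<inter> ?X = {}} = ?E" using E by (auto simp: tc_def)
    finally have 1: "w \<in> ball ?E (k - Suc i) {y}" .
    have "ball ?E l {y} \<subseteq> ball E l {y}" for l by (rule ball_mono_edges) auto
    then have "at_dist ?E (k - Suc i) y w" using 1 y(2) unfolding at_dist_def by blast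
    then have "arm V (k - Suc i) y ?E" using edges_sub[OF E] wV by (intro arm_at_dist[of ?E]) auto
    moreover have "(?X, ?Y) \<in> S" using sub c yXY by (auto simp: S_def simp del: ball.simps)
    ultimately show "\<exists>XY\<in>S. D (fst XY) (snd XY) E \<and>
          (\<exists>y\<in>snd XY - fst XY. arm V (k - Suc i) y (E \<inter> (F - tc (fst XY))))"
      using yXY unfolding D_def by (intro bexI[of _ "(?X, ?Y)"]) (auto simp del: ball.simps)
  qed
  also have "\<dots> \<le> (\<Sum>XY\<in>S. Pr (\<lambda>E. D (fst XY) (snd XY) E \<and>
          (\<exists>y\<in>snd XY - fst XY. arm V (k - Suc i) y (E \<inter> (F - tc (fst XY))))))"
    by (rule prob_Ex_le[OF p0 p1 fS])
  also have "\<dots> \<le> (\<Sum>XY\<in>S. Pr (D (fst XY) (snd XY)) * (L * t))"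
    by (intro sum_mono each) auto
  also have "\<dots> = Exv (\<lambda>E. \<Sum>XY\<in>S. of_bool (D (fst XY) (snd XY) E)) * (L * t)"
    by (simp add: expec_sum prob_def sum_distrib_right del: sum_of_bool_eq)
  also have "\<dots> \<le> Pr (arm V (Suc i) v) * (L * t)"
  proof (rule mult_right_mono)
    show "Exv (\<lambda>E. \<Sum>XY\<in>S. of_bool (D (fst XY) (snd XY) E)) \<le> Pr (arm V (Suc i) v)"
      unfolding prob_def
    proof (rule expec_mono[OF p0 p1])
      fix E assume E: "E \<subseteq> F"
      let ?XY = "(ball E i {v}, ball E (Suc i) {v})"
      have "(\<Sum>XY\<in>S. of_bool (D (fst XY) (snd XY) E) :: real) = (\<Sum>XY\<in>S. if XY = ?XY then 1 else 0)"
        by (intro sum.cong) (auto simp: D_def prod_eq_iff simp del: ball.simps)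
      also have "\<dots> = of_bool (?XY \<in> S)" using fS by (simp del: ball.simps)
      also have "\<dots> \<le> of_bool (arm V (Suc i) v E)"
      proof (cases "?XY \<in> S")
        case True
        then obtain y where "y \<in> ball E (Suc i) {v} - ball E i {v}" "y \<in> V"
          unfolding S_def by blast
        then have "arm V (Suc i) v E"
          using arm_at_dist[OF edges_sub[OF E]] at_dist_ball_Diff by metis
        then show ?thesis by simp
      qed simp
      finally show "(\<Sum>XY\<in>S. of_bool (D (fst XY) (snd XY) E)) \<le> (of_bool (arm V (Suc i) v E) :: real)" .
    qed
  qed (use L t0 in auto)
  finally show ?thesis .
qed

lemma sum_card_spheres:
  assumes "finite W" "\<And>i. ball E i {v} \<subseteq> W" "a \<le> b"
  shows "(\<Sum>i\<in>{a..<b}. card (ball E (Suc i) {v} - ball E i {v})) + card (ball E a {v}) = card (ball E b {v})"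
  using assms(3)
proof (induction b rule: dec_induct)
  case (step b)
  have "finite (ball E (Suc b) {v})" using assms(1,2) finite_subset by metis
  then have "card (ball E b {v}) \<le> card (ball E (Suc b) {v})"
    "card (ball E (Suc b) {v} - ball E b {v}) = card (ball E (Suc b) {v}) - card (ball E b {v})"
    using ball_mono_radius[of b "Suc b" E "{v}"] assms(1) finite_subset[OF assms(2)[of b]]
    by (auto intro!: card_mono card_Diff_subset simp del: ball.simps)
  then show ?case using step by (simp del: ball.simps)
qed simp

text \<open>If the ball is small, fewer than half of the spheres of radius h + 1 to 2h have more
  than 2 \<kappa> h vertices, so averaging over these radii costs only a factor 2. For each radius
  there is an arm of length at least h up to the sphere and one of length at least h beyond it,
  whence two factors O(1/h) against the sphere size O(\<kappa> h).\<close>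

lemma Pr_far_small_ball_le:
  assumes v: "v \<in> V" and h: "1 \<le> h" and \<kappa>: "0 < \<kappa>"
  shows "Pr (\<lambda>E. (\<exists>w. at_dist E (3 * h) v w) \<and> real (card (ball E (2 * h) {v})) < \<kappa> * (real h)\<^sup>2)
    \<le> 64 * \<kappa> * g ^ (6 * h) / real h"
proof -
  define t where "t = 4 * g ^ (3 * h) / real h"
  have t: "Pr (arm V k y) \<le> t" if "h \<le> k" "k \<le> 3 * h" for k y
  proof -
    have "Pr (arm V k y) \<le> 4 * g ^ k / (real k + 4)" by (rule Pr_arm_le) simp
    also have "\<dots> \<le> t" unfolding t_def using that g1 h
      by (intro frac_le mult_left_mono power_increasing) auto
    finally show ?thesis .
  qed
  have t0: "0 \<le> t" using g1 by (simp add: t_def)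
  let ?far = "\<lambda>E. \<exists>w. at_dist E (3 * h) v w"
  let ?s = "\<lambda>E i. real (card (ball E (Suc i) {v} - ball E i {v}))"
  let ?L = "2 * \<kappa> * real h"
  have "Pr (\<lambda>E. ?far E \<and> real (card (ball E (2 * h) {v})) < \<kappa> * (real h)\<^sup>2)
     \<le> Exv (\<lambda>E. 2 / real h * (\<Sum>i\<in>{h..<2*h}. of_bool (?far E \<and> ?s E i \<le> ?L)))"
  proof (rule prob_le_expec[OF p0 p1])
    fix E assume E: "E \<subseteq> F"
    show "of_bool (?far E \<and> real (card (ball E (2 * h) {v})) < \<kappa> * (real h)\<^sup>2)
      \<le> 2 / real h * (\<Sum>i\<in>{h..<2*h}. of_bool (?far E \<and> ?s E i \<le> ?L))"
    proof (cases "?far E \<and> real (card (ball E (2 * h) {v})) < \<kappa> * (real h)\<^sup>2")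
      case True
      let ?B = "{i\<in>{h..<2*h}. \<not> ?s E i \<le> ?L}"
      have "real (card ?B) * ?L \<le> (\<Sum>i\<in>?B. ?s E i)"
        using sum_mono[of ?B "\<lambda>_. ?L" "?s E"] by auto
      also have "\<dots> \<le> (\<Sum>i\<in>{h..<2*h}. ?s E i)" by (intro sum_mono2) auto
      also have "\<dots> \<le> real (card (ball E (2 * h) {v}))"
        using sum_card_spheres[of V E v h "2 * h"] ball_sub_V[OF E v]
        by (simp flip: of_nat_sum del: ball.simps)
      also have "\<dots> < \<kappa> * (real h)\<^sup>2" using True by simp
      also have "\<dots> = real h / 2 * ?L" by (simp add: power2_eq_square)
      finally have B: "real (card ?B) < real h / 2" using \<kappa> h by (simp add: mult_less_cancel_right)
      have "(\<Sum>i\<in>{h..<2*h}. of_bool (?s E i \<le> ?L) + of_bool (\<not> ?s E i \<le> ?L)) = (\<Sum>i\<in>{h..<2*h}. 1 :: real)"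
        by (intro sum.cong) auto
      then have "(\<Sum>i\<in>{h..<2*h}. of_bool (?s E i \<le> ?L)) + real (card ?B) = real h"
        by (simp add: sum.distrib Int_def del: ball.simps)
      then have "real h / 2 \<le> (\<Sum>i\<in>{h..<2*h}. of_bool (?s E i \<le> ?L))" using B by linarith
      then have "1 \<le> 2 / real h * (\<Sum>i\<in>{h..<2*h}. of_bool (?s E i \<le> ?L))"
        using h by (simp add: field_simps del: sum_of_bool_eq ball.simps)
      then show ?thesis using True by simp
    next
      case False
      have "0 \<le> 2 / real h * (\<Sum>i\<in>{h..<2*h}. of_bool (?far E \<and> ?s E i \<le> ?L))"
        by (intro mult_nonneg_nonneg sum_nonneg) auto
      then show ?thesis using False by (simp only: of_bool_eq(1) simp_thms)
    qed
  qed
  also have "\<dots> = 2 / real h * (\<Sum>i\<in>{h..<2*h}. Pr (\<lambda>E. ?far E \<and> ?s E i \<le> ?L))"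
    by (simp only: expec_cmult expec_sum prob_def)
  also have "\<dots> \<le> 2 / real h * (\<Sum>i\<in>{h..<2*h}. t * (?L * t))"
  proof (intro mult_left_mono sum_mono)
    fix i assume i: "i \<in> {h..<2*h}"
    have "Pr (\<lambda>E. ?far E \<and> ?s E i \<le> ?L) \<le> Pr (arm V (Suc i) v) * (?L * t)"
      using i \<kappa> by (intro Pr_far_small_sphere_le[OF v] t) auto
    also have "\<dots> \<le> t * (?L * t)" using i \<kappa> t0 by (intro mult_right_mono t) auto
    finally show "Pr (\<lambda>E. ?far E \<and> ?s E i \<le> ?L) \<le> t * (?L * t)" .
  qed auto
  also have "\<dots> = 4 * \<kappa> * real h * t\<^sup>2" using h by (simp add: power2_eq_square field_simps)
  also have "t\<^sup>2 = 16 * g ^ (6 * h) / (real h)\<^sup>2"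
    by (simp add: t_def power_divide power_mult_distrib flip: power_mult)
  also have "4 * \<kappa> * real h * \<dots> = 64 * \<kappa> * g ^ (6 * h) / real h"
    using h by (simp add: power2_eq_square)
  finally show ?thesis .
qed

lemma Pr_arm_small_ball_le:
  assumes v: "v \<in> V" and h: "1 \<le> h" and \<kappa>: "0 < \<kappa>"
  shows "Pr (\<lambda>E. arm V (3 * h) v E \<and> real (card (ball E (2 * h) {v})) < \<kappa> * (real h)\<^sup>2)
    \<le> 64 * \<kappa> * g ^ (6 * h) / real h + 24 * (real h)\<^sup>2 * (p * g ^ (9 * h))"
proof -
  let ?far = "\<lambda>E. \<exists>w. at_dist E (3 * h) v w"
  have "Pr (\<lambda>E. arm V (3 * h) v E \<and> real (card (ball E (2 * h) {v})) < \<kappa> * (real h)\<^sup>2)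
    \<le> Pr (\<lambda>E. (?far E \<and> real (card (ball E (2 * h) {v})) < \<kappa> * (real h)\<^sup>2) \<or> (arm V (3 * h) v E \<and> \<not> ?far E))"
    by (rule Pr_mono) blast
  also have "\<dots> \<le> Pr (\<lambda>E. ?far E \<and> real (card (ball E (2 * h) {v})) < \<kappa> * (real h)\<^sup>2)
      + Pr (\<lambda>E. arm V (3 * h) v E \<and> \<not> ?far E)"
    by (rule prob_disj_le[OF p0 p1])
  also have "\<dots> \<le> 64 * \<kappa> * g ^ (6 * h) / real h + real (2 * (3 * h) * (3 * h + 1)) * (p * g ^ (3 * (3 * h)))"
    by (intro add_mono Pr_far_small_ball_le Pr_arm_not_far_le assms)
  also have "real (2 * (3 * h) * (3 * h + 1)) * (p * g ^ (3 * (3 * h))) \<le> 24 * (real h)\<^sup>2 * (p * g ^ (9 * h))"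
  proof -
    have "2 * (3 * h) * (3 * h + 1) \<le> 24 * h\<^sup>2" using h by (simp add: power2_eq_square)
    then have "real (2 * (3 * h) * (3 * h + 1)) \<le> real (24 * h\<^sup>2)" by (rule of_nat_mono)
    then have "real (2 * (3 * h) * (3 * h + 1)) \<le> 24 * (real h)\<^sup>2" by simp
    then show ?thesis using p0 g1 by (auto intro: mult_right_mono)
  qed
  finally show ?thesis by simp
qed

end

subsection \<open>Comparison with a smaller random graph\<close>

lemma card_supersets:
  assumes "finite V" "W \<subseteq> V" "card W \<le> m"
  shows "card {V'. W \<subseteq> V' \<and> V' \<subseteq> V \<and> card V' = m} = (card V - card W) choose (m - card W)"
proof -
  have f: "finite W" "finite (V - W)" using assms finite_subset by auto
  have "bij_betw (\<lambda>B. B \<union> W) {B. B \<subseteq> V - W \<and> card B = m - card W} {V'. W \<subseteq> V' \<and> V' \<subseteq> V \<and> card V' = m}"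
  proof (rule bij_betw_byWitness[where f'="\<lambda>V'. V' - W"])
    show "(\<lambda>B. B \<union> W) ` {B. B \<subseteq> V - W \<and> card B = m - card W} \<subseteq> {V'. W \<subseteq> V' \<and> V' \<subseteq> V \<and> card V' = m}"
    proof (rule image_subsetI)
      fix B assume B: "B \<in> {B. B \<subseteq> V - W \<and> card B = m - card W}"
      then have "card (B \<union> W) = card B + card W"
        using f finite_subset[of B "V - W"] by (intro card_Un_disjoint) auto
      then show "B \<union> W \<in> {V'. W \<subseteq> V' \<and> V' \<subseteq> V \<and> card V' = m}" using B assms by auto
    qed
    show "(\<lambda>V'. V' - W) ` {V'. W \<subseteq> V' \<and> V' \<subseteq> V \<and> card V' = m} \<subseteq> {B. B \<subseteq> V - W \<and> card B = m - card W}"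
      using f by (auto simp: card_Diff_subset)
  qed auto
  then have "card {V'. W \<subseteq> V' \<and> V' \<subseteq> V \<and> card V' = m} = card {B. B \<subseteq> V - W \<and> card B = m - card W}"
    by (rule bij_betw_same_card[symmetric])
  also have "\<dots> = card (V - W) choose (m - card W)" using f by (simp add: n_subsets)
  finally show ?thesis using f assms by (simp add: card_Diff_subset)
qed

text \<open>The quotient of the two binomials is the product of (n - j) / (m - j) = 1 + (n - m) / (m
  - j) over 1 <= j < k. It compares the \<open>m\<close>-sets through one vertex with those
  containing a given \<open>k\<close>-set.\<close>

lemma binomial_shift_le:
  fixes x :: real
  assumes "1 \<le> k" "k \<le> k0" "k0 < m" "m \<le> n" "real (n - m) / real (m - k0) \<le> x"
  shows "real ((n - 1) choose (m - 1)) \<le> (1 + x) ^ (k - 1) * real ((n - k) choose (m - k))"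
  using assms(1,2)
proof (induction k rule: dec_induct)
  case (step k)
  have pos: "0 < m - k" "0 < n - k" using step assms by auto
  have "(m - k) * ((n - k) choose (m - k)) = (n - k) * ((n - k - 1) choose (m - k - 1))"
    using pos by (intro times_binomial_minus1_eq) auto
  then have "real (m - k) * real ((n - k) choose (m - k)) = real (n - k) * real ((n - k - 1) choose (m - k - 1))"
    by (metis of_nat_mult)
  then have eq: "real ((n - k) choose (m - k)) = (real (n - k) / real (m - k)) * real ((n - Suc k) choose (m - Suc k))"
    using pos by (simp add: field_simps)
  have "real (n - k) / real (m - k) = 1 + real (n - m) / real (m - k)"
    using step assms by (simp add: of_nat_diff field_simps)
  also have "real (n - m) / real (m - k) \<le> real (n - m) / real (m - k0)"
    using step assms by (intro divide_left_mono) auto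
  finally have le: "real (n - k) / real (m - k) \<le> 1 + x" using assms(5) by simp
  have x0: "0 \<le> x" using assms(5) by (rule order_trans[rotated]) simp
  have "real ((n - 1) choose (m - 1)) \<le> (1 + x) ^ (k - 1) * real ((n - k) choose (m - k))"
    using step by simp
  also have "\<dots> \<le> (1 + x) ^ (k - 1) * ((1 + x) * real ((n - Suc k) choose (m - Suc k)))"
    unfolding eq using le x0 by (intro mult_left_mono mult_right_mono) auto
  also have "\<dots> = (1 + x) ^ (Suc k - 1) * real ((n - Suc k) choose (m - Suc k))"
    using step by (cases k) auto
  finally show ?case .
qed simp

context gnp
begin

definition Ed :: "nat set \<Rightarrow> nat set set" where
  "Ed W = {e\<in>F. e \<subseteq> W}"

definition Cut :: "nat set \<Rightarrow> nat set \<Rightarrow> nat set set" where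
  "Cut W V' = (\<lambda>(a, b). {a, b}) ` (W \<times> (V' - W))"

lemma card_Cut:
  assumes "finite V'" "W \<subseteq> V'"
  shows "card (Cut W V') = card W * (card V' - card W)"
proof -
  have "inj_on (\<lambda>(a, b). {a, b}) (W \<times> (V' - W))"
    by (auto simp: inj_on_def doubleton_eq_iff)
  then have "card (Cut W V') = card W * card (V' - W)"
    by (simp add: Cut_def card_image card_cartesian_product)
  then show ?thesis using assms by (simp add: card_Diff_subset finite_subset)
qed

text \<open>The event splits into one about edges inside \<open>W\<close> and one about edges
  leaving \<open>W\<close> within \<open>V'\<close>. These edge sets are disjoint, hence
  independent.\<close>

lemma cmp_eq_iff:
  assumes "E \<subseteq> F" "v \<in> W" "W \<subseteq> V'" "V' \<subseteq> V"
  shows "cmp (E \<inter> Ed V') v = W \<longleftrightarrow> cmp (E \<inter> Ed W) v = W \<and> E \<inter> Cut W V' = {}"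
proof
  assume c: "cmp (E \<inter> Ed V') v = W"
  have cut: "E \<inter> Cut W V' = {}"
  proof (rule ccontr)
    assume "E \<inter> Cut W V' \<noteq> {}"
    then obtain a b where ab: "a \<in> W" "b \<in> V' - W" "{a, b} \<in> E" by (auto simp: Cut_def)
    then have "{a, b} \<in> E \<inter> Ed V'" using assms by (auto simp: Ed_def)
    then have "b \<in> W" using cmp_closed[of a "E \<inter> Ed V'" v b] ab c by simp
    then show False using ab by simp
  qed
  have sub: "cmp (E \<inter> Ed W) v \<subseteq> W" using assms by (intro cmp_least) (auto simp: Ed_def)
  have "cmp (E \<inter> Ed V') v \<subseteq> cmp (E \<inter> Ed W) v"
  proof (rule cmp_least)
    fix u w assume u: "u \<in> cmp (E \<inter> Ed W) v" and uw: "{u, w} \<in> E \<inter> Ed V'"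
    then have "w \<in> W" using sub c cmp_closed[of u "E \<inter> Ed V'" v w] by auto
    then have "{u, w} \<in> E \<inter> Ed W" using uw u sub by (auto simp: Ed_def)
    then show "w \<in> cmp (E \<inter> Ed W) v" using u by (rule cmp_closed[rotated])
  qed (rule cmp_self)
  then show "cmp (E \<inter> Ed W) v = W \<and> E \<inter> Cut W V' = {}" using sub c cut by auto
next
  assume c: "cmp (E \<inter> Ed W) v = W \<and> E \<inter> Cut W V' = {}"
  have "cmp (E \<inter> Ed W) v \<subseteq> cmp (E \<inter> Ed V') v"
    using assms by (intro cmp_mono) (auto simp: Ed_def)
  moreover have "cmp (E \<inter> Ed V') v \<subseteq> W"
  proof (rule cmp_least[OF assms(2)])
    fix u w assume uw: "u \<in> W" "{u, w} \<in> E \<inter> Ed V'"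
    show "w \<in> W"
    proof (rule ccontr)
      assume "w \<notin> W"
      then have "{u, w} \<in> Cut W V'" using uw unfolding Cut_def Ed_def by force
      then show False using uw c by auto
    qed
  qed
  ultimately show "cmp (E \<inter> Ed V') v = W" using c by auto
qed

text \<open>\<open>V'\<close> enters only through a power of 1 - p. The laws of the component in two
  host sets therefore differ, at each \<open>W\<close>, by an explicit factor.\<close>

lemma Pr_cmp_eq:
  assumes "v \<in> W" "W \<subseteq> V'" "V' \<subseteq> V"
  shows "Pr (\<lambda>E. cmp (E \<inter> Ed V') v = W \<and> Q (E \<inter> Ed W))
    = Pr (\<lambda>E. cmp (E \<inter> Ed W) v = W \<and> Q (E \<inter> Ed W)) * (1 - p) ^ (card W * (card V' - card W))"
proof -
  have fV: "finite V'" using assms finite_subset by blast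
  have sub: "Ed W \<subseteq> F" "Cut W V' \<subseteq> F" "Ed W \<inter> Cut W V' = {}"
    using assms unfolding Ed_def Cut_def by (fastforce simp: all_edges_iff)+
  have "Pr (\<lambda>E. cmp (E \<inter> Ed V') v = W \<and> Q (E \<inter> Ed W))
      = Pr (\<lambda>E. (cmp (E \<inter> Ed W) v = W \<and> Q (E \<inter> Ed W)) \<and> E \<inter> Cut W V' = {})"
    using cmp_eq_iff[OF _ assms] by (intro prob_cong) auto
  also have "\<dots> = Pr (\<lambda>E. cmp (E \<inter> Ed W) v = W \<and> Q (E \<inter> Ed W)) * Pr (\<lambda>E. E \<inter> Cut W V' = {})"
    by (rule prob_indep[OF finite_all_edges sub, of p "\<lambda>I. cmp I v = W \<and> Q I" "\<lambda>J. J = {}"])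
  finally show ?thesis
    using prob_none[OF finite_all_edges sub(2)] card_Cut[OF fV assms(2)] by simp
qed

text \<open>Averaging the law of the component of \<open>v\<close> over all induced subgraphs on \<open>m\<close> vertices
  compares the supercritical graph with a smaller, subcritical one.\<close>

lemma Pr_small_component_le:
  assumes v: "v \<in> V" and k0: "k0 < m" and m: "m \<le> n"
    and x: "real (n - m) / real (m - k0) \<le> x" and ex: "1 + x \<le> exp (p * real (n - m))"
    and t: "\<And>V'. V' \<subseteq> V \<Longrightarrow> card V' = m \<Longrightarrow> v \<in> V' \<Longrightarrow>
      Pr (\<lambda>E. Q (E \<inter> Ed (cmp (E \<inter> Ed V') v))) \<le> t"
  shows "Pr (\<lambda>E. card (cmp E v) \<le> k0 \<and> Q (E \<inter> Ed (cmp E v))) \<le> t / (1 + x)"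
proof -
  define gW where "gW W = Pr (\<lambda>E. cmp (E \<inter> Ed W) v = W \<and> Q (E \<inter> Ed W))" for W
  define \<W> where "\<W> = {W. v \<in> W \<and> W \<subseteq> V \<and> card W \<le> k0}"
  define \<V> where "\<V> = {V'. {v} \<subseteq> V' \<and> V' \<subseteq> V \<and> card V' = m}"
  have fin: "finite \<W>" "finite \<V>"
    by (rule finite_subset[of _ "Pow V"]; auto simp: \<W>_def \<V>_def)+
  have g0: "0 \<le> gW W" for W unfolding gW_def by (rule Pr_nonneg)
  have x0: "0 \<le> x" using x by (rule order_trans[rotated]) simp
  let ?N = "real ((n - 1) choose (m - 1))"
  have cV: "real (card \<V>) = ?N"
    using card_supersets[of V "{v}" m] v k0 by (auto simp: \<V>_def)
  have N0: "0 < ?N" using m k0 by simp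
  \<comment> \<open>The binomial ratio contributes (1 + x)^(k - 1), and the missing cut edges
    contribute at most (1 + x)^(-k) by the choice of \<open>x\<close>. The one factor left over is
    the gain 1 / (1 + x) of the lemma.\<close>
  have each: "?N * (gW W * (1 - p) ^ (card W * (n - card W)))
      \<le> 1 / (1 + x) * (\<Sum>V'\<in>\<V>. if W \<subseteq> V' then gW W * (1 - p) ^ (card W * (m - card W)) else 0)"
    if W: "W \<in> \<W>" for W
  proof -
    define k where "k = card W"
    have k: "1 \<le> k" "k \<le> k0" "finite W"
      using W finite_subset[of W V] by (auto simp: \<W>_def k_def Suc_le_eq card_gt_0_iff)
    have "?N * (1 - p) ^ (k * (n - m)) \<le> ((1 + x) ^ (k - 1) * real ((n - k) choose (m - k))) * inverse (exp (p * real (n - m)) ^ k)"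
    proof (rule mult_mono)
      show "?N \<le> (1 + x) ^ (k - 1) * real ((n - k) choose (m - k))"
        by (rule binomial_shift_le[OF k(1,2) k0 m x])
      have "(1 - p) ^ (k * (n - m)) \<le> exp (- p) ^ (k * (n - m))"
        using exp_ge_add_one_self[of "- p"] p1 by (intro power_mono) auto
      also have "\<dots> = inverse (exp (p * real (n - m)) ^ k)"
      proof -
        have "exp (- p) ^ (k * (n - m)) = exp (real (k * (n - m)) * (- p))"
          by (rule exp_of_nat_mult[symmetric])
        also have "\<dots> = exp (- (real k * (p * real (n - m))))"
          by (simp only: of_nat_mult mult_minus_right mult.assoc mult.commute[of p])
        also have "\<dots> = inverse (exp (p * real (n - m)) ^ k)"
          unfolding exp_of_nat_mult[symmetric] by (rule exp_minus)
        finally show ?thesis .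
      qed
      finally show "(1 - p) ^ (k * (n - m)) \<le> inverse (exp (p * real (n - m)) ^ k)" .
    qed (use x0 p1 in auto)
    also have "\<dots> \<le> ((1 + x) ^ (k - 1) * real ((n - k) choose (m - k))) * inverse ((1 + x) ^ k)"
      using x0 ex by (intro mult_left_mono le_imp_inverse_le power_mono) auto
    also have "\<dots> = 1 / (1 + x) * real ((n - k) choose (m - k))"
    proof -
      have aux: "y * B * inverse (c * y) = 1 / c * B" if "y \<noteq> 0" "c \<noteq> 0" for y B c :: real
        using that by (simp add: field_simps)
      have "(1 + x) ^ k = (1 + x) * (1 + x) ^ (k - 1)" using k(1) by (cases k) auto
      then show ?thesis using aux[of "(1 + x) ^ (k - 1)" "1 + x"] x0 by simp
    qed
    finally have b: "?N * (1 - p) ^ (k * (n - m)) \<le> 1 / (1 + x) * real ((n - k) choose (m - k))" .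
    have "n - k = (n - m) + (m - k)" using k k0 m by simp
    then have "(1 - p) ^ (k * (n - k)) = (1 - p) ^ (k * (n - m)) * (1 - p) ^ (k * (m - k))"
      by (simp add: distrib_left power_add)
    then have "?N * (gW W * (1 - p) ^ (k * (n - k)))
       = (?N * (1 - p) ^ (k * (n - m))) * (gW W * (1 - p) ^ (k * (m - k)))" by simp
    also have "\<dots> \<le> (1 / (1 + x) * real ((n - k) choose (m - k))) * (gW W * (1 - p) ^ (k * (m - k)))"
      using b g0 p1 by (intro mult_right_mono) auto
    also have "real ((n - k) choose (m - k)) = real (card {V'\<in>\<V>. W \<subseteq> V'})"
    proof -
      have "{V'\<in>\<V>. W \<subseteq> V'} = {V'. W \<subseteq> V' \<and> V' \<subseteq> V \<and> card V' = m}"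
        using W by (auto simp: \<V>_def \<W>_def)
      then show ?thesis using card_supersets[of V W m] W k k0 by (simp add: \<W>_def k_def)
    qed
    also have "(1 / (1 + x) * real (card {V'\<in>\<V>. W \<subseteq> V'})) * (gW W * (1 - p) ^ (k * (m - k)))
       = 1 / (1 + x) * (\<Sum>V'\<in>{V'\<in>\<V>. W \<subseteq> V'}. gW W * (1 - p) ^ (k * (m - k)))"
      by simp
    also have "(\<Sum>V'\<in>{V'\<in>\<V>. W \<subseteq> V'}. gW W * (1 - p) ^ (k * (m - k)))
       = (\<Sum>V'\<in>\<V>. if W \<subseteq> V' then gW W * (1 - p) ^ (k * (m - k)) else 0)"
      by (rule sum.inter_filter[OF fin(2)])
    finally show ?thesis unfolding k_def .
  qed
  \<comment> \<open>For a fixed host set the events that the component equals \<open>W\<close>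
    exclude each other, so the sum is a single probability in the smaller graph.\<close>
  have inner: "(\<Sum>W\<in>\<W>. if W \<subseteq> V' then gW W * (1 - p) ^ (card W * (m - card W)) else 0) \<le> t"
    if V': "V' \<in> \<V>" for V'
  proof -
    have "(\<Sum>W\<in>\<W>. if W \<subseteq> V' then gW W * (1 - p) ^ (card W * (m - card W)) else 0)
       \<le> (\<Sum>W\<in>\<W>. Pr (\<lambda>E. cmp (E \<inter> Ed V') v = W \<and> Q (E \<inter> Ed W)))"
    proof (rule sum_mono)
      fix W assume "W \<in> \<W>"
      then show "(if W \<subseteq> V' then gW W * (1 - p) ^ (card W * (m - card W)) else 0)
          \<le> Pr (\<lambda>E. cmp (E \<inter> Ed V') v = W \<and> Q (E \<inter> Ed W))"
        using V' Pr_cmp_eq[of v W V' Q] Pr_nonneg by (auto simp: gW_def \<W>_def \<V>_def)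
    qed
    also have "\<dots> = Exv (\<lambda>E. \<Sum>W\<in>\<W>. of_bool (cmp (E \<inter> Ed V') v = W \<and> Q (E \<inter> Ed W)))"
      by (simp add: expec_sum prob_def del: sum_of_bool_eq)
    also have "\<dots> \<le> Pr (\<lambda>E. Q (E \<inter> Ed (cmp (E \<inter> Ed V') v)))"
      unfolding prob_def
    proof (rule expec_mono[OF p0 p1])
      fix E :: "nat set set"
      have "(\<Sum>W\<in>\<W>. of_bool (cmp (E \<inter> Ed V') v = W \<and> Q (E \<inter> Ed W)) :: real)
         = (\<Sum>W\<in>\<W>. if cmp (E \<inter> Ed V') v = W then of_bool (Q (E \<inter> Ed (cmp (E \<inter> Ed V') v))) else 0)"
        by (intro sum.cong) auto
      also have "\<dots> \<le> of_bool (Q (E \<inter> Ed (cmp (E \<inter> Ed V') v)))"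
        using fin by simp
      finally show "(\<Sum>W\<in>\<W>. of_bool (cmp (E \<inter> Ed V') v = W \<and> Q (E \<inter> Ed W)) :: real)
        \<le> of_bool (Q (E \<inter> Ed (cmp (E \<inter> Ed V') v)))" .
    qed
    also have "\<dots> \<le> t" using V' by (intro t) (auto simp: \<V>_def)
    finally show ?thesis .
  qed
  have cV_sub: "cmp E v \<subseteq> V" if "E \<subseteq> F" for E
    unfolding cmp_def using ball_sub_V[OF that v] by blast
  have EdV: "E \<inter> Ed V = E" if "E \<subseteq> F" for E
    using that edges_sub[OF that] by (auto simp: Ed_def)
  have "Pr (\<lambda>E. card (cmp E v) \<le> k0 \<and> Q (E \<inter> Ed (cmp E v)))
      \<le> Pr (\<lambda>E. \<exists>W\<in>\<W>. cmp (E \<inter> Ed V) v = W \<and> Q (E \<inter> Ed W))"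
    by (rule Pr_mono) (use cV_sub EdV cmp_self in \<open>auto simp: \<W>_def\<close>)
  also have "\<dots> \<le> (\<Sum>W\<in>\<W>. Pr (\<lambda>E. cmp (E \<inter> Ed V) v = W \<and> Q (E \<inter> Ed W)))"
    by (rule prob_Ex_le[OF p0 p1 fin(1)])
  also have "\<dots> = (\<Sum>W\<in>\<W>. gW W * (1 - p) ^ (card W * (n - card W)))"
    by (intro sum.cong refl) (use Pr_cmp_eq[of v _ V Q] in \<open>auto simp: gW_def \<W>_def\<close>)
  finally have le: "Pr (\<lambda>E. card (cmp E v) \<le> k0 \<and> Q (E \<inter> Ed (cmp E v)))
     \<le> (\<Sum>W\<in>\<W>. gW W * (1 - p) ^ (card W * (n - card W)))" .
  have "?N * (\<Sum>W\<in>\<W>. gW W * (1 - p) ^ (card W * (n - card W)))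
      \<le> (\<Sum>W\<in>\<W>. 1 / (1 + x) * (\<Sum>V'\<in>\<V>. if W \<subseteq> V' then gW W * (1 - p) ^ (card W * (m - card W)) else 0))"
    unfolding sum_distrib_left[of ?N] by (intro sum_mono each)
  also have "\<dots> = 1 / (1 + x) * (\<Sum>V'\<in>\<V>. \<Sum>W\<in>\<W>. if W \<subseteq> V' then gW W * (1 - p) ^ (card W * (m - card W)) else 0)"
    by (subst sum.swap) (simp add: sum_distrib_left)
  also have "\<dots> \<le> 1 / (1 + x) * (\<Sum>V'\<in>\<V>. t)"
    using x0 by (intro mult_left_mono sum_mono inner) auto
  also have "\<dots> = ?N * (t / (1 + x))" using cV by simp
  finally have "(\<Sum>W\<in>\<W>. gW W * (1 - p) ^ (card W * (n - card W))) \<le> t / (1 + x)"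
    using N0 by (rule mult_left_le_imp_le)
  then show ?thesis using le by (rule order_trans[rotated])
qed

lemma Pr_component_le:
  assumes "v \<in> V" "k0 < m" "m \<le> n"
    "real (n - m) / real (m - k0) \<le> x" "1 + x \<le> exp (p * real (n - m))"
  shows "Pr (\<lambda>E. card (cmp E v) \<le> k0) \<le> 1 / (1 + x)"
  using Pr_small_component_le[OF assms, of "\<lambda>_. True" 1] prob_le_1[OF pr] by simp

text \<open>An arm stays inside the component of its start, so it can be transported to a host set
  of \<open>m\<close> vertices. There the first \<open>j\<close> steps decay like powers of
  \<open>m * p\<close>, below 1 in the application, and the remaining \<open>k\<close> steps still
  earn the one-arm factor.\<close>

lemma Pr_arm_component_le:
  assumes "v \<in> V" "k0 < m" "m \<le> n"
    "real (n - m) / real (m - k0) \<le> x" "1 + x \<le> exp (p * real (n - m))"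
  shows "Pr (\<lambda>E. card (cmp E v) \<le> k0 \<and> arm V (j + k) v E)
    \<le> (real m * p) ^ j * (4 * g ^ k / (real k + 4))"
proof -
  let ?t = "(real m * p) ^ j * (4 * g ^ k / (real k + 4))"
  have "0 \<le> real (n - m) / real (m - k0)" by simp
  then have x0: "0 \<le> x" using assms(4) by (rule order_trans)
  have t0: "0 \<le> ?t" using p0 g1 by (intro mult_nonneg_nonneg) auto
  have "Pr (\<lambda>E. card (cmp E v) \<le> k0 \<and> arm V (j + k) v E)
     \<le> Pr (\<lambda>E. card (cmp E v) \<le> k0 \<and> arm V (j + k) v (E \<inter> Ed (cmp E v)))"
  proof (rule Pr_mono, elim conjE, intro conjI)
    fix E assume E: "E \<subseteq> F" "arm V (j + k) v E"
    have "arm V (j + k) v {e\<in>E. e \<subseteq> ball E (j + k) {v}}" using local_at_arm E(2) by (rule local_atD)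
    then show "arm V (j + k) v (E \<inter> Ed (cmp E v))"
      by (rule increasingD[OF increasing_arm])
        (use E(1) ball_subset_cmp[of E "j + k" v] in \<open>auto simp: Ed_def\<close>)
  qed
  also have "\<dots> \<le> ?t / (1 + x)"
  proof (rule Pr_small_component_le[OF assms])
    fix V' assume V': "V' \<subseteq> V" "card V' = m" "v \<in> V'"
    have "Pr (\<lambda>E. arm V (j + k) v (E \<inter> Ed (cmp (E \<inter> Ed V') v))) \<le> Pr (arm V' (j + k) v)"
    proof (rule Pr_mono)
      fix E assume a: "arm V (j + k) v (E \<inter> Ed (cmp (E \<inter> Ed V') v))"
      have "cmp (E \<inter> Ed V') v \<subseteq> V'" using V' by (intro cmp_least) (auto simp: Ed_def)
      then have "E \<inter> Ed (cmp (E \<inter> Ed V') v) \<subseteq> Pow V'" by (auto simp: Ed_def)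
      with a have "arm V' (j + k) v (E \<inter> Ed (cmp (E \<inter> Ed V') v))" by (rule arm_subset)
      then show "arm V' (j + k) v E" by (rule increasingD[OF increasing_arm]) auto
    qed
    also have "\<dots> = Pr (chain V' (arm V' k) j v)" by (simp add: chain_chain)
    also have "\<dots> \<le> (real (card V') * p) ^ j * (4 * g ^ k / (real k + 4))"
      using V' finite_subset[of V' V] by (intro Pr_chain_le Pr_arm_le increasing_arm) auto
    finally show "Pr (\<lambda>E. arm V (j + k) v (E \<inter> Ed (cmp (E \<inter> Ed V') v))) \<le> ?t" using V' by simp
  qed
  also have "\<dots> \<le> ?t" using divide_left_mono[of 1 "1 + x" ?t] x0 t0 by simp
  finally show ?thesis .
qed

end

subsection \<open>Spread from ball growth\<close>

lemma lipschitz_ball: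
  assumes "lipschitz_on_graph (cmp E v) E f" "w \<in> ball E k {v}"
  shows "\<bar>f w - f v\<bar> \<le> real k"
  using assms(2)
proof (induction k arbitrary: w)
  case (Suc k)
  show ?case
  proof (cases "w \<in> ball E k {v}")
    case True
    then show ?thesis using Suc.IH[of w] by simp
  next
    case False
    then obtain u where u: "u \<in> ball E k {v}" "{u, w} \<in> E" using Suc.prems by auto
    have "u \<in> cmp E v" "w \<in> cmp E v"
      using ball_subset_cmp[of E k v] ball_subset_cmp[of E "Suc k" v] u(1) Suc.prems by blast+
    then have "\<bar>f u - f w\<bar> \<le> 1" using assms(1) u(2) unfolding lipschitz_on_graph_def by blast
    then show ?thesis using Suc.IH[OF u(1)] by linarith
  qed
qed simp

lemma unif_variance_le:
  assumes "finite C" "C \<noteq> {}" "\<And>w. w \<in> C \<Longrightarrow> \<bar>f w - a\<bar> \<le> M"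
  shows "unif_variance C f \<le> (2 * M)\<^sup>2"
proof -
  define m where "m = (\<Sum>v\<in>C. f v) / real (card C)"
  have c: "real (card C) > 0" using assms by (simp add: card_gt_0_iff)
  have "(\<Sum>v\<in>C. f v) \<le> (\<Sum>v\<in>C. a + M)" "(\<Sum>v\<in>C. a - M) \<le> (\<Sum>v\<in>C. f v)"
    using assms(3) by (force intro!: sum_mono simp: abs_le_iff)+
  then have m: "m \<le> a + M" "a - M \<le> m" using c by (auto simp: m_def field_simps)
  have "(\<Sum>v\<in>C. (f v - m)\<^sup>2) \<le> (\<Sum>v\<in>C. (2 * M)\<^sup>2)"
  proof (rule sum_mono)
    fix v assume "v \<in> C"
    then have "\<bar>f v - m\<bar> \<le> 2 * M" using assms(3)[of v] m by linarith
    then show "(f v - m)\<^sup>2 \<le> (2 * M)\<^sup>2" by (metis abs_ge_zero power2_abs power_mono)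
  qed
  then show ?thesis using c by (simp add: unif_variance_def m_def[symmetric] field_simps)
qed

text \<open>A supremum of reals dominates its members only if it is bounded. In a finite component
  every vertex is within a fixed radius of \<open>v\<close>, which bounds all Lipschitz functions up
  to an additive constant.\<close>

lemma spread_ge:
  assumes "finite (cmp E v)" "lipschitz_on_graph (cmp E v) E f"
  shows "unif_variance (cmp E v) f \<le> spread (cmp E v) E"
  unfolding spread_def
proof (rule cSUP_upper)
  have "\<forall>w\<in>cmp E v. \<exists>k. w \<in> ball E k {v}" by (auto simp: cmp_def)
  then obtain r where r: "\<And>w. w \<in> cmp E v \<Longrightarrow> w \<in> ball E (r w) {v}" by metis
  define M where "M = real (Max (r ` cmp E v))"
  show "bdd_above (unif_variance (cmp E v) ` {f. lipschitz_on_graph (cmp E v) E f})"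
  proof (rule bdd_aboveI[of _ "(2 * M)\<^sup>2"], elim imageE, simp only: mem_Collect_eq)
    fix g assume g: "lipschitz_on_graph (cmp E v) E g"
    show "unif_variance (cmp E v) g \<le> (2 * M)\<^sup>2"
    proof (rule unif_variance_le[OF assms(1), of _ "g v"])
      show "cmp E v \<noteq> {}" using cmp_self by fastforce
      fix w assume w: "w \<in> cmp E v"
      have "\<bar>g w - g v\<bar> \<le> real (r w)" by (rule lipschitz_ball[OF g r[OF w]])
      also have "\<dots> \<le> M" using assms(1) w by (simp add: M_def)
      finally show "\<bar>g w - g v\<bar> \<le> M" .
    qed
  qed
qed (use assms in auto)

text \<open>Wherever the mean lies relative to 3h, the values on one of the two sets differ from it
  by at least h.\<close>

lemma unif_variance_ge:
  assumes "finite C" "C \<noteq> {}" "A \<subseteq> C" "B \<subseteq> C" "0 \<le> h"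
    "\<And>v. v \<in> A \<Longrightarrow> f v \<le> 2 * h" "\<And>v. v \<in> B \<Longrightarrow> f v = 4 * h"
    "\<alpha> * real (card C) \<le> real (card A)" "\<alpha> * real (card C) \<le> real (card B)"
  shows "\<alpha> * h\<^sup>2 \<le> unif_variance C f"
proof -
  define m where "m = (\<Sum>v\<in>C. f v) / real (card C)"
  have c: "real (card C) > 0" using assms by (simp add: card_gt_0_iff)
  have "\<exists>S\<subseteq>C. \<alpha> * real (card C) \<le> real (card S) \<and> (\<forall>v\<in>S. h\<^sup>2 \<le> (f v - m)\<^sup>2)"
  proof (cases "m \<le> 3 * h")
    case True
    have "h\<^sup>2 \<le> (f v - m)\<^sup>2" if "v \<in> B" for v
      using assms(5) assms(7)[OF that] True by (intro power_mono) auto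
    then show ?thesis using assms by blast
  next
    case False
    have "h\<^sup>2 \<le> (m - f v)\<^sup>2" if "v \<in> A" for v
      using assms(5) assms(6)[OF that] False by (intro power_mono) auto
    then show ?thesis using assms by (metis power2_commute)
  qed
  then obtain S where S: "S \<subseteq> C" "\<alpha> * real (card C) \<le> real (card S)" "\<And>v. v \<in> S \<Longrightarrow> h\<^sup>2 \<le> (f v - m)\<^sup>2"
    by blast
  have "(\<alpha> * real (card C)) * h\<^sup>2 \<le> real (card S) * h\<^sup>2" using S(2) by (intro mult_right_mono) auto
  also have "\<dots> = (\<Sum>v\<in>S. h\<^sup>2)" by simp
  also have "\<dots> \<le> (\<Sum>v\<in>S. (f v - m)\<^sup>2)" by (rule sum_mono) (rule S(3))
  also have "\<dots> \<le> (\<Sum>v\<in>C. (f v - m)\<^sup>2)" using assms(1) S(1) by (intro sum_mono2) auto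
  finally show ?thesis using c by (simp add: unif_variance_def m_def[symmetric] field_simps)
qed

lemma card_ball_le:
  assumes "finite S" "\<And>s. s \<in> S \<Longrightarrow> real (card (ball E r {s})) \<le> L"
  shows "real (card (ball E r S)) \<le> real (card S) * L"
proof -
  have "card (ball E r S) \<le> (\<Sum>s\<in>S. card (ball E r {s}))"
    unfolding ball_UN[of E r S] by (rule card_UN_le[OF assms(1)])
  then have "real (card (ball E r S)) \<le> (\<Sum>s\<in>S. real (card (ball E r {s})))"
    by (simp flip: of_nat_sum)
  also have "\<dots> \<le> real (card S) * L" using assms(2) by (intro sum_bounded_above)
  finally show ?thesis .
qed

text \<open>Each chosen centre excludes at most \<open>L\<close> further candidates, namely those in
  its ball of doubled radius.\<close>

lemma separated_set_exists:
  assumes "finite G" "0 \<le> L" "\<And>s. s \<in> G \<Longrightarrow> finite (ball E (2 * r) {s}) \<and> real (card (ball E (2 * r) {s})) \<le> L"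
    "real M * L < real (card G)"
  shows "\<exists>S\<subseteq>G. card S = M \<and> (\<forall>s\<in>S. \<forall>t\<in>S. s \<noteq> t \<longrightarrow> ball E r {s} \<inter> ball E r {t} = {})"
  using assms(4)
proof (induction M)
  case 0
  then show ?case by (intro exI[of _ "{}"]) auto
next
  case (Suc M)
  have "real M * L < real (card G)" using Suc.prems assms(2) by (simp add: algebra_simps)
  then obtain S where S: "S \<subseteq> G" "card S = M"
    "\<And>s t. s \<in> S \<Longrightarrow> t \<in> S \<Longrightarrow> s \<noteq> t \<Longrightarrow> ball E r {s} \<inter> ball E r {t} = {}"
    using Suc.IH by blast
  have fS: "finite S" using S(1) assms(1) finite_subset by blast
  have "real (card (ball E (2 * r) S)) \<le> real (card S) * L"
    using S(1) assms(3) by (intro card_ball_le[OF fS]) auto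
  then have "card (ball E (2 * r) S) < card G" using \<open>real M * L < real (card G)\<close> S(2) by simp
  moreover have "finite (ball E (2 * r) S)"
    unfolding ball_UN[of E "2 * r" S] using fS S(1) assms(3) by blast
  ultimately obtain x where x: "x \<in> G" "x \<notin> ball E (2 * r) S"
    by (metis card_mono not_le subsetI)
  have dis: "ball E r {s} \<inter> ball E r {x} = {}" if "s \<in> S" for s
  proof (rule ccontr)
    assume "ball E r {s} \<inter> ball E r {x} \<noteq> {}"
    then obtain y where "y \<in> ball E r {s}" "y \<in> ball E r {x}" by auto
    then have "x \<in> ball E (r + r) {s}" using ball_sym[of y E r x] ball_trans[of y E r s x r] by blast
    then have "x \<in> ball E (2 * r) S"
      unfolding ball_UN[of E "2 * r" S] using that by (auto simp: mult_2)
    then show False using x by simp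
  qed
  have "x \<notin> S" using x(2) ball_mono_radius[of 0 "2 * r" E S] by auto
  then have "card (insert x S) = Suc M" using S(2) fS by simp
  moreover have "\<forall>s\<in>insert x S. \<forall>t\<in>insert x S. s \<noteq> t \<longrightarrow> ball E r {s} \<inter> ball E r {t} = {}"
    using dis S(3) by (simp add: Int_commute)
  ultimately show ?case using S(1) x(1) by (intro exI[of _ "insert x S"]) auto
qed

text \<open>Counting the radii below \<open>k\<close> whose ball misses \<open>v\<close> gives the
  minimum of \<open>k\<close> and the distance to \<open>S\<close>, without a value for unreachable
  vertices.\<close>

definition trunc_dist :: "'a set set \<Rightarrow> nat \<Rightarrow> 'a set \<Rightarrow> 'a \<Rightarrow> real" where
  "trunc_dist E k S v = real (card {i\<in>{..<k}. v \<notin> ball E i S})"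

lemma trunc_dist_step:
  assumes "{v, u} \<in> E"
  shows "trunc_dist E k S u \<le> trunc_dist E k S v + 1"
proof -
  let ?A = "{i\<in>{..<k}. u \<notin> ball E i S}" and ?B = "{i\<in>{..<k}. v \<notin> ball E i S}"
  have "?A \<subseteq> insert 0 (Suc ` ?B)"
  proof
    fix i assume i: "i \<in> ?A"
    show "i \<in> insert 0 (Suc ` ?B)"
    proof (cases i)
      case (Suc j)
      then have "v \<notin> ball E j S" using i assms by auto
      then show ?thesis using i Suc by auto
    qed simp
  qed
  then have "card ?A \<le> card (insert 0 (Suc ` ?B))" by (intro card_mono) auto
  also have "\<dots> \<le> card ?B + 1"
    using card_insert_le_m1[of "card ?B + 1" "Suc ` ?B" 0] card_image_le[of ?B Suc] by auto
  finally show ?thesis unfolding trunc_dist_def by linarith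
qed

lemma lipschitz_trunc_dist: "lipschitz_on_graph C E (trunc_dist E k S)"
  unfolding lipschitz_on_graph_def
proof (intro ballI impI)
  fix u v assume "{u, v} \<in> E"
  then show "\<bar>trunc_dist E k S u - trunc_dist E k S v\<bar> \<le> 1"
    using trunc_dist_step[of u v E k S] trunc_dist_step[of v u E k S]
    by (simp add: insert_commute abs_le_iff)
qed

lemma trunc_dist_le:
  assumes "v \<in> ball E j S"
  shows "trunc_dist E k S v \<le> real j"
proof -
  have "{i\<in>{..<k}. v \<notin> ball E i S} \<subseteq> {..<j}"
  proof
    fix i assume "i \<in> {i\<in>{..<k}. v \<notin> ball E i S}"
    then show "i \<in> {..<j}" using assms ball_mono_radius[of j i E S] by (auto simp: not_less[symmetric])
  qed
  then show ?thesis unfolding trunc_dist_def using card_mono[of "{..<j}"] by fastforce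
qed

lemma trunc_dist_eq:
  assumes "v \<notin> ball E k S"
  shows "trunc_dist E k S v = real k"
proof -
  have "{i\<in>{..<k}. v \<notin> ball E i S} = {..<k}"
    using assms ball_mono_radius[of _ k E S] by (auto simp: less_imp_le_nat) (meson in_mono less_imp_le_nat)
  then show ?thesis by (simp add: trunc_dist_def)
qed

lemma spread_ge_of_ball_growth:
  fixes L l :: real
  assumes fin: "finite (cmp E v0)" and L: "0 < L" "4 * L \<le> real (card (cmp E v0))" and l0: "0 < l"
    and G: "G \<subseteq> cmp E v0" "card (cmp E v0) \<le> 2 * card G"
    "\<And>v. v \<in> G \<Longrightarrow> real (card (ball E (4 * h) {v})) \<le> L"
    "\<And>v. v \<in> G \<Longrightarrow> l \<le> real (card (ball E (2 * h) {v}))"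
  shows "l / (8 * L) * (real h)\<^sup>2 \<le> spread (cmp E v0) E"
proof -
  let ?C = "cmp E v0"
  have fG: "finite G" using G(1) fin finite_subset by blast
  have c: "0 < real (card ?C)" using L by linarith
  have bC: "ball E k S \<subseteq> ?C" if "S \<subseteq> ?C" for k S
  proof (induction k)
    case (Suc k)
    then show ?case using cmp_closed by fastforce
  qed (use that in simp)
  \<comment> \<open>With |C| / (4L) centres the balls of radius 4h cover at most a quarter of the
    component, and the greedy choice cannot run out, since \<open>G\<close> is at least half of it.
    As \<open>4 * L\<close> is at most |C|, rounding down loses no more than a factor 2, hence the 8
    in the conclusion.\<close>
  define M where "M = nat \<lfloor>real (card ?C) / (4 * L)\<rfloor>"
  have q: "1 \<le> real (card ?C) / (4 * L)" using L by (simp add: field_simps)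
  have M: "real M \<le> real (card ?C) / (4 * L)" "real (card ?C) / (8 * L) \<le> real M"
  proof -
    have f1: "1 \<le> \<lfloor>real (card ?C) / (4 * L)\<rfloor>" using q by (simp add: le_floor_iff)
    then have "real M = of_int \<lfloor>real (card ?C) / (4 * L)\<rfloor>" by (simp add: M_def)
    moreover have "(1::real) \<le> of_int \<lfloor>real (card ?C) / (4 * L)\<rfloor>" using f1 by linarith
    ultimately have *: "real M \<le> real (card ?C) / (4 * L)" "real (card ?C) / (4 * L) < real M + 1"
      "1 \<le> real M" by linarith+
    show "real M \<le> real (card ?C) / (4 * L)" by (rule *)
    have "real (card ?C) / (8 * L) = real (card ?C) / (4 * L) / 2" by simp
    then show "real (card ?C) / (8 * L) \<le> real M" using * by linarith
  qed
  have SL: "real M * L \<le> real (card ?C) / 4" using M(1) L by (simp add: field_simps)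
  have SG: "real M * L < real (card G)"
  proof -
    have "real (card ?C) \<le> 2 * real (card G)" using G(2) by linarith
    then show ?thesis using SL c by linarith
  qed
  have "\<exists>S\<subseteq>G. card S = M \<and> (\<forall>s\<in>S. \<forall>t\<in>S. s \<noteq> t \<longrightarrow> ball E (2 * h) {s} \<inter> ball E (2 * h) {t} = {})"
  proof (rule separated_set_exists[OF fG _ _ SG])
    fix s assume s: "s \<in> G"
    then have "ball E (4 * h) {s} \<subseteq> ?C" using G(1) by (intro bC) auto
    then show "finite (ball E (2 * (2 * h)) {s}) \<and> real (card (ball E (2 * (2 * h)) {s})) \<le> L"
      using G(3)[OF s] finite_subset[OF _ fin] by simp
  qed (use L in simp)
  then obtain S where S: "S \<subseteq> G" "card S = M"
    "\<And>s t. s \<in> S \<Longrightarrow> t \<in> S \<Longrightarrow> s \<noteq> t \<Longrightarrow> ball E (2 * h) {s} \<inter> ball E (2 * h) {t} = {}" by blast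
  have fS: "finite S" using S(1) fG finite_subset by blast
  have SC: "S \<subseteq> ?C" using S(1) G(1) by blast
  let ?A = "ball E (2 * h) S" and ?B = "?C - ball E (4 * h) S"
  have "card ?A = (\<Sum>s\<in>S. card (ball E (2 * h) {s}))"
  proof -
    have "\<forall>s\<in>S. finite (ball E (2 * h) {s})" using SC finite_subset[OF bC fin] by auto
    moreover have "\<forall>s\<in>S. \<forall>t\<in>S. s \<noteq> t \<longrightarrow> ball E (2 * h) {s} \<inter> ball E (2 * h) {t} = {}"
      using S(3) by blast
    ultimately show ?thesis
      unfolding ball_UN[of E "2 * h" S] by (rule card_UN_disjoint[OF fS])
  qed
  then have "real (card ?A) = (\<Sum>s\<in>S. real (card (ball E (2 * h) {s})))" by simp
  also have "\<dots> \<ge> real (card S) * l" using S(1) G(4) by (intro sum_bounded_below) auto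
  finally have A: "real M * l \<le> real (card ?A)" using S(2) by simp
  have B4: "real (card (ball E (4 * h) S)) \<le> real (card ?C) / 4"
    using card_ball_le[OF fS, of E "4 * h" L] S G(3) SL by (simp add: subset_iff)
  have "real (card ?B) = real (card ?C) - real (card (ball E (4 * h) S))"
    using bC[OF SC, of "4 * h"] fin by (simp add: card_Diff_subset finite_subset card_mono of_nat_diff)
  then have B: "real (card ?C) / 2 \<le> real (card ?B)" using B4 c by linarith
  have "G \<noteq> {}" using G(2) c by auto
  then obtain x where x: "x \<in> G" by auto
  have "card (ball E (2 * h) {x}) \<le> card (ball E (4 * h) {x})"
    using x G(1) by (intro card_mono ball_mono_radius finite_subset[OF bC fin]) auto
  \<comment> \<open>Makes \<open>l / (8 * L)\<close> at most 1/2, so that the far set, at least half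
    of the component, is large enough too.\<close>
  then have lL: "l \<le> L" using G(3)[OF x] G(4)[OF x] by linarith
  have "l / (8 * L) * (real h)\<^sup>2 \<le> unif_variance ?C (trunc_dist E (4 * h) S)"
  proof (rule unif_variance_ge[OF fin, of ?A ?B])
    show "?C \<noteq> {}" using c by auto
    show "l / (8 * L) * real (card ?C) \<le> real (card ?A)"
    proof -
      have "real (card ?C) / (8 * L) * l \<le> real M * l" using M(2) l0 by (intro mult_right_mono) auto
      then show ?thesis using A by (simp add: mult.commute)
    qed
    have "l / (8 * L) \<le> 1 / 2" using lL L by (simp add: field_simps)
    then have "l / (8 * L) * real (card ?C) \<le> 1 / 2 * real (card ?C)" using c by (intro mult_right_mono) auto
    then show "l / (8 * L) * real (card ?C) \<le> real (card ?B)" using B by linarith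
    show "trunc_dist E (4 * h) S v \<le> 2 * real h" if "v \<in> ?A" for v
      using trunc_dist_le[OF that, of "4 * h"] by simp
    show "trunc_dist E (4 * h) S v = 4 * real h" if "v \<in> ?B" for v
      using trunc_dist_eq[of v E "4 * h" S] that by simp
  qed (use bC[OF SC] in auto)
  also have "\<dots> \<le> spread ?C E" by (rule spread_ge[OF fin lipschitz_trunc_dist])
  finally show ?thesis .
qed

subsection \<open>The giant component\<close>

context gnp
begin

lemma component_eq_cmp:
  assumes "E \<subseteq> F" "v \<in> V"
  shows "component n E v = cmp E v"
proof -
  have "cmp E v \<subseteq> V" unfolding cmp_def using ball_sub_V[OF assms] by blast
  then show ?thesis unfolding component_def cmp_eq_rtrancl by auto
qed

lemma Pr_num_large_le:
  assumes "\<And>v. v \<in> V \<Longrightarrow> local_at r v (H v)" "\<And>v. v \<in> V \<Longrightarrow> increasing (H v)" "a > 0"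
    "\<And>v. v \<in> V \<Longrightarrow> Pr (H v) \<le> x" "real n * x \<le> a / 2"
  shows "Pr (\<lambda>E. a \<le> num H E) \<le> real n * (real (2 * r + 1) * g ^ (2 * r)) / (a / 2)\<^sup>2"
proof -
  have "Exv (num H) \<le> real n * x"
    unfolding Exv_num using sum_mono[of V "\<lambda>v. Pr (H v)" "\<lambda>_. x"] assms(4) by simp
  then have "Pr (\<lambda>E. a \<le> num H E) \<le> Pr (\<lambda>E. a / 2 \<le> \<bar>num H E - Exv (num H)\<bar>)"
    using assms(5) by (intro Pr_mono) linarith
  also have "\<dots> \<le> real n * (real (2 * r + 1) * g ^ (2 * r)) / (a / 2)\<^sup>2"
    using assms by (intro num_concentration) auto
  finally show ?thesis .
qed

text \<open>The event counted here is not monotone, but its count is the difference of two counts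
  of monotone local events.\<close>

lemma Pr_num_Diff_large_le:
  assumes "\<And>v. v \<in> V \<Longrightarrow> local_at r v (A v)" "\<And>v. v \<in> V \<Longrightarrow> increasing (A v)"
    "\<And>v. v \<in> V \<Longrightarrow> local_at r v (B v)" "\<And>v. v \<in> V \<Longrightarrow> increasing (B v)" "a > 0"
    "\<And>v. v \<in> V \<Longrightarrow> Pr (\<lambda>E. A v E \<and> \<not> B v E) \<le> x" "real n * x \<le> a / 2"
  shows "Pr (\<lambda>E. a \<le> num (\<lambda>v E. A v E \<and> \<not> B v E) E)
    \<le> 2 * (real n * (real (2 * r + 1) * g ^ (2 * r)) / (a / 4)\<^sup>2)"
proof -
  let ?AB = "\<lambda>v E. A v E \<and> B v E" and ?N = "\<lambda>v E. A v E \<and> \<not> B v E"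
  let ?t = "real n * (real (2 * r + 1) * g ^ (2 * r)) / (a / 4)\<^sup>2"
  have split: "num ?N E = num A E - num ?AB E" for E
    unfolding num_def sum_subtractf[symmetric] by (intro sum.cong) auto
  then have ex: "Exv (num ?N) = Exv (num A) - Exv (num ?AB)"
    unfolding expec_diff[symmetric] by (intro expec_cong) auto
  have "Exv (num ?N) \<le> real n * x"
    unfolding Exv_num using sum_mono[of V "\<lambda>v. Pr (?N v)" "\<lambda>_. x"] assms(6) by simp
  then have "Pr (\<lambda>E. a \<le> num ?N E) \<le> Pr (\<lambda>E. a / 4 \<le> \<bar>num A E - Exv (num A)\<bar>
      \<or> a / 4 \<le> \<bar>num ?AB E - Exv (num ?AB)\<bar>)"
    using assms(7) ex by (intro Pr_mono) (simp only: split; linarith)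
  also have "\<dots> \<le> Pr (\<lambda>E. a / 4 \<le> \<bar>num A E - Exv (num A)\<bar>) + Pr (\<lambda>E. a / 4 \<le> \<bar>num ?AB E - Exv (num ?AB)\<bar>)"
    by (rule prob_disj_le[OF p0 p1])
  also have "\<dots> \<le> ?t + ?t"
    using assms by (intro add_mono num_concentration local_at_conj increasing_conj) auto
  finally show ?thesis by (simp only: mult_2)
qed

text \<open>A component with more than \<open>k0\<close> vertices either reaches distance
  \<open>R\<close> or lies in the ball of radius \<open>R\<close>; the latter is unlikely by the
  expected ball size.\<close>

lemma Pr_arm_ge:
  assumes "v \<in> V" "k0 < m" "m \<le> n" "0 < k0"
    "real (n - m) / real (m - k0) \<le> x" "1 + x \<le> exp (p * real (n - m))"
  shows "1 - 1 / (1 + x) - real (R + 1) * g ^ R / real k0 \<le> Pr (arm V R v)"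
proof -
  have "1 - 1 / (1 + x) \<le> 1 - Pr (\<lambda>E. card (cmp E v) \<le> k0)"
    using Pr_component_le[OF assms(1,2,3,5,6)] by simp
  also have "\<dots> = Pr (\<lambda>E. \<not> card (cmp E v) \<le> k0)" using prob_Not[OF finite_all_edges] by metis
  also have "\<dots> \<le> Pr (\<lambda>E. arm V R v E \<or> real k0 \<le> real (card (ball E R {v})))"
  proof (rule Pr_mono)
    fix E assume E: "E \<subseteq> F" "\<not> card (cmp E v) \<le> k0"
    show "arm V R v E \<or> real k0 \<le> real (card (ball E R {v}))"
    proof (cases "cmp E v \<subseteq> ball E R {v}")
      case True
      then have "card (cmp E v) \<le> card (ball E R {v})"
        by (intro card_mono finite_subset[OF ball_sub_V[OF E(1) assms(1)]]) simp_all
      then show ?thesis using E(2) by simp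
    next
      case False
      obtain w where w: "at_dist E R v w" using far_if_not_covered[OF False] by blast
      then have "w \<in> V" using ball_sub_V[OF E(1) assms(1)] by (auto simp: at_dist_def)
      then show ?thesis using arm_at_dist[OF edges_sub[OF E(1)] w] by simp
    qed
  qed
  also have "\<dots> \<le> Pr (arm V R v) + Pr (\<lambda>E. real k0 \<le> real (card (ball E R {v})))"
    by (rule prob_disj_le[OF p0 p1])
  also have "\<dots> \<le> Pr (arm V R v) + real (R + 1) * g ^ R / real k0"
    using assms by (intro add_left_mono Pr_ball_large_le) auto
  finally show ?thesis by simp
qed

text \<open>Without a component above \<open>k0\<close> every vertex with an arm lies in a small
  component, so two counts coincide. The first is local and concentrates around a mean of at least n
  \<sigma>; the second has small mean by the subcritical comparison, and Markov's inequality applies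
  to it.\<close>

lemma Pr_no_giant_le:
  assumes k0: "k0 < m" "m \<le> n" "0 < k0"
    and x: "real (n - m) / real (m - k0) \<le> x" "1 + x \<le> exp (p * real (n - m))"
    and \<sigma>: "0 < \<sigma>" "\<sigma> \<le> 1 - 1 / (1 + x) - real (j + k + 1) * g ^ (j + k) / real k0"
  shows "Pr (\<lambda>E. \<not> (\<exists>v\<in>V. k0 < card (cmp E v)))
    \<le> real n * (real (2 * (j + k) + 1) * g ^ (2 * (j + k))) / (real n * \<sigma> / 2)\<^sup>2
      + 2 * ((real m * p) ^ j * (4 * g ^ k / (real k + 4))) / \<sigma>"
proof -
  let ?A = "arm V (j + k)" and ?S = "\<lambda>v E. card (cmp E v) \<le> k0 \<and> arm V (j + k) v E"
  let ?z = "real n * \<sigma> / 2" and ?\<tau> = "(real m * p) ^ j * (4 * g ^ k / (real k + 4))"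
  have z: "0 < ?z" using \<sigma>(1) n2 by simp
  have "\<sigma> \<le> Pr (?A v)" if "v \<in> V" for v
    using Pr_arm_ge[OF that k0 x, of "j + k"] \<sigma>(2) by linarith
  then have ex: "real n * \<sigma> \<le> Exv (num ?A)"
    unfolding Exv_num using sum_mono[of V "\<lambda>_. \<sigma>" "\<lambda>v. Pr (?A v)"] by simp
  have "Pr (\<lambda>E. \<not> (\<exists>v\<in>V. k0 < card (cmp E v)))
      \<le> Pr (\<lambda>E. ?z \<le> \<bar>num ?A E - Exv (num ?A)\<bar> \<or> ?z \<le> num ?S E)"
  proof (rule Pr_mono)
    fix E assume "\<not> (\<exists>v\<in>V. k0 < card (cmp E v))"
    then have "card (cmp E v) \<le> k0" if "v \<in> V" for v using that by (meson not_le)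
    then have "num ?S E = num ?A E" unfolding num_def by (intro sum.cong) auto
    then show "?z \<le> \<bar>num ?A E - Exv (num ?A)\<bar> \<or> ?z \<le> num ?S E" using ex by argo
  qed
  also have "\<dots> \<le> Pr (\<lambda>E. ?z \<le> \<bar>num ?A E - Exv (num ?A)\<bar>) + Pr (\<lambda>E. ?z \<le> num ?S E)"
    by (rule prob_disj_le[OF p0 p1])
  also have "\<dots> \<le> real n * (real (2 * (j + k) + 1) * g ^ (2 * (j + k))) / ?z\<^sup>2 + real n * ?\<tau> / ?z"
    using z by (intro add_mono num_concentration local_at_arm increasing_arm
        Pr_num_ge Pr_arm_component_le[OF _ k0(1,2) x]) auto
  also have "real n * ?\<tau> / ?z = 2 * ?\<tau> / \<sigma>"
  proof -
    have "N * t / (N * \<sigma> / 2) = 2 * t / \<sigma>" if "N \<noteq> 0" for N t :: real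
      using that \<sigma>(1) by (simp add: field_simps)
    then show ?thesis using n2 by simp
  qed
  finally show ?thesis .
qed

text \<open>\<open>C\<close> has more than \<open>k0\<close> vertices, so it is not covered by the
  ball of radius 4h around any of its vertices outside the first bad set, and each of these has an
  arm of length 3h. Avoiding the second bad set then forces the large ball of radius 2h. The bad
  vertices number fewer than 2a, at most half of \<open>C\<close>.\<close>

lemma spread_largest_ge:
  assumes E: "E \<subseteq> F" and C: "is_largest_component n E C"
    and giant: "\<exists>v\<in>V. k0 < card (cmp E v)"
    and n1: "num (\<lambda>v E. L \<le> real (card (ball E (4 * h) {v}))) E < a"
    and n2: "num (\<lambda>v E. arm V (3 * h) v E \<and> \<not> l \<le> real (card (ball E (2 * h) {v}))) E < a"
    and par: "0 < L" "0 < l" "4 * L \<le> real k0" "4 * a \<le> real k0"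
  shows "l / (8 * L) * (real h)\<^sup>2 \<le> spread C E"
proof -
  let ?B1 = "{v\<in>V. L \<le> real (card (ball E (4 * h) {v}))}"
  let ?B2 = "{v\<in>V. arm V (3 * h) v E \<and> \<not> l \<le> real (card (ball E (2 * h) {v}))}"
  obtain v0 where v0: "v0 \<in> V" "C = cmp E v0"
    using C component_eq_cmp[OF E] unfolding is_largest_component_def components_def by auto
  obtain v1 where v1: "v1 \<in> V" "k0 < card (cmp E v1)" using giant by blast
  have "card (component n E v1) \<le> card C"
    using C v1(1) unfolding is_largest_component_def components_def by blast
  then have cC: "k0 < card C" using v1 component_eq_cmp[OF E] by simp
  have CV: "C \<subseteq> V" unfolding v0(2) cmp_def using ball_sub_V[OF E v0(1)] by blast
  then have fC: "finite C" using finite_subset by blast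
  define G where "G = C - (?B1 \<union> ?B2)"
  have "card C \<le> card G + (card ?B1 + card ?B2)"
  proof -
    have "card C \<le> card (G \<union> (?B1 \<union> ?B2))" using CV by (intro card_mono) (auto simp: G_def fC)
    also have "\<dots> \<le> card G + card (?B1 \<union> ?B2)" by (rule card_Un_le)
    also have "card (?B1 \<union> ?B2) \<le> card ?B1 + card ?B2" by (rule card_Un_le)
    finally show ?thesis by simp
  qed
  moreover have "real (card ?B1) < a" "real (card ?B2) < a" using n1 n2 by (simp_all add: num_eq_card)
  ultimately have "real (card C) < real (card G) + 2 * a" by linarith
  then have G2: "card C \<le> 2 * card G" using par(4) cC by linarith
  have l: "l \<le> real (card (ball E (2 * h) {v}))" and L: "real (card (ball E (4 * h) {v})) \<le> L"
    if v: "v \<in> G" for v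
  proof -
    have vV: "v \<in> V" using v CV by (auto simp: G_def)
    show L: "real (card (ball E (4 * h) {v})) \<le> L" using v vV by (auto simp: G_def)
    have "v \<in> cmp E v0" using v v0(2) by (simp add: G_def)
    then have Cv: "cmp E v = C" unfolding v0(2) by (rule cmp_eq)
    have nc: "\<not> cmp E v \<subseteq> ball E (3 * h) {v}"
    proof
      assume "cmp E v \<subseteq> ball E (3 * h) {v}"
      also have "\<dots> \<subseteq> ball E (4 * h) {v}" by (rule ball_mono_radius) simp
      finally have "card C \<le> card (ball E (4 * h) {v})"
        unfolding Cv by (intro card_mono finite_subset[OF ball_sub_V[OF E vV]]) simp_all
      then show False using L cC par by linarith
    qed
    obtain w where w: "at_dist E (3 * h) v w" using far_if_not_covered[OF nc] by blast
    then have "w \<in> V" using ball_sub_V[OF E vV] by (auto simp: at_dist_def)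
    then have "arm V (3 * h) v E" using arm_at_dist[OF edges_sub[OF E] w] by simp
    then show "l \<le> real (card (ball E (2 * h) {v}))" using v vV by (auto simp: G_def)
  qed
  show ?thesis unfolding v0(2)
  proof (rule spread_ge_of_ball_growth)
    show "G \<subseteq> cmp E v0" using v0(2) by (auto simp: G_def)
    show "card (cmp E v0) \<le> 2 * card G" using G2 v0(2) by simp
    show "4 * L \<le> real (card (cmp E v0))" using par cC unfolding v0(2) by linarith
  qed (use fC v0 par l L in auto)
qed

end

subsection \<open>Proof of the theorem\<close>

context gnp
begin

text \<open>The intersection with \<open>V\<close> keeps the sets finite: for an arbitrary edge set the ball may be
  infinite, with \<open>card\<close> equal to \<open>0\<close>, and monotonicity would fail.\<close>

lemma increasing_ball_card: "increasing (\<lambda>E. L \<le> real (card (ball E r {v} \<inter> V)))"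
proof (rule increasingI)
  fix E E' assume "E \<subseteq> E'" "L \<le> real (card (ball E r {v} \<inter> V))"
  moreover have "card (ball E r {v} \<inter> V) \<le> card (ball E' r {v} \<inter> V)" if "E \<subseteq> E'"
    using ball_mono_edges[OF that, of r "{v}"] by (intro card_mono) auto
  ultimately show "L \<le> real (card (ball E' r {v} \<inter> V))" by force
qed

lemma local_at_ball_card: "local_at r v (\<lambda>E. L \<le> real (card (ball E r {v} \<inter> V)))"
  unfolding local_at_def by (simp add: ball_restrict)

lemma ball_Int_V: "E \<subseteq> F \<Longrightarrow> v \<in> V \<Longrightarrow> ball E r {v} \<inter> V = ball E r {v}"
  using ball_sub_V by blast

lemma Pr_num_ball_ge_le:
  assumes "0 < L" "0 < a" "real n * (real (r + 1) * g ^ r / L) \<le> a / 2"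
  shows "Pr (\<lambda>E. a \<le> num (\<lambda>v E. L \<le> real (card (ball E r {v}))) E)
    \<le> real n * (real (2 * r + 1) * g ^ (2 * r)) / (a / 2)\<^sup>2"
proof -
  let ?H = "\<lambda>v E. L \<le> real (card (ball E r {v} \<inter> V))"
  have "Pr (\<lambda>E. a \<le> num (\<lambda>v E. L \<le> real (card (ball E r {v}))) E) = Pr (\<lambda>E. a \<le> num ?H E)"
  proof (rule prob_cong)
    fix E assume E: "E \<subseteq> F"
    have "num (\<lambda>v E. L \<le> real (card (ball E r {v}))) E = num ?H E"
      unfolding num_def by (intro sum.cong) (simp_all only: ball_Int_V[OF E] refl)
    then show "(a \<le> num (\<lambda>v E. L \<le> real (card (ball E r {v}))) E) = (a \<le> num ?H E)" by simp
  qed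
  also have "\<dots> \<le> real n * (real (2 * r + 1) * g ^ (2 * r)) / (a / 2)\<^sup>2"
  proof (rule Pr_num_large_le[where x = "real (r + 1) * g ^ r / L"])
    fix v assume v: "v \<in> V"
    have "Pr (?H v) = Pr (\<lambda>E. L \<le> real (card (ball E r {v})))"
      using ball_Int_V[OF _ v] by (intro prob_cong) simp
    also have "\<dots> \<le> real (r + 1) * g ^ r / L" using assms(1) v by (intro Pr_ball_large_le)
    finally show "Pr (?H v) \<le> real (r + 1) * g ^ r / L" .
  qed (use assms in \<open>simp_all add: local_at_ball_card increasing_ball_card\<close>)
  finally show ?thesis .
qed

lemma Pr_num_arm_small_ball_ge_le:
  assumes "1 \<le> h" "0 < \<kappa>" "0 < a"
    "real n * (64 * \<kappa> * g ^ (6 * h) / real h + 24 * (real h)\<^sup>2 * (p * g ^ (9 * h))) \<le> a / 2"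
  shows "Pr (\<lambda>E. a \<le> num (\<lambda>v E. arm V (3 * h) v E \<and> \<not> \<kappa> * (real h)\<^sup>2 \<le> real (card (ball E (2 * h) {v}))) E)
    \<le> 2 * (real n * (real (2 * (3 * h) + 1) * g ^ (2 * (3 * h))) / (a / 4)\<^sup>2)"
proof -
  let ?x = "64 * \<kappa> * g ^ (6 * h) / real h + 24 * (real h)\<^sup>2 * (p * g ^ (9 * h))"
  let ?L = "\<kappa> * (real h)\<^sup>2"
  let ?B = "\<lambda>v E. ?L \<le> real (card (ball E (2 * h) {v} \<inter> V))"
  let ?N = "\<lambda>v E. arm V (3 * h) v E \<and> \<not> ?L \<le> real (card (ball E (2 * h) {v}))"
  have "Pr (\<lambda>E. a \<le> num ?N E) = Pr (\<lambda>E. a \<le> num (\<lambda>v E. arm V (3 * h) v E \<and> \<not> ?B v E) E)"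
  proof (rule prob_cong)
    fix E assume E: "E \<subseteq> F"
    have "num ?N E = num (\<lambda>v E. arm V (3 * h) v E \<and> \<not> ?B v E) E"
      unfolding num_def by (intro sum.cong) (simp_all only: ball_Int_V[OF E] refl)
    then show "(a \<le> num ?N E) = (a \<le> num (\<lambda>v E. arm V (3 * h) v E \<and> \<not> ?B v E) E)" by simp
  qed
  also have "\<dots> \<le> 2 * (real n * (real (2 * (3 * h) + 1) * g ^ (2 * (3 * h))) / (a / 4)\<^sup>2)"
  proof (rule Pr_num_Diff_large_le[where x = ?x])
    fix v assume v: "v \<in> V"
    show "local_at (3 * h) v (?B v)"
      by (rule local_at_mono[OF local_at_ball_card increasing_ball_card]) simp
    have "Pr (\<lambda>E. arm V (3 * h) v E \<and> \<not> ?B v E) =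
        Pr (\<lambda>E. arm V (3 * h) v E \<and> real (card (ball E (2 * h) {v})) < ?L)"
      by (intro prob_cong) (simp only: ball_Int_V[OF _ v] not_le)
    also have "\<dots> \<le> ?x" by (rule Pr_arm_small_ball_le[OF v assms(1,2)])
    finally show "Pr (\<lambda>E. arm V (3 * h) v E \<and> \<not> ?B v E) \<le> ?x" .
  qed (use assms in \<open>simp_all add: local_at_arm increasing_arm increasing_ball_card\<close>)
  finally show ?thesis .
qed

end

text \<open>This is \<open>\<kappa> / (8 K 18\<^sup>2)\<close> with \<open>\<kappa> = 10\<^sup>-\<^sup>6\<close>, \<open>K = 40000\<close> and \<open>h \<ge> 1 / (18 \<epsilon>)\<close>.\<close>

definition spread_const :: real where
  "spread_const = 1 / (10 ^ 6 * 320000 * 324)"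

text \<open>To second order the left side is 1 + y + y^2 + y \<epsilon> / 8 and the right side is 1
  + y + \<epsilon> y + y^2 / 2, so y/2 + \<epsilon>/8 must stay below \<epsilon>. For y near
  3\<epsilon>/2 a positive multiple of \<epsilon> remains to absorb the higher terms.\<close>

lemma exp_component_bound:
  fixes \<epsilon> y :: real
  assumes e: "0 < \<epsilon>" "\<epsilon> \<le> 1/100" and y: "3/2 * \<epsilon> \<le> y" "y \<le> 151/100 * \<epsilon>"
  shows "1 + y / (1 - y - \<epsilon> / 8) \<le> exp ((1 + \<epsilon>) * y)"
proof -
  define s where "s = (1 + \<epsilon>) * y"
  have y0: "0 < y" using e y by linarith
  have s: "y * (1 + \<epsilon> + y / 2) \<le> s + s\<^sup>2 / 2" "0 \<le> s"
  proof -
    have "y \<le> s" using y0 e by (simp add: s_def)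
    then have "y\<^sup>2 \<le> s\<^sup>2" using y0 by (intro power_mono) auto
    then show "y * (1 + \<epsilon> + y / 2) \<le> s + s\<^sup>2 / 2" by (simp add: s_def power2_eq_square algebra_simps)
    show "0 \<le> s" using \<open>y \<le> s\<close> y0 by linarith
  qed
  have pos: "0 < 1 - y - \<epsilon> / 8" using e y by linarith
  have "(\<epsilon> + y / 2) * (y + \<epsilon> / 8) \<le> (2 * \<epsilon>) * (2 * \<epsilon>)"
    using e y y0 by (intro mult_mono) auto
  also have "\<dots> \<le> 1/25 * \<epsilon>" using e by simp
  finally have "(\<epsilon> + y / 2) * (y + \<epsilon> / 8) \<le> 1/25 * \<epsilon>" .
  moreover have "(1 + \<epsilon> + y / 2) * (1 - y - \<epsilon> / 8)
      = 1 + \<epsilon> + y / 2 - (y + \<epsilon> / 8) - (\<epsilon> + y / 2) * (y + \<epsilon> / 8)"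
    by (simp add: field_simps)
  ultimately have "1 \<le> (1 + \<epsilon> + y / 2) * (1 - y - \<epsilon> / 8)"
    using y e by linarith
  then have "y * 1 \<le> y * ((1 + \<epsilon> + y / 2) * (1 - y - \<epsilon> / 8))" using y0 by (intro mult_left_mono) auto
  also have "\<dots> = (y * (1 + \<epsilon> + y / 2)) * (1 - y - \<epsilon> / 8)" by (simp only: mult.assoc)
  also have "\<dots> \<le> (s + s\<^sup>2 / 2) * (1 - y - \<epsilon> / 8)" using s pos by (intro mult_right_mono) auto
  finally have "y / (1 - y - \<epsilon> / 8) \<le> s + s\<^sup>2 / 2" using pos by (simp add: divide_le_eq)
  also have "1 + (s + s\<^sup>2 / 2) \<le> exp s" using exp_lower_Taylor_quadratic[OF s(2)] by simp
  finally show ?thesis by (simp add: s_def)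
qed

text \<open>A bound for a single n. \<open>D\<close> measures the length of the arms used to find
  the giant, in units of h: it is fixed first to make the exponential term small, and then w tends
  to infinity.\<close>

lemma gnp_spread_fail:
  fixes n D :: nat and \<epsilon> :: real
  defines "w \<equiv> \<epsilon> ^ 3 * real n"
  assumes e: "0 < \<epsilon>" "\<epsilon> \<le> 1/100" and w: "100000 \<le> w" "32 * (real D + 1) * exp (real D + 1) \<le> w"
  shows "prob ((1 + \<epsilon>) / real n) (all_edges n)
      (\<lambda>E. \<not> (\<forall>C. is_largest_component n E C \<longrightarrow> spread_const / \<epsilon>\<^sup>2 \<le> spread C E))
    \<le> (16 * (real D + 1) * exp (real D + 1) + 1000000) / w + 864 * exp (- real D / 36)"
proof -
  define N where "N = real n"
  define p where "p = (1 + \<epsilon>) / N"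
  define g where "g = 1 + \<epsilon>"
  define eD where "eD = exp (real D + 1)"
  have w0: "0 < w" using w by simp
  have wN: "w = \<epsilon> ^ 3 * N" by (simp add: w_def N_def)
  have w2: "w = \<epsilon> * (\<epsilon> * (\<epsilon> * N))" by (simp add: wN power3_eq_cube)
  have eN: "1000000000 \<le> \<epsilon> * N"
  proof -
    have N0: "0 \<le> \<epsilon> * N" using e by (simp add: N_def)
    have "\<epsilon> * (\<epsilon> * (\<epsilon> * N)) \<le> 1/100 * (1/100 * (\<epsilon> * N))"
      using e N0 by (intro mult_mono) (auto simp: N_def)
    then show ?thesis using w w2 by simp
  qed
  have N: "1000000000 \<le> N"
  proof -
    have "\<epsilon> * N \<le> 1 * N" using e by (intro mult_right_mono) (auto simp: N_def)
    then show ?thesis using eN by linarith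
  qed
  have N0: "0 < N" using N by simp
  have Np: "N * p = 1 + \<epsilon>" using N0 by (simp add: p_def)
  have pN: "p \<le> 2 / N" using e N0 by (simp add: p_def divide_right_mono)
  interpret gnp n p g
  proof
    show "2 \<le> n" using N by (simp add: N_def)
    show "0 \<le> p" using e N0 by (simp add: p_def)
    have "2 / N \<le> 1 / 2" using N by (simp add: field_simps)
    then show "p \<le> 1 / 2" using pN by linarith
    show "real n * p \<le> g" "1 \<le> g" using Np e by (auto simp: g_def N_def)
  qed
  have gexp: "g ^ r \<le> exp (\<epsilon> * real r)" for r
  proof -
    have "g ^ r \<le> exp \<epsilon> ^ r" using e by (intro power_mono) (auto simp: g_def)
    also have "\<dots> = exp (\<epsilon> * real r)" by (rule exp_of_nat2_mult[symmetric])
    finally show ?thesis .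
  qed
  have g0: "0 \<le> g ^ r" for r using g1 by simp

  \<comment> \<open>The largest power of \<open>g\<close> that occurs outside the giant estimate is
    \<open>g ^ (9 * h)\<close>, from lollipops of arms of length 3h; it stays below e. Rounding down
    still leaves h >= 1 / (18 \<epsilon>).\<close>
  define h where "h = nat \<lfloor>1 / (9 * \<epsilon>)\<rfloor>"
  have h: "1 \<le> h" "9 * (\<epsilon> * real h) \<le> 1" "1 \<le> 18 * (\<epsilon> * real h)"
  proof -
    have q: "11 \<le> 1 / (9 * \<epsilon>)" using e by (simp add: field_simps)
    then have f: "(11::int) \<le> \<lfloor>1 / (9 * \<epsilon>)\<rfloor>" by (simp add: le_floor_iff)
    then have "real h = of_int \<lfloor>1 / (9 * \<epsilon>)\<rfloor>" unfolding h_def by (intro of_nat_nat) linarith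
    then have b: "real h \<le> 1 / (9 * \<epsilon>)" "1 / (9 * \<epsilon>) < real h + 1" by linarith+
    have "1 \<le> real h" using b(2) q by linarith
    then show "1 \<le> h" by simp
    show "9 * (\<epsilon> * real h) \<le> 1" using b(1) e by (simp add: field_simps)
    have "1 < 9 * (\<epsilon> * real h) + 9 * \<epsilon>" using b(2) e by (simp add: field_simps)
    then show "1 \<le> 18 * (\<epsilon> * real h)" using e by linarith
  qed
  have hr: "1 \<le> real h" using h(1) by simp
  have g3: "g ^ r \<le> 3" if "r \<le> 9 * h" for r
  proof -
    have "\<epsilon> * real r \<le> \<epsilon> * real (9 * h)" using that e by (intro mult_left_mono) auto
    also have "\<dots> \<le> 1" using h(2) by simp
    finally have "exp (\<epsilon> * real r) \<le> exp 1" by simp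
    also have "\<dots> \<le> 3" by (rule exp_le)
    finally show ?thesis using gexp[of r] by linarith
  qed
  have ih: "1 / real h \<le> 18 * \<epsilon>" using h(3) hr by (simp add: divide_le_eq mult.assoc)
  have rh: "real r \<le> 1 / \<epsilon>" if "r \<le> 9 * h" for r
  proof -
    have "\<epsilon> * real r \<le> \<epsilon> * real (9 * h)" using that e by (intro mult_left_mono) auto
    also have "\<dots> \<le> 1" using h(2) by simp
    finally show ?thesis using e by (simp add: field_simps)
  qed

  define k0 where "k0 = nat \<lfloor>\<epsilon> * N / 8\<rfloor>"
  have k0: "real k0 \<le> \<epsilon> * N / 8" "\<epsilon> * N / 16 \<le> real k0" "0 < k0"
  proof -
    have "real k0 = of_int \<lfloor>\<epsilon> * N / 8\<rfloor>" unfolding k0_def using eN by (intro of_nat_nat) simp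
    then have b: "real k0 \<le> \<epsilon> * N / 8" "\<epsilon> * N / 8 < real k0 + 1" by linarith+
    show "real k0 \<le> \<epsilon> * N / 8" by (rule b)
    show 1: "\<epsilon> * N / 16 \<le> real k0" using b(2) eN by simp
    have "0 < real k0" using 1 eN by linarith
    then show "0 < k0" by simp
  qed
  \<comment> \<open>The number of vertices removed. It exceeds \<epsilon> n, to make the remaining
    graph subcritical, and keeps \<open>y\<close> within the range of
    \<open>exp_component_bound\<close>.\<close>
  define d where "d = nat \<lceil>3/2 * (\<epsilon> * N)\<rceil>"
  have d: "3/2 * (\<epsilon> * N) \<le> real d" "real d \<le> 151/100 * (\<epsilon> * N)"
  proof -
    have "real d = of_int \<lceil>3/2 * (\<epsilon> * N)\<rceil>" unfolding d_def using eN by (intro of_nat_nat) linarith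
    then have b: "3/2 * (\<epsilon> * N) \<le> real d" "real d < 3/2 * (\<epsilon> * N) + 1" by linarith+
    show "3/2 * (\<epsilon> * N) \<le> real d" by (rule b)
    show "real d \<le> 151/100 * (\<epsilon> * N)" using b(2) eN by linarith
  qed
  have eN1: "\<epsilon> * N \<le> N / 100" using e N0 by simp
  define m where "m = n - d"
  have dn: "d < n" "real d + real k0 < N"
  proof -
    show "real d + real k0 < N" using d(2) k0(1) eN1 N0 by linarith
    then show "d < n" by (simp add: N_def)
  qed
  have m: "k0 < m" "m \<le> n" "n - m = d" "real m = N - real d"
    using dn by (auto simp: m_def N_def of_nat_diff)
  define y where "y = real d / N"
  define x where "x = y / (1 - y - \<epsilon> / 8)"
  have y: "3/2 * \<epsilon> \<le> y" "y \<le> 151/100 * \<epsilon>" using d N0 by (auto simp: y_def field_simps)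
  have y1: "0 < 1 - y - \<epsilon> / 8" using y e by linarith
  have x1: "real (n - m) / real (m - k0) \<le> x"
  proof -
    have "real (m - k0) = N - real d - real k0" using m by (simp add: of_nat_diff)
    moreover have "(1 - y - \<epsilon> / 8) * N \<le> N - real d - real k0"
      using k0(1) N0 by (simp add: y_def left_diff_distrib)
    ultimately have "real (n - m) / real (m - k0) \<le> real d / ((1 - y - \<epsilon> / 8) * N)"
      using m(3) y1 N0 by (intro frac_le) auto
    also have "\<dots> = x" by (simp add: x_def y_def mult.commute)
    finally show ?thesis .
  qed
  have x2: "1 + x \<le> exp (p * real (n - m))"
  proof -
    have "p * real (n - m) = (1 + \<epsilon>) * y" using m(3) by (simp add: p_def y_def)
    then show ?thesis unfolding x_def using exp_component_bound[OF e y] by simp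
  qed
  have x3: "\<epsilon> \<le> 1 - 1 / (1 + x)"
  proof -
    have "y \<le> x" unfolding x_def using y y1 e by (simp add: le_divide_eq mult_left_le)
    then have xx: "3/2 * \<epsilon> \<le> x" using y by linarith
    have "1 \<le> (1 - \<epsilon>) * (1 + 3/2 * \<epsilon>)"
      using mult_mono[of \<epsilon> "1/100" \<epsilon> \<epsilon>] e by (simp add: algebra_simps)
    also have "\<dots> \<le> (1 - \<epsilon>) * (1 + x)" using xx e by (intro mult_left_mono) auto
    finally show ?thesis using xx e by (simp add: field_simps)
  qed

  \<comment> \<open>\<open>D * h\<close> steps for the exponential decay in the smaller graph,
    followed by \<open>h\<close> steps for the one-arm factor of order \<epsilon>, which cancels the
    density of vertices with arms.\<close>
  define R where "R = D * h + h"
  have eR: "\<epsilon> * real R \<le> (real D + 1) / 9"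
  proof -
    have "\<epsilon> * real R = (real D + 1) * (\<epsilon> * real h)" by (simp add: R_def algebra_simps)
    also have "\<dots> \<le> (real D + 1) * (1 / 9)" using h(2) by (intro mult_left_mono) auto
    finally show ?thesis by simp
  qed
  have eD1: "1 \<le> eD" unfolding eD_def by simp
  have gR: "g ^ (2 * R) \<le> eD" "g ^ R \<le> eD"
  proof -
    have "\<epsilon> * real (2 * R) \<le> real D + 1"
    proof -
      have "\<epsilon> * real (2 * R) = 2 * (\<epsilon> * real R)" by simp
      also have "\<dots> \<le> 2 * ((real D + 1) / 9)" using eR by (rule mult_left_mono) simp
      also have "\<dots> \<le> real D + 1" by simp
      finally show ?thesis .
    qed
    then have "exp (\<epsilon> * real (2 * R)) \<le> eD" unfolding eD_def exp_le_cancel_iff .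
    then show "g ^ (2 * R) \<le> eD" using gexp[of "2 * R"] by linarith
    moreover have "g ^ R \<le> g ^ (2 * R)" using g1 by (intro power_increasing) auto
    ultimately show "g ^ R \<le> eD" by linarith
  qed
  have R2: "real (2 * R + 1) \<le> (real D + 1) / \<epsilon>" "real (R + 1) \<le> (real D + 1) / \<epsilon>"
  proof -
    have "\<epsilon> * real (2 * R + 1) = 2 * (\<epsilon> * real R) + \<epsilon>" by (simp add: algebra_simps)
    also have "\<dots> \<le> real D + 1" using eR e by simp
    finally show "real (2 * R + 1) \<le> (real D + 1) / \<epsilon>" using e by (simp add: field_simps)
    then show "real (R + 1) \<le> (real D + 1) / \<epsilon>" by simp
  qed
  \<comment> \<open>Half of the survival probability \<epsilon> is given up for components that are
    large only because a ball of radius \<open>R\<close> is; the second lower bound on w serves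
    this.\<close>
  have \<sigma>: "\<epsilon> / 2 \<le> 1 - 1 / (1 + x) - real (R + 1) * g ^ R / real k0"
  proof -
    have "real (R + 1) * g ^ R / real k0 \<le> ((real D + 1) / \<epsilon> * eD) / (\<epsilon> * N / 16)"
      using R2 gR k0 e g0 eN eD1 by (intro frac_le mult_mono) auto
    also have "\<dots> = 16 * (real D + 1) * eD * \<epsilon> / w"
      using e N0 by (simp add: w2 field_simps)
    also have "\<dots> \<le> \<epsilon> / 2"
    proof -
      have "(32 * (real D + 1) * eD) * \<epsilon> \<le> w * \<epsilon>" using w(2) e by (intro mult_right_mono) (auto simp: eD_def)
      then show ?thesis using w0 by (simp add: field_simps)
    qed
    finally show ?thesis using x3 by linarith
  qed
  have Ng: "real n = N" by (simp add: N_def)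
  have B0: "Pr (\<lambda>E. \<not> (\<exists>v\<in>V. k0 < card (cmp E v))) \<le> 16 * (real D + 1) * eD / w + 864 * exp (- real D / 36)"
  proof -
    let ?T1 = "real n * (real (2 * R + 1) * g ^ (2 * R)) / (real n * (\<epsilon> / 2) / 2)\<^sup>2"
    let ?T2 = "2 * ((real m * p) ^ (D * h) * (4 * g ^ h / (real h + 4))) / (\<epsilon> / 2)"
    have "Pr (\<lambda>E. \<not> (\<exists>v\<in>V. k0 < card (cmp E v))) \<le> ?T1 + ?T2"
      using Pr_no_giant_le[OF m(1,2) k0(3) x1 x2 _ \<sigma>[unfolded R_def]] e by (simp add: R_def)
    also have "?T1 \<le> N * ((real D + 1) / \<epsilon> * eD) / (N * (\<epsilon> / 2) / 2)\<^sup>2"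
      unfolding Ng using R2 gR g0 N0 e by (intro divide_right_mono mult_left_mono mult_mono) auto
    also have "\<dots> = 16 * (real D + 1) * eD / w"
      using e N0 by (simp add: w2 power2_eq_square field_simps)
    \<comment> \<open>The mean degree is at most (1 - 3\<epsilon>/2)(1 + \<epsilon>) <= 1 -
      \<epsilon>/2, and \<epsilon> h >= 1/18 turns its power into exp(-D/36). The one-arm factor is
      at most 12/h, and 216 = 12 * 18.\<close>
    also have "?T2 \<le> 2 * (exp (- real D / 36) * (216 * \<epsilon>)) / (\<epsilon> / 2)"
    proof (intro divide_right_mono mult_left_mono mult_mono)
      have "real m = N * (1 - y)" using m(4) N0 by (simp add: y_def right_diff_distrib)
      then have "real m * p = (1 - y) * (1 + \<epsilon>)" using N0 by (simp add: p_def)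
      also have "\<dots> \<le> (1 - 3/2 * \<epsilon>) * (1 + \<epsilon>)" using y e by (intro mult_right_mono) auto
      also have "\<dots> \<le> 1 + (- \<epsilon> / 2)" using e by (simp add: algebra_simps)
      also have "\<dots> \<le> exp (- \<epsilon> / 2)" by (rule exp_ge_add_one_self)
      finally have "(real m * p) ^ (D * h) \<le> exp (- \<epsilon> / 2) ^ (D * h)"
        using p0 by (intro power_mono) auto
      also have "\<dots> = exp (- (real D * (\<epsilon> * real h)) / 2)"
        by (simp add: exp_of_nat_mult[symmetric] algebra_simps)
      also have "\<dots> \<le> exp (- real D / 36)"
      proof -
        have "real D * (1/18) \<le> real D * (\<epsilon> * real h)" using h(3) by (intro mult_left_mono) auto
        then show ?thesis by simp
      qed
      finally show "(real m * p) ^ (D * h) \<le> exp (- real D / 36)" .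
      have "4 * g ^ h / (real h + 4) \<le> 12 / real h"
        using g3[of h] hr by (intro frac_le) auto
      then show "4 * g ^ h / (real h + 4) \<le> 216 * \<epsilon>" using ih by simp
    qed (use e g0 in auto)
    also have "\<dots> = 864 * exp (- real D / 36)" using e by simp
    finally show ?thesis by simp
  qed

  \<comment> \<open>The tolerated number of bad vertices of each kind: 4a is \<epsilon> N / 16, the
    lower bound for \<open>k0\<close>.\<close>
  define a where "a = \<epsilon> * N / 64"
  \<comment> \<open>The expected size of a ball of radius 4h is at most 15 h, so 40000 brings the
    probability of exceeding \<open>L\<close> below \<epsilon>/128, that is, half of
    \<open>a\<close> in the mean.\<close>
  define L where "L = 40000 * (real h)\<^sup>2"
  \<comment> \<open>Small enough that 64 \<kappa> * 3 * 18 <= 1/256: the small-ball term takes half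
    of the allowance \<epsilon>/128 and the lollipop term the other half.\<close>
  define \<kappa> :: real where "\<kappa> = 1 / 10 ^ 6"
  have a0: "0 < a" using eN by (simp add: a_def)
  have L0: "0 < L" using hr by (simp add: L_def)
  \<comment> \<open>Here c is 2 for a single count and 4 for a difference of two counts, according
    to the share of \<open>a\<close> granted to each deviation.\<close>
  have small: "N * (real (2 * r + 1) * g ^ (2 * r)) / (a / c)\<^sup>2 \<le> 12288 * c\<^sup>2 / w" if "r \<le> 4 * h" "0 < c" for r c
  proof -
    have r: "2 * r + 1 \<le> 9 * h" using that h(1) by linarith
    have "N * (real (2 * r + 1) * g ^ (2 * r)) / (a / c)\<^sup>2 \<le> N * (1 / \<epsilon> * 3) / (a / c)\<^sup>2"
      using rh[OF r] g3[of "2 * r"] r g0 N0 e by (intro divide_right_mono mult_left_mono mult_mono) auto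
    also have "\<dots> = 12288 * c\<^sup>2 / w"
      using e N0 by (simp add: w2 a_def power2_eq_square field_simps)
    finally show ?thesis .
  qed
  have B1: "Pr (\<lambda>E. a \<le> num (\<lambda>v E. L \<le> real (card (ball E (4 * h) {v}))) E) \<le> 49152 / w"
  proof -
    have "real (4 * h + 1) * g ^ (4 * h) / L \<le> (5 * real h * 3) / L"
      using hr L0 g0 by (intro divide_right_mono mult_mono g3) auto
    also have "\<dots> = 3 / 8000 * (1 / real h)" using hr by (simp add: L_def power2_eq_square)
    also have "\<dots> \<le> 3 / 8000 * (18 * \<epsilon>)" using ih by (intro mult_left_mono) auto
    also have "\<dots> \<le> \<epsilon> / 128" using e by simp
    finally have "N * (real (4 * h + 1) * g ^ (4 * h) / L) \<le> N * (\<epsilon> / 128)"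
      using N0 by (intro mult_left_mono) auto
    then have "real n * (real (4 * h + 1) * g ^ (4 * h) / L) \<le> a / 2" by (simp add: Ng a_def mult.commute)
    from Pr_num_ball_ge_le[OF L0 a0 this]
    show ?thesis using small[of "4 * h" 2] by (simp add: Ng)
  qed
  have B2: "Pr (\<lambda>E. a \<le> num (\<lambda>v E. arm V (3 * h) v E \<and>
      \<not> \<kappa> * (real h)\<^sup>2 \<le> real (card (ball E (2 * h) {v}))) E) \<le> 393216 / w"
  proof -
    have t1: "64 * \<kappa> * g ^ (6 * h) / real h \<le> \<epsilon> / 256"
    proof -
      have "64 * \<kappa> * g ^ (6 * h) / real h \<le> 64 * \<kappa> * 3 / real h"
        by (intro divide_right_mono mult_left_mono g3) (auto simp: \<kappa>_def)
      also have "\<dots> = 192 * \<kappa> * (1 / real h)" by simp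
      also have "\<dots> \<le> 192 * \<kappa> * (18 * \<epsilon>)" using ih by (intro mult_left_mono) (auto simp: \<kappa>_def)
      also have "\<dots> \<le> \<epsilon> / 256" using e by (simp add: \<kappa>_def)
      finally show ?thesis .
    qed
    \<comment> \<open>The lollipop term is O(1 / (\<epsilon>^2 N)), which is O(\<epsilon> /
      w).\<close>
    have t2: "24 * (real h)\<^sup>2 * (p * g ^ (9 * h)) \<le> \<epsilon> / 256"
    proof -
      have "(real h)\<^sup>2 \<le> (1 / \<epsilon>)\<^sup>2" using rh[of h] by (intro power_mono) auto
      then have "24 * (real h)\<^sup>2 * (p * g ^ (9 * h)) \<le> 24 * (1 / \<epsilon>)\<^sup>2 * (2 / N * 3)"
        using pN p0 N0 g0 by (intro mult_mono g3) auto
      also have "\<dots> = 144 * \<epsilon> / w" using e N0 by (simp add: w2 power2_eq_square field_simps)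
      also have "\<dots> \<le> 144 * \<epsilon> / 100000" using w(1) e by (intro divide_left_mono) auto
      also have "\<dots> \<le> \<epsilon> / 256" using e by simp
      finally show ?thesis .
    qed
    have "N * (64 * \<kappa> * g ^ (6 * h) / real h + 24 * (real h)\<^sup>2 * (p * g ^ (9 * h))) \<le> N * (\<epsilon> / 128)"
      using t1 t2 N0 by (intro mult_left_mono) auto
    then have "real n * (64 * \<kappa> * g ^ (6 * h) / real h + 24 * (real h)\<^sup>2 * (p * g ^ (9 * h))) \<le> a / 2"
      by (simp add: Ng a_def mult.commute)
    from Pr_num_arm_small_ball_ge_le[OF h(1) _ a0 this]
    show ?thesis using small[of "3 * h" 4] by (simp add: Ng \<kappa>_def)
  qed
  have par: "4 * L \<le> real k0" "4 * a \<le> real k0"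
  proof -
    have "real h \<le> 1 / (9 * \<epsilon>)" using h(2) e by (simp add: field_simps)
    then have "(real h)\<^sup>2 \<le> (1 / (9 * \<epsilon>))\<^sup>2" by (intro power_mono) auto
    then have "4 * L \<le> 160000 * (1 / (9 * \<epsilon>))\<^sup>2" by (simp add: L_def)
    also have "\<dots> \<le> \<epsilon> * N / 16"
    proof -
      have "160000 * 16 \<le> 81 * w" using w(1) by simp
      then show ?thesis using e by (simp add: w2 power2_eq_square field_simps)
    qed
    finally show "4 * L \<le> real k0" using k0(2) by linarith
    show "4 * a \<le> real k0" using k0(2) unfolding a_def by linarith
  qed
  have const: "spread_const / \<epsilon>\<^sup>2 \<le> \<kappa> * (real h)\<^sup>2 / (8 * L) * (real h)\<^sup>2"
  proof -
    have "1 / (18 * \<epsilon>) \<le> real h" using h(3) e by (simp add: field_simps)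
    then have "(1 / (18 * \<epsilon>))\<^sup>2 \<le> (real h)\<^sup>2" using e by (intro power_mono) auto
    then have "\<kappa> / 320000 * (1 / (18 * \<epsilon>))\<^sup>2 \<le> \<kappa> / 320000 * (real h)\<^sup>2"
      by (intro mult_left_mono) (auto simp: \<kappa>_def)
    moreover have "\<kappa> / 320000 * (1 / (18 * \<epsilon>))\<^sup>2 = spread_const / \<epsilon>\<^sup>2"
      by (simp add: \<kappa>_def spread_const_def power2_eq_square)
    moreover have "\<kappa> * (real h)\<^sup>2 / (8 * L) = \<kappa> / 320000" using hr by (simp add: L_def)
    ultimately show ?thesis by (simp only:)
  qed
  let ?P0 = "\<lambda>E. \<not> (\<exists>v\<in>V. k0 < card (cmp E v))"
  let ?P1 = "\<lambda>E. a \<le> num (\<lambda>v E. L \<le> real (card (ball E (4 * h) {v}))) E"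
  let ?P2 = "\<lambda>E. a \<le> num (\<lambda>v E. arm V (3 * h) v E \<and>
      \<not> \<kappa> * (real h)\<^sup>2 \<le> real (card (ball E (2 * h) {v}))) E"
  have "Pr (\<lambda>E. \<not> (\<forall>C. is_largest_component n E C \<longrightarrow> spread_const / \<epsilon>\<^sup>2 \<le> spread C E))
     \<le> Pr (\<lambda>E. ?P0 E \<or> (?P1 E \<or> ?P2 E))"
  proof (rule Pr_mono, rule ccontr)
    fix E assume E: "E \<subseteq> F" and "\<not> (\<forall>C. is_largest_component n E C \<longrightarrow> spread_const / \<epsilon>\<^sup>2 \<le> spread C E)"
      and nP: "\<not> (?P0 E \<or> (?P1 E \<or> ?P2 E))"
    then obtain C where C: "is_largest_component n E C" and lt: "\<not> spread_const / \<epsilon>\<^sup>2 \<le> spread C E" by blast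
    have "\<kappa> * (real h)\<^sup>2 / (8 * L) * (real h)\<^sup>2 \<le> spread C E"
      by (rule spread_largest_ge[OF E C, of k0 L h a]) (use nP L0 hr par in \<open>auto simp: \<kappa>_def\<close>)
    then show False using const lt by linarith
  qed
  also have "\<dots> \<le> Pr ?P0 + (Pr ?P1 + Pr ?P2)"
    by (intro order_trans[OF prob_disj_le[OF p0 p1]] add_left_mono prob_disj_le[OF p0 p1])
  also have "\<dots> \<le> (16 * (real D + 1) * eD / w + 864 * exp (- real D / 36)) + (49152 / w + 393216 / w)"
    by (intro add_mono B0 B1 B2)
  also have "\<dots> \<le> (16 * (real D + 1) * eD + 1000000) / w + 864 * exp (- real D / 36)"
    using w0 by (simp add: add_divide_distrib[symmetric] divide_right_mono)
  finally show ?thesis by (simp add: p_def N_def eD_def)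
qed

theorem theorem4p1:
  fixes \<epsilon> :: "nat \<Rightarrow> real"
  assumes "\<epsilon> \<longlonglongrightarrow> 0"
    and "filterlim (\<lambda>n. \<epsilon> n ^ 3 * real n) at_top sequentially"
  shows "\<exists>\<gamma>>0. (\<lambda>n. gnp_prob n ((1 + \<epsilon> n) / real n)
            (\<lambda>E. \<forall>C. is_largest_component n E C \<longrightarrow> spread C E \<ge> \<gamma> / (\<epsilon> n)\<^sup>2))
          \<longlonglongrightarrow> 1"
proof (intro exI conjI)
  show "0 < spread_const" by (simp add: spread_const_def)
  let ?Q = "\<lambda>n E. \<forall>C. is_largest_component n E C \<longrightarrow> spread C E \<ge> spread_const / (\<epsilon> n)\<^sup>2"
  let ?p = "\<lambda>n. (1 + \<epsilon> n) / real n"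
  show "(\<lambda>n. gnp_prob n (?p n) (?Q n)) \<longlonglongrightarrow> 1"
  proof (rule tendstoI)
    fix \<eta> :: real assume \<eta>: "0 < \<eta>"
    \<comment> \<open>From exp t >= 1 + t; 1728 = 2 * 864 reserves half of \<eta> for the
      exponential term.\<close>
    obtain D :: nat where "36 * (1728 / \<eta>) < real D" using reals_Archimedean2 by blast
    then have "1728 / \<eta> < exp (real D / 36)" using exp_ge_add_one_self[of "real D / 36"] by linarith
    then have D: "864 * exp (- real D / 36) < \<eta> / 2"
      using \<eta> by (simp add: exp_minus field_simps)
    define c where "c = 16 * (real D + 1) * exp (real D + 1) + 1000000"
    have c0: "0 < c" by (simp add: c_def add_pos_pos)
    have "\<forall>\<^sub>F n in sequentially. \<epsilon> n < 1/100" using assms(1) by (rule order_tendstoD) simp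
    moreover have "\<forall>\<^sub>F n in sequentially. max (2 * c + 1) (2 * c / \<eta> + 1) \<le> \<epsilon> n ^ 3 * real n"
      using assms(2) unfolding filterlim_at_top by blast
    ultimately show "\<forall>\<^sub>F n in sequentially. dist (gnp_prob n (?p n) (?Q n)) 1 < \<eta>"
    proof eventually_elim
      case (elim n)
      define w where "w = \<epsilon> n ^ 3 * real n"
      have w: "2 * c + 1 \<le> w" "2 * c / \<eta> + 1 \<le> w" using elim(2) by (auto simp: w_def)
      have w0: "0 < w" using w(1) c0 by linarith
      have n0: "0 < real n" using w0 by (cases n) (auto simp: w_def)
      \<comment> \<open>Positivity of \<epsilon> is not among the assumptions; it follows for large
        n because the cube times n is positive.\<close>
      then have "0 < \<epsilon> n ^ 3" using w0 by (simp add: w_def zero_less_mult_iff)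
      then have e: "0 < \<epsilon> n" by (simp add: zero_less_power_eq)
      have big: "100000 \<le> w" "32 * (real D + 1) * exp (real D + 1) \<le> w"
      proof -
        define t where "t = (real D + 1) * exp (real D + 1)"
        have t: "0 \<le> t" "c = 16 * t + 1000000" by (simp_all add: t_def c_def mult.assoc)
        show "100000 \<le> w" using w(1) t by linarith
        show "32 * (real D + 1) * exp (real D + 1) \<le> w" using w(1) t(2) unfolding mult.assoc t_def[symmetric] by linarith
      qed
      have fail: "prob (?p n) (all_edges n) (\<lambda>E. \<not> ?Q n E) \<le> c / w + 864 * exp (- real D / 36)"
        using gnp_spread_fail[of "\<epsilon> n" n D] e elim(1) big by (simp add: w_def c_def)
      have "2 * c / \<eta> < w" using w(2) by linarith
      then have "c / w < \<eta> / 2" using w0 \<eta> by (simp add: field_simps)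
      then have "prob (?p n) (all_edges n) (\<lambda>E. \<not> ?Q n E) < \<eta>" using fail D by linarith
      then have ge: "1 - \<eta> < prob (?p n) (all_edges n) (?Q n)"
        using prob_Not[OF finite_all_edges[of n], of "?p n" "?Q n"] by linarith
      have "1 \<le> real n" using n0 by simp
      have "2 \<le> real n"
      proof -
        have "\<epsilon> n ^ 3 \<le> 1" using e elim(1) by (intro power_le_one) auto
        then have "w \<le> 1 * real n" unfolding w_def using n0 by (intro mult_right_mono) auto
        then show ?thesis using big(1) by linarith
      qed
      then have "?p n \<le> 1" using elim(1) by (simp add: field_simps)
      then have "prob (?p n) (all_edges n) (?Q n) \<le> 1"
        using e n0 by (intro prob_le_1 finite_all_edges) auto
      then show ?case using ge by (simp add: gnp_prob_eq dist_real_def)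
    qed
  qed
qed

end
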